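(* Let $F:\Sigma\to\Sigma$, $F(x,z)=(f(x),G(x,z))$, be a skew product satisfying all the assumptions on the base map $f$ and on the fiber map $G$ listed in the context. Then the operator $F_*:S^\infty\to S^\infty$ can be written as $F_*=P+N$, where $P,N:S^\infty\to S^\infty$ are linear operators such that: (a) $P$ is a projection, i.e. $P^2=P$, and $\dim P(S^\infty)=1$; (b) there are $0<\xi<1$ and $K_0>0$ such that $\|N^n(\mu)\|_{S^\infty}\le K_0\,\xi^n\,\|\mu\|_{S^\infty}$ for all $\mu\in S^\infty$ and all $n\ge 1$; (c) $PN=NP=0$.
   Context: Base map. Fix $0<\zeta<1$. $M$ is a compact connected Riemannian manifold with Riemannian distance $d_1$ and $\operatorname{diam}(M)=1$. For $h:M\to\mathbb R$ put $H_\zeta(h)=\sup_{x\neq y}|h(x)-h(y)|/d_1(x,y)^\zeta$, $H_\zeta=\{h:H_\zeta(h)<\infty\}$, $|h|_\zeta=H_\zeta(h)+|h|_\infty$. The map $f:M\to M$ is a local diffeomorphism and there is a continuous $\ell:M\to\mathbb R$ such that every $x\in M$ has a neighbourhood $U_x$ on which $f_x:=f|_{U_x}:U_x\to f(U_x)$ is invertible with $d_1(f_x^{-1}(y),f_x^{-1}(z))\le \ell(x)\,d_1(y,z)$ for $y,z\in f(U_x)$; $\deg(f)=\#f^{-1}(x)$ (constant in $x$). There are an open set $\mathcal A\subset M$ and constants $\sigma>1$, $L\ge 1$, $\epsilon_\rho>0$ and an integer $q<\deg(f)$ with: (f1) $\ell(x)\le L$ for $x\in\mathcal A$ and $\ell(x)<\sigma^{-1}$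 for $x\notin\mathcal A$; (f2) there is a finite covering of $M$ by open domains of injectivity of $f$ such that $\mathcal A$ can be covered by $q$ of them; (f3) $\sup\log\rho-\inf\log\rho<\epsilon_\rho$ and $H_\zeta(\rho)<\epsilon_\rho\inf\rho$; and $e^{\epsilon_\rho}\cdot\frac{(\deg(f)-q)\sigma^{-\zeta}+qL^\zeta[1+(L-1)^\zeta]}{\deg(f)}<1$. Here $m_1$ is the $f$-invariant Borel probability of maximal entropy, absolutely continuous with respect to a conformal measure (known to exist for such $f$), and $\rho=1/|\det f'|$, where $|\det f'|$ is the Jacobian of $f$ with respect to $m_1$. The Perron-Frobenius operator with respect to $m_1$ is $P_f(\varphi)(x)=\sum_{i=1}^{\deg(f)}\varphi(x_i)\rho(x_i)$, where $x_1,\dots,x_{\deg(f)}$ are the preimages of $x$; since $m_1$ is invariant, $P_f1=1$. It is known that there are $0<r<1$, $D>0$ with $|P_f^n\varphi|_\zeta\le Dr^n|\varphi|_\zeta$ for all $n\ge1$ and all $\varphi\in H_\zeta$ with $\int\varphi\,dm_1=0$. Fiber map. $(K,d_2)$ is a compact metric space, $\Sigma=M\times K$ with metric $d_1+d_2$, $G:\Sigma\to K$ is measurable, and (G1): there is $0<\alpha<1$ such that for $m_1$-a.e. $x\in M$, $d_2(G(x,z_1),G(x,z_2))\le\alpha\, d_2(z_1,z_2)$ for all $z_1,z_2\in K$. Measures. $\pi_x(x,y)=x$, $\pi_y(x,y)=y$. $\mathcal{AB}$ is the set of signed Borel measures $\mu$ on $\Sigma$, with Jordan decomposition $\mu=\mu^+-\mu^-$,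 such that $\pi_{x*}\mu^\pm\ll m_1$. A positive $\mu\in\mathcal{AB}$ has a Rokhlin disintegration $(\{\mu_\gamma\}_{\gamma\in M},\phi_xm_1)$ along the leaves $\{\gamma\}\times K$, with $\mu_\gamma$ a probability on $\{\gamma\}\times K$ and $\phi_x=d(\pi_{x*}\mu)/dm_1$; the restriction is the measure on $K$ given by $\mu|_\gamma=\pi_{y*}(\phi_x(\gamma)\mu_\gamma)$. For signed $\mu\in\mathcal{AB}$, $\mu|_\gamma=\mu^+|_\gamma-\mu^-|_\gamma$ and $\phi_x=\phi_x^+-\phi_x^-$, where $\phi_x^\pm$ are the marginal densities of $\mu^\pm$. For a signed measure $\nu$ on $K$, $\|\nu\|_W=\sup\{|\int g\,d\nu|: |g|_\infty\le1,\ H_\zeta(g)\le1\}$, with $g:K\to\mathbb R$ and $H_\zeta(g)$ the best $\zeta$-Hölder constant of $g$. $\mathcal L^\infty=\{\mu\in\mathcal{AB}:\|\mu\|_\infty<\infty\}$ with $\|\mu\|_\infty=\operatorname{ess\,sup}_\gamma\|\mu|_\gamma\|_W$ (with respect to $m_1$), and $S^\infty=\{\mu\in\mathcal L^\infty:\phi_x\in H_\zeta\}$ (i.e. $\phi_x$ has a version in $H_\zeta$) with norm $\|\mu\|_{S^\infty}=|\phi_x|_\zeta+\|\mu\|_\infty$. The transfer operator is the pushforward $(F_*\mu)(E)=\mu(F^{-1}(E))$. *)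

theory Defs
  imports "HOL-Probability.Probability"
begin

section \<open>Compact Riemannian manifolds as metric-space types\<close>

text \<open>
  A manifold is a type \<^typ>\<open>'m\<close> of class \<^class>\<open>metric_space\<close>; its dimension is that of the
  Euclidean space \<^typ>\<open>'e\<close> in which the charts take their values. A chart is an open
  set together with a coordinate map, of which only the values on that set matter.
\<close>

type_synonym ('m, 'e) chart = "'m set \<times> ('m \<Rightarrow> 'e)"

fun Ck_on :: "nat \<Rightarrow> ('a::real_normed_vector \<Rightarrow> 'b::real_normed_vector) \<Rightarrow> 'a set \<Rightarrow> bool" where
  "Ck_on 0 h S \<longleftrightarrow> continuous_on S h"
| "Ck_on (Suc k) h S \<longleftrightarrow>
     h differentiable_on S \<and> (\<forall>v. Ck_on k (\<lambda>x. frechet_derivative h (at x) v) S)"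

definition smooth_on :: "'a set \<Rightarrow> ('a::real_normed_vector \<Rightarrow> 'b::real_normed_vector) \<Rightarrow> bool" where
  "smooth_on S h \<longleftrightarrow> (\<forall>k. Ck_on k h S)"

definition smooth_atlas :: "('m::topological_space, 'e::euclidean_space) chart set \<Rightarrow> bool" where
  "smooth_atlas \<A> \<longleftrightarrow>
     (\<forall>(U, \<phi>)\<in>\<A>. open U \<and> open (\<phi> ` U) \<and> homeomorphism U (\<phi> ` U) \<phi> (inv_into U \<phi>)) \<and>
     (\<Union>(U, \<phi>)\<in>\<A>. U) = UNIV \<and>
     (\<forall>(U, \<phi>)\<in>\<A>. \<forall>(V, \<psi>)\<in>\<A>. smooth_on (\<phi> ` (U \<inter> V)) (\<psi> \<circ> inv_into U \<phi>))"

text \<open>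
  A Riemannian metric is given by its coordinate expressions: \<open>g (U, \<phi>) x\<close> is the inner product
  at the point of \<open>U\<close> with coordinate \<open>x \<in> \<phi> ` U\<close>. The last clause is the tensor transformation law.
\<close>

definition riemannian_metric ::
  "('m::topological_space, 'e::euclidean_space) chart set \<Rightarrow>
   (('m, 'e) chart \<Rightarrow> 'e \<Rightarrow> 'e \<Rightarrow> 'e \<Rightarrow> real) \<Rightarrow> bool" where
  "riemannian_metric \<A> g \<longleftrightarrow>
     (\<forall>(U, \<phi>)\<in>\<A>.
        (\<forall>x\<in>\<phi> ` U. bilinear (g (U, \<phi>) x) \<and>
           (\<forall>u v. g (U, \<phi>) x u v = g (U, \<phi>) x v u) \<and>
           (\<forall>u. u \<noteq> 0 \<longrightarrow> g (U, \<phi>) x u u > 0)) \<and>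
        (\<forall>u v. smooth_on (\<phi> ` U) (\<lambda>x. g (U, \<phi>) x u v))) \<and>
     (\<forall>(U, \<phi>)\<in>\<A>. \<forall>(V, \<psi>)\<in>\<A>. \<forall>p\<in>U \<inter> V. \<forall>u v.
        g (U, \<phi>) (\<phi> p) u v =
        g (V, \<psi>) (\<psi> p) (frechet_derivative (\<psi> \<circ> inv_into U \<phi>) (at (\<phi> p)) u)
                       (frechet_derivative (\<psi> \<circ> inv_into U \<phi>) (at (\<phi> p)) v))"

text \<open>
  \<open>curve_length \<A> g p q l\<close>: some piecewise C1 curve from \<open>p\<close> to \<open>q\<close> has length \<open>l\<close>. The curve is a
  finite concatenation of C1 pieces, each inside one chart and given by its coordinate curve.
\<close>

inductive curve_length ::
  "('m, 'e::euclidean_space) chart set \<Rightarrow> (('m, 'e) chart \<Rightarrow> 'e \<Rightarrow> 'e \<Rightarrow> 'e \<Rightarrow> real) \<Rightarrow>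
   'm \<Rightarrow> 'm \<Rightarrow> real \<Rightarrow> bool"
  for \<A> g where
  curve_const: "curve_length \<A> g p p 0"
| curve_step:
    "curve_length \<A> g p q l \<Longrightarrow> (U, \<phi>) \<in> \<A> \<Longrightarrow> q \<in> U \<Longrightarrow> r \<in> U \<Longrightarrow>
     c C1_differentiable_on {0..1} \<Longrightarrow> c ` {0..1} \<subseteq> \<phi> ` U \<Longrightarrow> c 0 = \<phi> q \<Longrightarrow> c 1 = \<phi> r \<Longrightarrow>
     curve_length \<A> g p r
       (l + integral {0..1} (\<lambda>t. sqrt (g (U, \<phi>) (c t) (vector_derivative c (at t))
                                                   (vector_derivative c (at t)))))"

definition riemannian_manifold ::
  "('m::metric_space, 'e::euclidean_space) chart set \<Rightarrow>
   (('m, 'e) chart \<Rightarrow> 'e \<Rightarrow> 'e \<Rightarrow> 'e \<Rightarrow> real) \<Rightarrow> bool" where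
  "riemannian_manifold \<A> g \<longleftrightarrow>
     smooth_atlas \<A> \<and> riemannian_metric \<A> g \<and>
     (\<forall>p q. dist p q = Inf {l. curve_length \<A> g p q l})"

definition C1_map_on ::
  "('m::topological_space, 'e::euclidean_space) chart set \<Rightarrow> 'm set \<Rightarrow> ('m \<Rightarrow> 'm) \<Rightarrow> bool" where
  "C1_map_on \<A> S f \<longleftrightarrow> continuous_on S f \<and>
     (\<forall>(U, \<phi>)\<in>\<A>. \<forall>(V, \<psi>)\<in>\<A>.
        Ck_on 1 (\<psi> \<circ> f \<circ> inv_into U \<phi>) (\<phi> ` (S \<inter> U \<inter> f -` V)))"

definition local_diffeomorphism ::
  "('m::topological_space, 'e::euclidean_space) chart set \<Rightarrow> ('m \<Rightarrow> 'm) \<Rightarrow> bool" where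
  "local_diffeomorphism \<A> f \<longleftrightarrow>
     (\<forall>x. \<exists>S. open S \<and> x \<in> S \<and> open (f ` S) \<and> inj_on f S \<and>
        C1_map_on \<A> S f \<and> C1_map_on \<A> (f ` S) (inv_into S f))"


section \<open>Hoelder functions\<close>

definition holder_const :: "real \<Rightarrow> ('a::metric_space \<Rightarrow> real) \<Rightarrow> ennreal" where
  "holder_const \<zeta> h = (SUP (x, y)\<in>{(x, y). x \<noteq> y}. ennreal (\<bar>h x - h y\<bar> / dist x y powr \<zeta>))"

definition sup_norm :: "('a \<Rightarrow> real) \<Rightarrow> ennreal" where
  "sup_norm h = (SUP x. ennreal \<bar>h x\<bar>)"

definition holder_fun :: "real \<Rightarrow> ('a::metric_space \<Rightarrow> real) set" where
  "holder_fun \<zeta> = {h. holder_const \<zeta> h < \<infinity>}"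

definition holder_norm :: "real \<Rightarrow> ('a::metric_space \<Rightarrow> real) \<Rightarrow> ennreal" where
  "holder_norm \<zeta> h = holder_const \<zeta> h + sup_norm h"


section \<open>Invariant measures, entropy and Jacobians\<close>

definition borel_prob :: "'a::topological_space measure \<Rightarrow> bool" where
  "borel_prob \<nu> \<longleftrightarrow> prob_space \<nu> \<and> sets \<nu> = sets borel"

definition invariant_prob :: "('a::topological_space \<Rightarrow> 'a) \<Rightarrow> 'a measure \<Rightarrow> bool" where
  "invariant_prob f \<nu> \<longleftrightarrow> borel_prob \<nu> \<and> distr \<nu> borel f = \<nu>"

text \<open>
  Finite measurable partitions are coded by measurable functions with finitely many values; the
  itinerary of length \<open>n\<close> then codes the join of the first \<open>n\<close> preimages of the partition.
  Note that \<open>0 * ln 0 = 0\<close>.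
\<close>

definition partition_entropy :: "'a measure \<Rightarrow> ('a \<Rightarrow> 'c) \<Rightarrow> real" where
  "partition_entropy \<nu> X =
     - (\<Sum>v\<in>range X. measure \<nu> (X -` {v}) * ln (measure \<nu> (X -` {v})))"

definition itinerary :: "('a \<Rightarrow> 'a) \<Rightarrow> ('a \<Rightarrow> 'c) \<Rightarrow> nat \<Rightarrow> 'a \<Rightarrow> 'c list" where
  "itinerary f X n x = map (\<lambda>i. X ((f ^^ i) x)) [0..<n]"

definition metric_entropy :: "('a::topological_space \<Rightarrow> 'a) \<Rightarrow> 'a measure \<Rightarrow> ereal" where
  "metric_entropy f \<nu> =
     (SUP X\<in>{X :: 'a \<Rightarrow> nat. X \<in> measurable borel (count_space UNIV) \<and> finite (range X)}.
        ereal (lim (\<lambda>n. partition_entropy \<nu> (itinerary f X n) / real n)))"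

definition maximal_entropy_measure :: "('a::topological_space \<Rightarrow> 'a) \<Rightarrow> 'a measure \<Rightarrow> bool" where
  "maximal_entropy_measure f \<nu> \<longleftrightarrow>
     invariant_prob f \<nu> \<and> (\<forall>\<mu>. invariant_prob f \<mu> \<longrightarrow> metric_entropy f \<mu> \<le> metric_entropy f \<nu>)"

definition has_jacobian ::
  "('a::topological_space \<Rightarrow> 'a) \<Rightarrow> 'a measure \<Rightarrow> ('a \<Rightarrow> real) \<Rightarrow> bool" where
  "has_jacobian f \<nu> J \<longleftrightarrow> J \<in> borel_measurable borel \<and> (\<forall>x. J x > 0) \<and>
     (\<forall>B\<in>sets borel. inj_on f B \<longrightarrow> emeasure \<nu> (f ` B) = (\<integral>\<^sup>+x\<in>B. ennreal (J x) \<partial>\<nu>))"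

definition conformal_measure :: "('a::topological_space \<Rightarrow> 'a) \<Rightarrow> 'a measure \<Rightarrow> bool" where
  "conformal_measure f \<nu> \<longleftrightarrow> borel_prob \<nu> \<and> (\<exists>\<psi>. has_jacobian f \<nu> (\<lambda>x. exp (- \<psi> x)))"

definition perron_frobenius :: "('a \<Rightarrow> 'a) \<Rightarrow> ('a \<Rightarrow> real) \<Rightarrow> ('a \<Rightarrow> real) \<Rightarrow> 'a \<Rightarrow> real" where
  "perron_frobenius f \<rho> h x = (\<Sum>y\<in>f -` {x}. h y * \<rho> y)"


section \<open>Finite signed Borel measures\<close>

typedef (overloaded) ('a::topological_space) signed_measure =
  "{\<mu> :: 'a set \<Rightarrow> real.
      (\<forall>E. E \<notin> sets borel \<longrightarrow> \<mu> E = 0) \<and>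
      (\<forall>A :: nat \<Rightarrow> 'a set. range A \<subseteq> sets borel \<longrightarrow> disjoint_family A \<longrightarrow>
         (\<lambda>i. \<mu> (A i)) sums \<mu> (\<Union>i. A i))}"
  morphisms smeasure Abs_signed_measure
  by (rule exI[of _ "\<lambda>_. 0"]) auto

setup_lifting type_definition_signed_measure

instantiation signed_measure :: (topological_space) real_vector
begin

lift_definition zero_signed_measure :: "'a signed_measure" is "\<lambda>_. 0"
  by auto

lift_definition plus_signed_measure ::
  "'a signed_measure \<Rightarrow> 'a signed_measure \<Rightarrow> 'a signed_measure" is "\<lambda>\<mu> \<nu> E. \<mu> E + \<nu> E"
  by (auto intro: sums_add)

lift_definition minus_signed_measure ::
  "'a signed_measure \<Rightarrow> 'a signed_measure \<Rightarrow> 'a signed_measure" is "\<lambda>\<mu> \<nu> E. \<mu> E - \<nu> E"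
  by (auto intro: sums_diff)

lift_definition uminus_signed_measure ::
  "'a signed_measure \<Rightarrow> 'a signed_measure" is "\<lambda>\<mu> E. - \<mu> E"
  by (auto intro: sums_minus)

lift_definition scaleR_signed_measure ::
  "real \<Rightarrow> 'a signed_measure \<Rightarrow> 'a signed_measure" is "\<lambda>c \<mu> E. c * \<mu> E"
  by (auto intro: sums_mult)

instance
  by standard (transfer, force simp: algebra_simps)+

end

definition signed_of :: "'a::topological_space measure \<Rightarrow> 'a signed_measure" where
  "signed_of p = Abs_signed_measure (\<lambda>E. if E \<in> sets borel then measure p E else 0)"

definition pushforward ::
  "('a::topological_space \<Rightarrow> 'b::topological_space) \<Rightarrow> 'a signed_measure \<Rightarrow> 'b signed_measure" where
  "pushforward T \<mu> =
     Abs_signed_measure (\<lambda>E. if E \<in> sets borel then smeasure \<mu> (T -` E) else 0)"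

definition jordan_decomposition ::
  "'a::topological_space signed_measure \<Rightarrow> 'a measure \<Rightarrow> 'a measure \<Rightarrow> bool" where
  "jordan_decomposition \<mu> p n \<longleftrightarrow>
     finite_measure p \<and> finite_measure n \<and> sets p = sets borel \<and> sets n = sets borel \<and>
     (\<forall>E\<in>sets borel. smeasure \<mu> E = measure p E - measure n E) \<and>
     (\<exists>H\<in>sets borel. emeasure p (- H) = 0 \<and> emeasure n H = 0)"

definition pos_part :: "'a::topological_space signed_measure \<Rightarrow> 'a measure" where
  "pos_part \<mu> = (THE p. \<exists>n. jordan_decomposition \<mu> p n)"

definition neg_part :: "'a::topological_space signed_measure \<Rightarrow> 'a measure" where
  "neg_part \<mu> = (THE n. \<exists>p. jordan_decomposition \<mu> p n)"

definition signed_integral :: "'a::topological_space signed_measure \<Rightarrow> ('a \<Rightarrow> real) \<Rightarrow> real" where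
  "signed_integral \<nu> g = (LINT x|pos_part \<nu>. g x) - (LINT x|neg_part \<nu>. g x)"

definition wnorm :: "real \<Rightarrow> 'k::metric_space signed_measure \<Rightarrow> ennreal" where
  "wnorm \<zeta> \<nu> =
     (SUP g\<in>{g. sup_norm g \<le> 1 \<and> holder_const \<zeta> g \<le> 1}. ennreal \<bar>signed_integral \<nu> g\<bar>)"


section \<open>Disintegration along the fibres and the space of measures\<close>

text \<open>
  The product carries the Borel sets of the product topology, which is also the topology
  of the sum metric \<open>d\<^sub>1 + d\<^sub>2\<close>.
\<close>

definition marginal_density ::
  "'m::topological_space measure \<Rightarrow> ('m \<times> 'k::topological_space) measure \<Rightarrow> 'm \<Rightarrow> real" where
  "marginal_density m1 p x = enn2real (RN_deriv m1 (distr p borel fst) x)"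

definition rokhlin_disintegration ::
  "'m::topological_space measure \<Rightarrow> ('m \<times> 'k::topological_space) measure \<Rightarrow>
   ('m \<Rightarrow> ('m \<times> 'k) measure) \<Rightarrow> bool" where
  "rokhlin_disintegration m1 p \<kappa> \<longleftrightarrow>
     \<kappa> \<in> measurable borel (prob_algebra borel) \<and>
     (\<forall>x. emeasure (\<kappa> x) ({x} \<times> UNIV) = 1) \<and>
     (\<forall>E\<in>sets borel.
        emeasure p E = (\<integral>\<^sup>+x. emeasure (\<kappa> x) E \<partial>(density m1 (\<lambda>x. ennreal (marginal_density m1 p x)))))"

text \<open>
  The disintegration is unique up to a null set of \<open>density m1 (marginal_density m1 p)\<close>, so the
  restriction below does not depend on the choice, \<open>m1\<close>-almost everywhere.
\<close>

definition pos_restriction ::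
  "'m::topological_space measure \<Rightarrow> ('m \<times> 'k::topological_space) measure \<Rightarrow> 'm \<Rightarrow> 'k measure" where
  "pos_restriction m1 p x =
     distr (scale_measure (ennreal (marginal_density m1 p x))
              ((SOME \<kappa>. rokhlin_disintegration m1 p \<kappa>) x)) borel snd"

definition restriction ::
  "'m::topological_space measure \<Rightarrow> ('m \<times> 'k::topological_space) signed_measure \<Rightarrow>
   'm \<Rightarrow> 'k signed_measure" where
  "restriction m1 \<mu> x =
     signed_of (pos_restriction m1 (pos_part \<mu>) x) - signed_of (pos_restriction m1 (neg_part \<mu>) x)"

definition signed_density ::
  "'m::topological_space measure \<Rightarrow> ('m \<times> 'k::topological_space) signed_measure \<Rightarrow> 'm \<Rightarrow> real" where
  "signed_density m1 \<mu> x = marginal_density m1 (pos_part \<mu>) x - marginal_density m1 (neg_part \<mu>) x"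

definition AB_space ::
  "'m::topological_space measure \<Rightarrow> ('m \<times> 'k::topological_space) signed_measure set" where
  "AB_space m1 = {\<mu>. absolutely_continuous m1 (distr (pos_part \<mu>) borel fst) \<and>
                     absolutely_continuous m1 (distr (neg_part \<mu>) borel fst)}"

definition Linf_norm ::
  "real \<Rightarrow> 'm::topological_space measure \<Rightarrow> ('m \<times> 'k::metric_space) signed_measure \<Rightarrow> ennreal" where
  "Linf_norm \<zeta> m1 \<mu> = esssup m1 (\<lambda>x. wnorm \<zeta> (restriction m1 \<mu> x))"

definition Linf_space ::
  "real \<Rightarrow> 'm::topological_space measure \<Rightarrow> ('m \<times> 'k::metric_space) signed_measure set" where
  "Linf_space \<zeta> m1 = {\<mu> \<in> AB_space m1. Linf_norm \<zeta> m1 \<mu> < \<infinity>}"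

definition holder_versions ::
  "real \<Rightarrow> 'm::metric_space measure \<Rightarrow> ('m \<Rightarrow> real) \<Rightarrow> ('m \<Rightarrow> real) set" where
  "holder_versions \<zeta> m1 \<phi> = {h \<in> holder_fun \<zeta>. AE x in m1. h x = \<phi> x}"

definition Sinf_space ::
  "real \<Rightarrow> 'm::metric_space measure \<Rightarrow> ('m \<times> 'k::metric_space) signed_measure set" where
  "Sinf_space \<zeta> m1 = {\<mu> \<in> Linf_space \<zeta> m1. holder_versions \<zeta> m1 (signed_density m1 \<mu>) \<noteq> {}}"

text \<open>
  If \<open>m1\<close> has full support, a density has at most one Hoelder version and the infimum below is its
  norm. The infimum (the quotient norm) keeps the norm well defined without full support, which
  the standing assumptions do not force (the base map may have an attracting fixed point).
\<close>

definition Sinf_norm ::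
  "real \<Rightarrow> 'm::metric_space measure \<Rightarrow> ('m \<times> 'k::metric_space) signed_measure \<Rightarrow> ennreal" where
  "Sinf_norm \<zeta> m1 \<mu> =
     (INF h\<in>holder_versions \<zeta> m1 (signed_density m1 \<mu>). holder_norm \<zeta> h) + Linf_norm \<zeta> m1 \<mu>"

definition linear_operator_on :: "'v::real_vector set \<Rightarrow> ('v \<Rightarrow> 'v) \<Rightarrow> bool" where
  "linear_operator_on S T \<longleftrightarrow> subspace S \<and> T ` S \<subseteq> S \<and>
     (\<forall>x\<in>S. \<forall>y\<in>S. T (x + y) = T x + T y) \<and> (\<forall>c. \<forall>x\<in>S. T (c *\<^sub>R x) = c *\<^sub>R T x)"

end

theory Submission
  imports Defs
begin

text \<open>
  On the measures of total mass zero the push-forward contracts: the marginal density decays by the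
  spectral gap of the Perron-Frobenius operator, and on the fibres the contraction of \<open>G\<close> shrinks the
  dual norm by the factor \<open>\<alpha> powr \<zeta>\<close>, up to a term bounded by the fibre mass, that is by the density.
  So the theorem holds with \<open>P \<mu> = \<mu>(\<Sigma>) \<mu>\<^sub>0\<close>, once there is an invariant probability \<open>\<mu>\<^sub>0\<close> in
  \<open>S\<^sup>\<infinity>\<close>. It is the joint law of the end point of a random past orbit of \<open>f\<close> and of the limit of the
  fibre maps along that orbit.
\<close>

section \<open>Signed measures and their Jordan decomposition\<close>

text \<open>The link between base and fibres is a formula: if a family \<open>s\<close> represents
  \<open>\<mu>\<close> relative to \<open>m1\<close>, the push-forward is represented at
  \<open>x\<close> by the sum over the preimages \<open>y\<close> of \<open>\<rho> y\<close> times
  the image of \<open>s y\<close> under the fibre map at \<open>y\<close>. Total masses thus evolve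
  by the Perron-Frobenius operator, and since the weights sum to 1 almost everywhere, fibre bounds
  are averaged and not enlarged. Jordan parts are not additive in the measure, so estimates are made
  on representing families, which are unique almost everywhere. Two constants need care. A test
  function minus one of its values on a fibre of large diameter may exceed 1, so the iteration uses
  test functions bounded by a constant \<open>C\<close> that dominates every distance to the power
  \<open>\<zeta>\<close>. And the mass term, of rate \<open>r\<close>, drives a recursion of rate
  \<open>\<alpha> powr \<zeta>\<close>; equal rates could produce \<open>n * \<theta> ^ n\<close>,
  so the final rate lies strictly above both. The fibre contraction holds only over almost every
  point; \<open>G\<close> is modified over a null set, which the measures in question do not
  see.\<close>

lemma smeasure_nonborel: "E \<notin> sets borel \<Longrightarrow> smeasure \<mu> E = 0"
  using smeasure[of \<mu>] by auto

lemma smeasure_sums: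
  "range A \<subseteq> sets borel \<Longrightarrow> disjoint_family A \<Longrightarrow> (\<lambda>i. smeasure \<mu> (A i)) sums smeasure \<mu> (\<Union>i. A i)"
  using smeasure[of \<mu>] by auto

lemma smeasure_empty [simp]: "smeasure \<mu> {} = 0"
proof -
  have "(\<lambda>i::nat. smeasure \<mu> {}) sums smeasure \<mu> {}"
    using smeasure_sums[of "\<lambda>_. {}" \<mu>] by (auto simp: disjoint_family_on_def)
  then show ?thesis by (metis sums_summable summable_const_iff)
qed

lemma smeasure_Un:
  assumes "A \<in> sets borel" "B \<in> sets borel" "A \<inter> B = {}"
  shows "smeasure \<mu> (A \<union> B) = smeasure \<mu> A + smeasure \<mu> B"
proof -
  have "(\<lambda>i. smeasure \<mu> (binaryset A B i)) sums smeasure \<mu> (\<Union>i. binaryset A B i)"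
    using assms by (intro smeasure_sums) (auto simp: range_binaryset_eq disjoint_family_on_def binaryset_def)
  moreover have "(\<lambda>i. smeasure \<mu> (binaryset A B i)) sums (smeasure \<mu> A + smeasure \<mu> B)"
    by (rule binaryset_sums) simp
  ultimately show ?thesis by (simp add: UN_binaryset_eq sums_unique2)
qed

lemma smeasure_Diff:
  assumes "A \<in> sets borel" "B \<in> sets borel" "A \<subseteq> B"
  shows "smeasure \<mu> (B - A) = smeasure \<mu> B - smeasure \<mu> A"
  using smeasure_Un[of A "B - A" \<mu>] assms by (auto simp: Un_absorb1)

lemma smeasure_eqI:
  assumes "\<And>E. E \<in> sets borel \<Longrightarrow> smeasure \<mu> E = smeasure \<nu> E"
  shows "\<mu> = \<nu>"
proof -
  have "smeasure \<mu> = smeasure \<nu>"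
    using assms by (metis smeasure_nonborel ext)
  then show ?thesis by (simp add: smeasure_inject)
qed

lemma smeasure_simps [simp]:
  "smeasure 0 E = 0" "smeasure (\<mu> + \<nu>) E = smeasure \<mu> E + smeasure \<nu> E"
  "smeasure (\<mu> - \<nu>) E = smeasure \<mu> E - smeasure \<nu> E" "smeasure (- \<mu>) E = - smeasure \<mu> E"
  "smeasure (c *\<^sub>R \<mu>) E = c * smeasure \<mu> E"
  by (transfer, simp)+

lemma smeasure_sum: "smeasure (sum s I) E = (\<Sum>i\<in>I. smeasure (s i) E)"
  by (induction I rule: infinite_finite_induct) auto

text \<open>For a disjoint sequence of Borel sets all members and the union are Borel, so the case
  distinction disappears. Both \<open>signed_of\<close> and \<open>pushforward\<close> have this
  shape.\<close>

lemma smeasure_Abs_signed_measure: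
  assumes "\<And>A :: nat \<Rightarrow> 'a::topological_space set. range A \<subseteq> sets borel \<Longrightarrow> disjoint_family A \<Longrightarrow>
    (\<lambda>i. m (A i)) sums m (\<Union>i. A i)"
  shows "smeasure (Abs_signed_measure (\<lambda>E. if E \<in> sets borel then m E else 0)) E
    = (if E \<in> sets borel then m E else 0)"
proof -
  let ?m = "\<lambda>E. if E \<in> sets borel then m E else 0"
  have "(\<lambda>i. ?m (A i)) sums ?m (\<Union>i. A i)"
    if A: "range A \<subseteq> sets borel" "disjoint_family A" for A :: "nat \<Rightarrow> 'a set"
  proof -
    have B: "A i \<in> sets borel" for i using A by auto
    then have "(\<Union>i. A i) \<in> sets borel" by blast
    then show ?thesis using assms[OF A] B by simp
  qed
  then have "?m \<in> {\<mu>. (\<forall>E. E \<notin> sets borel \<longrightarrow> \<mu> E = 0) \<and>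
      (\<forall>A :: nat \<Rightarrow> 'a set. range A \<subseteq> sets borel \<longrightarrow> disjoint_family A \<longrightarrow>
         (\<lambda>i. \<mu> (A i)) sums \<mu> (\<Union>i. A i))}"
    by (intro CollectI) simp
  from Abs_signed_measure_inverse[OF this] show ?thesis by simp
qed

lemma smeasure_signed_of:
  assumes "finite_measure p" "sets p = sets borel"
  shows "smeasure (signed_of p) E = measure p E"
proof -
  interpret finite_measure p by fact
  show ?thesis unfolding signed_of_def
    by (subst smeasure_Abs_signed_measure)
      (auto simp: measure_notin_sets assms intro!: finite_measure_UNION)
qed

lemma smeasure_pushforward:
  fixes T :: "'a::topological_space \<Rightarrow> 'b::topological_space"
  assumes "T \<in> borel_measurable borel"
  shows "smeasure (pushforward T \<mu>) E = (if E \<in> sets borel then smeasure \<mu> (T -` E) else 0)"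
  unfolding pushforward_def
proof (rule smeasure_Abs_signed_measure)
  fix A :: "nat \<Rightarrow> 'b set" assume A: "range A \<subseteq> sets borel" "disjoint_family A"
  have "T -` A i \<in> sets borel" for i
    using measurable_sets[OF assms, of "A i"] A(1) by auto
  then have "(\<lambda>i. smeasure \<mu> (T -` A i)) sums smeasure \<mu> (\<Union>i. T -` A i)"
    using A by (intro smeasure_sums) (auto simp: disjoint_family_on_def, blast)
  then show "(\<lambda>i. smeasure \<mu> (T -` A i)) sums smeasure \<mu> (T -` (\<Union>i. A i))"
    by (simp add: vimage_UN)
qed

lemma pushforward_add:
  "T \<in> borel_measurable borel \<Longrightarrow> pushforward T (\<mu> + \<nu>) = pushforward T \<mu> + pushforward T \<nu>"
  by (rule smeasure_eqI) (simp add: smeasure_pushforward)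

lemma pushforward_diff:
  "T \<in> borel_measurable borel \<Longrightarrow> pushforward T (\<mu> - \<nu>) = pushforward T \<mu> - pushforward T \<nu>"
  by (rule smeasure_eqI) (simp add: smeasure_pushforward)

lemma pushforward_scaleR:
  "T \<in> borel_measurable borel \<Longrightarrow> pushforward T (c *\<^sub>R \<mu>) = c *\<^sub>R pushforward T \<mu>"
  by (rule smeasure_eqI) (simp add: smeasure_pushforward)

text \<open>The positive variation; \<open>ennreal\<close> truncates negative values, which is harmless because of \<open>B = {}\<close>.\<close>

definition pos_variation :: "'a::topological_space signed_measure \<Rightarrow> 'a set \<Rightarrow> ennreal" where
  "pos_variation \<mu> E = (SUP B\<in>{B \<in> sets borel. B \<subseteq> E}. ennreal (smeasure \<mu> B))"

lemma pos_variation_upper: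
  "B \<in> sets borel \<Longrightarrow> B \<subseteq> E \<Longrightarrow> ennreal (smeasure \<mu> B) \<le> pos_variation \<mu> E"
  unfolding pos_variation_def by (rule SUP_upper) auto

lemma pos_variation_mono: "E \<subseteq> E' \<Longrightarrow> pos_variation \<mu> E \<le> pos_variation \<mu> E'"
  unfolding pos_variation_def by (rule SUP_subset_mono) auto

text \<open>A competitor of negative mass can be replaced by the empty set without changing its
  truncated mass; after that truncation is additive and the union of the two competitors competes in
  \<open>A \<union> B\<close>. The two suprema are pulled out one after the other.\<close>

lemma pos_variation_Un_ge:
  assumes "A \<inter> B = {}"
  shows "pos_variation \<mu> A + pos_variation \<mu> B \<le> pos_variation \<mu> (A \<union> B)"
proof -
  have *: "ennreal (smeasure \<mu> X) + ennreal (smeasure \<mu> Y) \<le> pos_variation \<mu> (A \<union> B)"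
    if "X \<in> sets borel" "X \<subseteq> A" "Y \<in> sets borel" "Y \<subseteq> B" for X Y
  proof -
    define X' where "X' = (if smeasure \<mu> X \<ge> 0 then X else {})"
    define Y' where "Y' = (if smeasure \<mu> Y \<ge> 0 then Y else {})"
    have "ennreal (smeasure \<mu> X) + ennreal (smeasure \<mu> Y) = ennreal (smeasure \<mu> X') + ennreal (smeasure \<mu> Y')"
      by (auto simp: X'_def Y'_def ennreal_neg)
    also have "\<dots> = ennreal (smeasure \<mu> X' + smeasure \<mu> Y')"
      by (rule ennreal_plus[symmetric]) (auto simp: X'_def Y'_def)
    also have "smeasure \<mu> X' + smeasure \<mu> Y' = smeasure \<mu> (X' \<union> Y')"
      using that assms by (intro smeasure_Un[symmetric]) (auto simp: X'_def Y'_def)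
    also have "ennreal \<dots> \<le> pos_variation \<mu> (A \<union> B)"
      using that by (intro pos_variation_upper) (auto simp: X'_def Y'_def)
    finally show ?thesis .
  qed
  have ne: "{Y \<in> sets borel. Y \<subseteq> E} \<noteq> {}" for E :: "'a set" by blast
  have "pos_variation \<mu> A + pos_variation \<mu> B
      = (SUP X\<in>{X \<in> sets borel. X \<subseteq> A}. ennreal (smeasure \<mu> X) + pos_variation \<mu> B)"
    unfolding pos_variation_def[of _ A]
    by (rule ennreal_SUP_add_left[symmetric, OF ne])
  also have "\<dots> \<le> pos_variation \<mu> (A \<union> B)"
  proof (rule SUP_least)
    fix X assume X: "X \<in> {X \<in> sets borel. X \<subseteq> A}"
    have "ennreal (smeasure \<mu> X) + pos_variation \<mu> B
        = (SUP Y\<in>{Y \<in> sets borel. Y \<subseteq> B}. ennreal (smeasure \<mu> X) + ennreal (smeasure \<mu> Y))"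
      unfolding pos_variation_def add.commute[of "ennreal (smeasure \<mu> X)"]
      by (rule ennreal_SUP_add_left[symmetric, OF ne])
    also have "\<dots> \<le> pos_variation \<mu> (A \<union> B)"
      using X by (intro SUP_least *) auto
    finally show "ennreal (smeasure \<mu> X) + pos_variation \<mu> B \<le> pos_variation \<mu> (A \<union> B)" .
  qed
  finally show ?thesis .
qed

text \<open>Truncating negative terms to zero can only increase a sum.\<close>

lemma ennreal_sum_le: "finite I \<Longrightarrow> ennreal (\<Sum>i\<in>I. x i) \<le> (\<Sum>i\<in>I. ennreal (x i))"
proof (induction I rule: finite_induct)
  case (insert i I)
  have "ennreal (x i + sum x I) \<le> ennreal (x i) + ennreal (sum x I)"
    by (auto simp: ennreal_plus_if max_def intro: ennreal_leI)
  then show ?case using insert by (auto intro: order_trans add_left_mono)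
qed simp

text \<open>Superadditivity on finite unions gives one inequality. For the other, a competitor
  \<open>B\<close> is cut into the sets \<open>B \<inter> A i\<close>, whose masses sum to that of
  \<open>B\<close>; truncation is continuous, so the bound on partial sums passes to the
  limit.\<close>

lemma pos_variation_suminf:
  assumes A: "range A \<subseteq> sets borel" "disjoint_family A"
  shows "(\<Sum>i. pos_variation \<mu> (A i)) = pos_variation \<mu> (\<Union>i. A i)"
proof (rule antisym)
  have "(\<Sum>i<n. pos_variation \<mu> (A i)) \<le> pos_variation \<mu> (\<Union>i<n. A i)" for n
  proof (induction n)
    case (Suc n)
    have "pos_variation \<mu> (\<Union>i<n. A i) + pos_variation \<mu> (A n) \<le> pos_variation \<mu> ((\<Union>i<n. A i) \<union> A n)"
    proof (rule pos_variation_Un_ge)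
      have "A i \<inter> A n = {}" if "i < n" for i
        using A(2) that unfolding disjoint_family_on_def by (metis UNIV_I less_irrefl)
      then show "(\<Union>i<n. A i) \<inter> A n = {}" by blast
    qed
    also have "(\<Union>i<n. A i) \<union> A n = (\<Union>i<Suc n. A i)" by (auto simp: less_Suc_eq)
    finally show ?case using Suc by (auto intro: order_trans add_right_mono)
  qed simp
  then have "(\<Sum>i<n. pos_variation \<mu> (A i)) \<le> pos_variation \<mu> (\<Union>i. A i)" for n
    by (rule order_trans) (rule pos_variation_mono, auto)
  then show "(\<Sum>i. pos_variation \<mu> (A i)) \<le> pos_variation \<mu> (\<Union>i. A i)"
    by (intro suminf_le_const) auto
  show "pos_variation \<mu> (\<Union>i. A i) \<le> (\<Sum>i. pos_variation \<mu> (A i))"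
    unfolding pos_variation_def[of _ "\<Union>i. A i"]
  proof (rule SUP_least)
    fix B assume B: "B \<in> {B \<in> sets borel. B \<subseteq> (\<Union>i. A i)}"
    have "(\<lambda>i. smeasure \<mu> (B \<inter> A i)) sums smeasure \<mu> (\<Union>i. B \<inter> A i)"
      using A B by (intro smeasure_sums) (auto simp: disjoint_family_on_def)
    also have "(\<Union>i. B \<inter> A i) = B" using B by auto
    finally have "(\<lambda>n. ennreal (\<Sum>i<n. smeasure \<mu> (B \<inter> A i))) \<longlonglongrightarrow> ennreal (smeasure \<mu> B)"
      by (auto simp: sums_def intro: tendsto_ennrealI)
    moreover have "ennreal (\<Sum>i<n. smeasure \<mu> (B \<inter> A i)) \<le> (\<Sum>i. pos_variation \<mu> (A i))" for n
    proof -
      have "ennreal (\<Sum>i<n. smeasure \<mu> (B \<inter> A i)) \<le> (\<Sum>i<n. ennreal (smeasure \<mu> (B \<inter> A i)))"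
        by (rule ennreal_sum_le) simp
      also have "\<dots> \<le> (\<Sum>i<n. pos_variation \<mu> (A i))"
        using A B by (intro sum_mono pos_variation_upper) auto
      also have "\<dots> \<le> (\<Sum>i. pos_variation \<mu> (A i))" by (rule sum_le_suminf) auto
      finally show ?thesis .
    qed
    ultimately show "ennreal (smeasure \<mu> B) \<le> (\<Sum>i. pos_variation \<mu> (A i))"
      by (intro LIMSEQ_le_const2[where a = "\<Sum>i. pos_variation \<mu> (A i)"]) auto
  qed
qed

lemma pos_variation_empty [simp]: "pos_variation \<mu> {} = 0"
proof -
  have "{B \<in> sets borel. B \<subseteq> {}} = {{} :: 'a set}" by auto
  then show ?thesis by (simp add: pos_variation_def)
qed

lemma pos_variation_Un:
  assumes "A \<in> sets borel" "B \<in> sets borel" "A \<inter> B = {}"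
  shows "pos_variation \<mu> (A \<union> B) = pos_variation \<mu> A + pos_variation \<mu> B"
proof -
  have "(\<Sum>i. pos_variation \<mu> (binaryset A B i)) = pos_variation \<mu> (\<Union>i. binaryset A B i)"
    using assms by (intro pos_variation_suminf) (auto simp: range_binaryset_eq disjoint_family_on_def binaryset_def)
  moreover have "(\<lambda>i. pos_variation \<mu> (binaryset A B i)) sums (pos_variation \<mu> A + pos_variation \<mu> B)"
    by (rule binaryset_sums) simp
  ultimately show ?thesis by (simp add: UN_binaryset_eq sums_unique[symmetric])
qed

text \<open>The differences \<open>A n - A (Suc n)\<close> are disjoint, so their masses form a
  convergent series; it telescopes, hence \<open>smeasure \<mu> (A n)\<close> converges. This is
  what infinite variation will contradict.\<close>

lemma smeasure_decseq_bounded: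
  assumes "range A \<subseteq> sets borel" "decseq A"
  shows "bounded (range (\<lambda>n. smeasure \<mu> (A n)))"
proof -
  have A: "A n \<in> sets borel" "A (Suc n) \<subseteq> A n" for n
    using assms by (auto simp: decseq_Suc_iff)
  have "(\<lambda>n. smeasure \<mu> (A n - A (Suc n))) sums smeasure \<mu> (\<Union>n. A n - A (Suc n))"
  proof (rule smeasure_sums)
    have "(A m - A (Suc m)) \<inter> (A n - A (Suc n)) = {}" if "m < n" for m n
      using decseqD[OF assms(2), of "Suc m" n] that by auto
    then show "disjoint_family (\<lambda>n. A n - A (Suc n))"
      unfolding disjoint_family_on_def by (metis Int_commute linorder_neqE_nat)
  qed (use A in auto)
  then have "(\<lambda>n. smeasure \<mu> (A n) - smeasure \<mu> (A (Suc n))) sums smeasure \<mu> (\<Union>n. A n - A (Suc n))"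
    using A by (simp add: smeasure_Diff)
  moreover have "(\<Sum>i<n. smeasure \<mu> (A i) - smeasure \<mu> (A (Suc i))) = smeasure \<mu> (A 0) - smeasure \<mu> (A n)" for n
    by (induction n) auto
  ultimately have "(\<lambda>n. smeasure \<mu> (A 0) - smeasure \<mu> (A n)) \<longlonglongrightarrow> smeasure \<mu> (\<Union>n. A n - A (Suc n))"
    by (simp add: sums_def)
  from tendsto_diff[OF tendsto_const[of "smeasure \<mu> (A 0)"] this]
  have "convergent (\<lambda>n. smeasure \<mu> (A n))" by (auto simp: convergent_def)
  then show ?thesis by (auto dest: convergent_imp_Bseq simp: Bseq_eq_bounded)
qed

text \<open>Inside a Borel set \<open>E\<close> of infinite variation take a competitor
  \<open>B\<close> of large mass. Either \<open>B\<close> or \<open>E - B\<close> inherits the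
  infinite variation, and both have mass of large modulus. Iteration yields a decreasing sequence
  with unbounded masses.\<close>

lemma pos_variation_finite: "pos_variation \<mu> UNIV < \<infinity>"
proof (rule ccontr)
  assume inf: "\<not> pos_variation \<mu> UNIV < \<infinity>"
  define Bad where "Bad E \<longleftrightarrow> E \<in> sets borel \<and> pos_variation \<mu> E = \<infinity>" for E
  have step: "\<exists>E'. Bad E' \<and> E' \<subseteq> E \<and> \<bar>smeasure \<mu> E'\<bar> \<ge> real n" if "Bad E" for E n
  proof -
    have E: "E \<in> sets borel" "pos_variation \<mu> E = \<infinity>" using that by (auto simp: Bad_def)
    \<comment> \<open>Adding \<open>\<bar>smeasure \<mu> E\<bar>\<close> to the threshold makes the
      mass of \<open>B\<close> and that of \<open>E - B\<close> both have modulus at least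
      \<open>n\<close>.\<close>
    then have "ennreal (real n + \<bar>smeasure \<mu> E\<bar>) < pos_variation \<mu> E" by simp
    then obtain B where B: "B \<in> sets borel" "B \<subseteq> E"
      "ennreal (real n + \<bar>smeasure \<mu> E\<bar>) < ennreal (smeasure \<mu> B)"
      unfolding pos_variation_def less_SUP_iff by auto
    then have big: "real n + \<bar>smeasure \<mu> E\<bar> < smeasure \<mu> B"
      by (simp add: ennreal_less_iff del: ennreal_plus)
    have "pos_variation \<mu> (B \<union> (E - B)) = pos_variation \<mu> B + pos_variation \<mu> (E - B)"
      using B E by (intro pos_variation_Un) auto
    also have "B \<union> (E - B) = E" using B by auto
    finally consider "pos_variation \<mu> B = \<infinity>" | "pos_variation \<mu> (E - B) = \<infinity>"
      using E by (metis ennreal_add_eq_top infinity_ennreal_def)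
    then show ?thesis
    proof cases
      case 1
      then show ?thesis using B big by (intro exI[of _ B]) (auto simp: Bad_def)
    next
      case 2
      then show ?thesis using B big E smeasure_Diff[of B E \<mu>]
        by (intro exI[of _ "E - B"]) (auto simp: Bad_def)
    qed
  qed
  have "\<exists>E. \<forall>n. Bad (E n) \<and> (E (Suc n) \<subseteq> E n \<and> \<bar>smeasure \<mu> (E (Suc n))\<bar> \<ge> real n)"
  proof (rule dependent_nat_choice)
    show "\<exists>E. Bad E" using inf unfolding Bad_def infinity_ennreal_def by (metis borel_open open_UNIV top.not_eq_extremum)
  qed (use step in blast)
  then obtain E where E: "\<And>n. Bad (E n)" "\<And>n. E (Suc n) \<subseteq> E n" "\<And>n. \<bar>smeasure \<mu> (E (Suc n))\<bar> \<ge> real n"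
    by blast
  have "bounded (range (\<lambda>n. smeasure \<mu> (E n)))"
    using E by (intro smeasure_decseq_bounded) (auto simp: Bad_def decseq_Suc_iff)
  then obtain C where C: "\<And>n. \<bar>smeasure \<mu> (E n)\<bar> \<le> C" by (auto simp: bounded_iff)
  obtain n where "C < real n" using reals_Archimedean2 by blast
  with C[of "Suc n"] E(3)[of n] show False by linarith
qed

text \<open>The two measures are the variations \<open>V \<mu>\<close> and
  \<open>V (- \<mu>)\<close>. Passing from a competitor \<open>B\<close> in \<open>E\<close> to
  \<open>E - B\<close> turns one variation into the other up to the constant
  \<open>smeasure \<mu> E\<close>, which gives both inequalities.\<close>

lemma signed_measure_eq_diff:
  obtains p n where "finite_measure p" "finite_measure n" "sets p = sets borel" "sets n = sets borel"
    "\<mu> = signed_of p - signed_of n"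
proof -
  define V where "V \<nu> = measure_of UNIV (sets borel) (pos_variation \<nu>)" for \<nu> :: "'a signed_measure"
  have sp: "sets (V \<nu>) = sets borel" "space (V \<nu>) = UNIV" for \<nu>
    unfolding V_def by (metis sets.sets_measure_of_eq space_borel) simp
  have em: "emeasure (V \<nu>) E = pos_variation \<nu> E" if "E \<in> sets borel" for \<nu> E
  proof (rule emeasure_measure_of[of "V \<nu>" UNIV "sets borel" "pos_variation \<nu>"])
    show "countably_additive (sets (V \<nu>)) (pos_variation \<nu>)"
      unfolding countably_additive_def sp using pos_variation_suminf[of _ \<nu>] by auto
  qed (use that sp in \<open>auto simp: V_def positive_def\<close>)
  have fin: "finite_measure (V \<nu>)" for \<nu>
    using pos_variation_finite[of \<nu>] by (intro finite_measureI) (simp add: sp em)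
  have eq: "smeasure \<mu> E = measure (V \<mu>) E - measure (V (- \<mu>)) E" if E: "E \<in> sets borel" for E
  proof -
    interpret P: finite_measure "V \<mu>" by (rule fin)
    interpret N: finite_measure "V (- \<mu>)" by (rule fin)
    have ub: "smeasure \<nu> B \<le> measure (V \<nu>) E" if "B \<in> sets borel" "B \<subseteq> E" for \<nu> B
    proof -
      interpret finite_measure "V \<nu>" by (rule fin)
      show ?thesis using pos_variation_upper[OF that, of \<nu>] E em[OF E, of \<nu>]
        by (simp add: emeasure_eq_measure flip: em)
    qed
    have lub: "measure (V \<nu>) E \<le> c" if "c \<ge> 0" "\<And>B. B \<in> sets borel \<Longrightarrow> B \<subseteq> E \<Longrightarrow> smeasure \<nu> B \<le> c" for \<nu> c
    proof -
      interpret finite_measure "V \<nu>" by (rule fin)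
      have "pos_variation \<nu> E \<le> ennreal c" unfolding pos_variation_def
        using that by (auto intro!: SUP_least ennreal_leI)
      then show ?thesis using em[OF E, of \<nu>] that by (simp add: emeasure_eq_measure flip: em[OF E])
    qed
    have "measure (V \<mu>) E \<le> smeasure \<mu> E + measure (V (- \<mu>)) E"
    proof (rule lub)
      show "0 \<le> smeasure \<mu> E + measure (V (- \<mu>)) E" using ub[of E "- \<mu>"] E by simp
      show "smeasure \<mu> B \<le> smeasure \<mu> E + measure (V (- \<mu>)) E" if "B \<in> sets borel" "B \<subseteq> E" for B
        using ub[of "E - B" "- \<mu>"] smeasure_Diff[OF that(1) E that(2), of \<mu>] that E by simp
    qed
    moreover have "measure (V (- \<mu>)) E \<le> measure (V \<mu>) E - smeasure \<mu> E"
    proof (rule lub)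
      show "0 \<le> measure (V \<mu>) E - smeasure \<mu> E" using ub[of E "\<mu>"] E by simp
      show "smeasure (- \<mu>) B \<le> measure (V \<mu>) E - smeasure \<mu> E" if "B \<in> sets borel" "B \<subseteq> E" for B
        using ub[of "E - B" "\<mu>"] smeasure_Diff[OF that(1) E that(2), of \<mu>] that E by simp
    qed
    ultimately show ?thesis by simp
  qed
  show ?thesis
    by (rule that[OF fin fin sp(1) sp(1)], rule smeasure_eqI)
      (simp add: eq smeasure_signed_of fin sp)
qed

text \<open>The Hahn set \<open>Y\<close> is that of the two positive finite measures whose
  difference is \<open>\<mu>\<close>. The parts are \<open>\<mu>\<close> cut down to
  \<open>Y\<close> and \<open>- \<mu>\<close> cut down to the complement of
  \<open>Y\<close>.\<close>

lemma jordan_decomposition_exists: "\<exists>p n. jordan_decomposition \<mu> p n"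
proof -
  obtain a b where ab: "finite_measure a" "finite_measure b" "sets a = sets borel" "sets b = sets borel"
    "\<mu> = signed_of a - signed_of b" by (rule signed_measure_eq_diff)
  interpret a: finite_measure a by fact
  interpret b: finite_measure b by fact
  have \<mu>: "smeasure \<mu> E = measure a E - measure b E" for E
    using ab by (simp add: smeasure_signed_of)
  obtain Y where Y: "Y \<in> sets a" "\<And>X. X \<in> sets a \<Longrightarrow> X \<subseteq> Y \<Longrightarrow> b X \<le> a X"
    "\<And>X. X \<in> sets a \<Longrightarrow> X \<inter> Y = {} \<Longrightarrow> a X \<le> b X"
    using finite_unsigned_Hahn_decomposition[of a b] ab by auto
  have pos: "smeasure \<mu> X \<ge> 0" if "X \<in> sets borel" "X \<subseteq> Y" for X
    using Y(2)[of X] that ab(1-4) by (simp add: \<mu> a.emeasure_eq_measure b.emeasure_eq_measure)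
  have neg: "smeasure \<mu> X \<le> 0" if "X \<in> sets borel" "X \<inter> Y = {}" for X
    using Y(3)[of X] that ab(1-4) by (simp add: \<mu> a.emeasure_eq_measure b.emeasure_eq_measure)
  have Yb: "Y \<in> sets borel" using Y ab by simp
  define restr where "restr \<nu> Z = measure_of UNIV (sets borel) (\<lambda>E. ennreal (smeasure \<nu> (E \<inter> Z)))"
    for \<nu> :: "'a signed_measure" and Z
  have sp: "sets (restr \<nu> Z) = sets borel" "space (restr \<nu> Z) = UNIV" for \<nu> Z
    unfolding restr_def by (metis sets.sets_measure_of_eq space_borel) simp
  have em: "emeasure (restr \<nu> Z) E = ennreal (smeasure \<nu> (E \<inter> Z))"
    if "E \<in> sets borel" "Z \<in> sets borel" "\<And>X. X \<in> sets borel \<Longrightarrow> X \<subseteq> Z \<Longrightarrow> smeasure \<nu> X \<ge> 0" for \<nu> Z E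
  proof (rule emeasure_measure_of[of "restr \<nu> Z" UNIV "sets borel"])
    show "countably_additive (sets (restr \<nu> Z)) (\<lambda>E. ennreal (smeasure \<nu> (E \<inter> Z)))"
      unfolding countably_additive_def sp
    proof safe
      fix A :: "nat \<Rightarrow> 'a set" assume A: "range A \<subseteq> sets borel" "disjoint_family A"
      have "(\<lambda>i. smeasure \<nu> (A i \<inter> Z)) sums smeasure \<nu> (\<Union>i. A i \<inter> Z)"
        using A that by (intro smeasure_sums) (auto simp: disjoint_family_on_def)
      then have s: "(\<lambda>i. smeasure \<nu> (A i \<inter> Z)) sums smeasure \<nu> (\<Union>(range A) \<inter> Z)" by simp
      have nn: "0 \<le> smeasure \<nu> (A i \<inter> Z)" for i using A that by auto
      show "(\<Sum>i. ennreal (smeasure \<nu> (A i \<inter> Z))) = ennreal (smeasure \<nu> (\<Union>(range A) \<inter> Z))"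
        using suminf_ennreal_eq[OF nn s] by simp
    qed
  qed (use that sp in \<open>auto simp: restr_def positive_def\<close>)
  let ?p = "restr \<mu> Y" and ?n = "restr (- \<mu>) (- Y)"
  have emp: "emeasure ?p E = ennreal (smeasure \<mu> (E \<inter> Y))" if "E \<in> sets borel" for E
    using that Yb pos by (intro em) auto
  have emn: "emeasure ?n E = ennreal (smeasure (- \<mu>) (E \<inter> - Y))" if "E \<in> sets borel" for E
    using that Yb neg by (intro em) auto
  have "jordan_decomposition \<mu> ?p ?n"
    unfolding jordan_decomposition_def
  proof (intro conjI ballI bexI[of _ Y])
    show "finite_measure ?p" "finite_measure ?n"
      using emp[of UNIV] emn[of UNIV] by (auto intro!: finite_measureI simp: sp)
    fix E :: "'a set" assume E: "E \<in> sets borel"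
    have "measure ?p E = smeasure \<mu> (E \<inter> Y)" "measure ?n E = - smeasure \<mu> (E \<inter> - Y)"
      using emp[OF E] emn[OF E] pos[of "E \<inter> Y"] neg[of "E \<inter> - Y"] E Yb by (auto simp: measure_def)
    moreover have "smeasure \<mu> ((E \<inter> Y) \<union> (E \<inter> - Y)) = smeasure \<mu> (E \<inter> Y) + smeasure \<mu> (E \<inter> - Y)"
      using E Yb by (intro smeasure_Un) auto
    moreover have "(E \<inter> Y) \<union> (E \<inter> - Y) = E" by auto
    ultimately show "smeasure \<mu> E = measure ?p E - measure ?n E" by simp
  qed (use sp emp emn Yb in auto)
  then show ?thesis by blast
qed

text \<open>On the Hahn set \<open>H\<close> the mass of \<open>p\<close> is that of
  \<open>\<mu>\<close>, and \<open>\<mu>\<close> is at most \<open>a\<close>; symmetrically off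
  \<open>H\<close>. Besides uniqueness, this bounds the variation of a difference of measures
  without computing its parts.\<close>

lemma jordan_decomposition_minimal:
  assumes J: "jordan_decomposition \<mu> p n"
    and ab: "finite_measure a" "finite_measure b" "sets a = sets borel" "sets b = sets borel"
    and \<mu>: "\<mu> = signed_of a - signed_of b" and E: "E \<in> sets borel"
  shows "measure p E \<le> measure a E" "measure n E \<le> measure b E"
proof -
  interpret a: finite_measure a by fact
  interpret b: finite_measure b by fact
  obtain H where H: "H \<in> sets borel" "emeasure p (- H) = 0" "emeasure n H = 0"
    and fin: "finite_measure p" "finite_measure n" and s: "sets p = sets borel" "sets n = sets borel"
    and eq: "\<And>E. E \<in> sets borel \<Longrightarrow> smeasure \<mu> E = measure p E - measure n E"
    using J by (auto simp: jordan_decomposition_def)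
  interpret p: finite_measure p by fact
  interpret n: finite_measure n by fact
  have \<mu>E: "smeasure \<mu> E = measure a E - measure b E" for E
    using ab \<mu> by (simp add: smeasure_signed_of)
  have p0: "measure p (E \<inter> - H) = 0"
    using H s E p.finite_measure_mono[of "E \<inter> - H" "- H"] by (simp add: p.emeasure_eq_measure measure_le_0_iff)
  have n0: "measure n (E \<inter> H) = 0"
    using H s E n.finite_measure_mono[of "E \<inter> H" "H"] by (simp add: n.emeasure_eq_measure measure_le_0_iff)
  have split: "E = (E \<inter> H) \<union> (E \<inter> - H)" by auto
  have "measure p E = measure p (E \<inter> H) + measure p (E \<inter> - H)"
    by (subst split, rule p.finite_measure_Union) (use E H s in auto)
  also have "\<dots> = smeasure \<mu> (E \<inter> H)" using p0 n0 eq[of "E \<inter> H"] E H by simp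
  also have "\<dots> \<le> measure a (E \<inter> H)" unfolding \<mu>E by simp
  also have "\<dots> \<le> measure a E" using E H ab by (intro a.finite_measure_mono) auto
  finally show "measure p E \<le> measure a E" .
  have "measure n E = measure n (E \<inter> H) + measure n (E \<inter> - H)"
    by (subst split, rule n.finite_measure_Union) (use E H s in auto)
  also have "\<dots> = - smeasure \<mu> (E \<inter> - H)" using p0 n0 eq[of "E \<inter> - H"] E H by simp
  also have "\<dots> \<le> measure b (E \<inter> - H)" unfolding \<mu>E by simp
  also have "\<dots> \<le> measure b E" using E H ab by (intro b.finite_measure_mono) auto
  finally show "measure n E \<le> measure b E" .
qed

lemma jordan_decompositionD:
  assumes "jordan_decomposition \<mu> p n"
  shows "finite_measure p" "finite_measure n" "sets p = sets borel" "sets n = sets borel"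
    "\<mu> = signed_of p - signed_of n"
  using assms by (auto simp: jordan_decomposition_def smeasure_signed_of intro!: smeasure_eqI)

text \<open>Each of the two decompositions is minimal with respect to the other.\<close>

lemma jordan_decomposition_unique:
  assumes J: "jordan_decomposition \<mu> p n" and J': "jordan_decomposition \<mu> p' n'"
  shows "p = p'" "n = n'"
proof -
  note D = jordan_decompositionD[OF J] and D' = jordan_decompositionD[OF J']
  interpret p: finite_measure p by (rule D) interpret n: finite_measure n by (rule D)
  interpret p': finite_measure p' by (rule D') interpret n': finite_measure n' by (rule D')
  note le = jordan_decomposition_minimal[OF J D'(1-5)] jordan_decomposition_minimal[OF J' D(1-5)]
  show "p = p'" using D D' le
    by (intro measure_eqI) (auto simp: p.emeasure_eq_measure p'.emeasure_eq_measure intro: antisym)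
  show "n = n'" using D D' le
    by (intro measure_eqI) (auto simp: n.emeasure_eq_measure n'.emeasure_eq_measure intro: antisym)
qed

lemma jordan_decomposition_parts: "jordan_decomposition \<mu> (pos_part \<mu>) (neg_part \<mu>)"
proof -
  obtain p n where J: "jordan_decomposition \<mu> p n" using jordan_decomposition_exists by blast
  have "pos_part \<mu> = p" unfolding pos_part_def
    using J jordan_decomposition_unique(1)[OF _ J] by (intro the_equality) blast+
  moreover have "neg_part \<mu> = n" unfolding neg_part_def
    using J jordan_decomposition_unique(2)[OF _ J] by (intro the_equality) blast+
  ultimately show ?thesis using J by simp
qed

lemmas pos_neg_parts = jordan_decompositionD[OF jordan_decomposition_parts]

lemma bounded_integrable:
  assumes "finite_measure a" "sets a = sets borel" "g \<in> borel_measurable borel" "\<And>x. \<bar>g x\<bar> \<le> c"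
  shows "integrable a (g :: _ \<Rightarrow> real)"
proof -
  interpret finite_measure a by fact
  show ?thesis using assms
    by (intro integrable_const_bound[of _ c]) (auto cong: measurable_cong_sets)
qed

section \<open>Randomization of measures on products\<close>

text \<open>Binary digits are written in base 3 to leave a gap: a code is at most 1/6 if the first
  digit is 0 and at least 1/3 if it is 1. Each digit is therefore a Borel function of the code, with
  no ambiguity between expansions.\<close>

definition ternary :: "(nat \<Rightarrow> bool) \<Rightarrow> real" where
  "ternary b = (\<Sum>n. of_bool (b n) * (1/3) ^ Suc n)"

definition ternary_shift :: "real \<Rightarrow> real" where
  "ternary_shift t = (if t \<ge> 1/3 then 3 * t - 1 else 3 * t)"

lemma ternary_summable: "summable (\<lambda>n. of_bool (b n) * (1/3 :: real) ^ Suc n)"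
  by (rule summable_comparison_test'[of "\<lambda>n. (1/3) ^ n" 0])
    (auto intro: summable_geometric simp: power_Suc of_bool_def)

lemma ternary_bounds: "0 \<le> ternary b" "ternary b \<le> 1/2"
proof -
  show "0 \<le> ternary b" unfolding ternary_def
    by (rule suminf_nonneg[OF ternary_summable]) simp
  have "(\<lambda>n. (1/3 :: real) * (1/3) ^ n) sums ((1/3) * (1 / (1 - 1/3)))"
    by (intro sums_mult geometric_sums) simp
  then have s: "(\<lambda>n. (1/3 :: real) ^ Suc n) sums (1/2)" by simp
  have "ternary b \<le> (\<Sum>n. (1/3 :: real) ^ Suc n)" unfolding ternary_def
    by (rule suminf_le[OF _ ternary_summable sums_summable[OF s]]) (simp add: of_bool_def)
  then show "ternary b \<le> 1/2" using sums_unique[OF s] by simp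
qed

lemma ternary_unfold: "ternary b = (of_bool (b 0) + ternary (\<lambda>n. b (Suc n))) / 3"
proof -
  have "ternary b = of_bool (b 0) / 3 + (\<Sum>n. of_bool (b (Suc n)) * (1/3) ^ Suc (Suc n))"
    unfolding ternary_def using suminf_split_head[OF ternary_summable[of b]] by simp
  also have "(\<Sum>n. of_bool (b (Suc n)) * (1/3 :: real) ^ Suc (Suc n))
      = (\<Sum>n. (1/3) * (of_bool (b (Suc n)) * (1/3) ^ Suc n))" by (simp add: ac_simps)
  also have "\<dots> = (1/3) * ternary (\<lambda>n. b (Suc n))"
    unfolding ternary_def by (rule suminf_mult[OF ternary_summable])
  finally show ?thesis by (simp add: field_simps)
qed

lemma ternary_ge_iff: "1/3 \<le> ternary b \<longleftrightarrow> b 0"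
  using ternary_unfold[of b] ternary_bounds[of "\<lambda>n. b (Suc n)"] by (cases "b 0") auto

lemma ternary_shift_ternary: "ternary_shift (ternary b) = ternary (\<lambda>n. b (Suc n))"
  unfolding ternary_shift_def ternary_ge_iff using ternary_unfold[of b] by (cases "b 0") (auto simp: field_simps)

lemma ternary_digit: "1/3 \<le> (ternary_shift ^^ n) (ternary b) \<longleftrightarrow> b n"
proof -
  have "(ternary_shift ^^ n) (ternary b) = ternary (\<lambda>k. b (k + n))"
    by (induction n) (simp_all add: ternary_shift_ternary)
  then show ?thesis using ternary_ge_iff[of "\<lambda>k. b (k + n)"] by simp
qed

lemma ternary_shift_measurable [measurable]: "(ternary_shift ^^ n) \<in> borel_measurable borel"
proof (induction n)
  case (Suc n)
  have [measurable]: "ternary_shift \<in> borel_measurable borel"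
    unfolding ternary_shift_def by measurable
  show ?case using Suc by simp
qed (simp add: id_def)

text \<open>A point is recorded by the digits \<open>[dist z (d k) < 1/2^n]\<close> for a dense sequence \<open>d\<close>; they
  determine points \<open>d k\<^sub>n\<close> converging to it.\<close>

lemma real_coding:
  assumes K: "compact (UNIV :: 'k::{metric_space, second_countable_topology} set)"
  obtains e :: "'k::{metric_space, second_countable_topology} \<Rightarrow> real"
    and c :: "real \<Rightarrow> 'k::{metric_space, second_countable_topology}"
  where "e \<in> borel_measurable borel" "c \<in> borel_measurable borel" "\<And>z. c (e z) = z"
proof -
  obtain D :: "'k set" where D: "countable D" "\<And>X. open X \<Longrightarrow> X \<noteq> {} \<Longrightarrow> \<exists>d\<in>D. d \<in> X"
    by (rule countable_dense_setE) blast
  define d where "d = from_nat_into D"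
  have dense: "\<exists>k. dist z (d k) < \<epsilon>" if "\<epsilon> > 0" for z \<epsilon>
  proof -
    have "\<exists>y\<in>D. y \<in> ball z \<epsilon>" using that by (intro D(2)) (auto intro!: exI[of _ z])
    then obtain y where "y \<in> D" "y \<in> ball z \<epsilon>" by blast
    then show ?thesis using from_nat_into_surj[OF D(1)] unfolding d_def by (metis mem_ball)
  qed
  define b where "b z m = (case prod_decode m of (n, k) \<Rightarrow> dist z (d k) < 1 / 2 ^ n)" for z m
  define e where "e z = ternary (b z)" for z
  define k where "k n t = (LEAST k. 1/3 \<le> (ternary_shift ^^ prod_encode (n, k)) t)" for n t
  \<comment> \<open>Only codes of points decode meaningfully. Where the decoded centres are not
    Cauchy they are replaced by a constant, so that \<open>c\<close> is a limit of Borel maps on the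
    whole line.\<close>
  define A where "A = {t. Cauchy (\<lambda>n. d (k n t))}"
  define a where "a n t = (if t \<in> A then d (k n t) else d 0)" for n t
  define c where "c t = lim (\<lambda>n. a n t)" for t
  have "(\<lambda>z. b z m) \<in> measurable borel (count_space UNIV)" for m
    unfolding b_def by (cases "prod_decode m") simp
  then have e: "e \<in> borel_measurable borel" unfolding e_def ternary_def by measurable
  have [measurable]: "k n \<in> measurable borel (count_space UNIV)" for n
    unfolding k_def by measurable
  have dk [measurable]: "(\<lambda>t. d (k n t)) \<in> borel_measurable borel" for n
    by (rule measurable_compose[of "k n" _ "count_space UNIV"]) auto
  have "{t \<in> space borel. Cauchy (\<lambda>n. d (k n t))} \<in> sets borel" by (rule sets_Collect_Cauchy) simp
  then have [measurable]: "A \<in> sets borel" by (simp add: A_def)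
  have [measurable]: "a n \<in> borel_measurable borel" for n unfolding a_def by measurable
  have c: "c \<in> borel_measurable borel"
  proof (rule borel_measurable_LIMSEQ_metric)
    show "(\<lambda>n. a n t) \<longlonglongrightarrow> c t" for t
    proof (cases "t \<in> A")
      case True
      then have "Cauchy (\<lambda>n. d (k n t))" by (simp add: A_def)
      then obtain l where "(\<lambda>n. d (k n t)) \<longlonglongrightarrow> l"
        using compact_imp_complete[OF K] unfolding complete_def by auto
      then show ?thesis unfolding c_def a_def using True by (simp add: limI)
    qed (simp add: a_def c_def)
  qed simp
  have ce: "c (e z) = z" for z
  proof -
    have near: "dist (d (k n (e z))) z < 1 / 2 ^ n" for n
    proof -
      have eq: "k n (e z) = (LEAST k. dist z (d k) < 1 / 2 ^ n)"
        unfolding k_def e_def ternary_digit by (simp add: b_def)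
      obtain j where "dist z (d j) < 1 / 2 ^ n" using dense[of "1/2^n" z] by auto
      then show ?thesis unfolding eq by (metis (mono_tags, lifting) LeastI dist_commute)
    qed
    have "(\<lambda>n. (1/2 :: real) ^ n) \<longlonglongrightarrow> 0" by (rule LIMSEQ_power_zero) simp
    then have lim: "(\<lambda>n. d (k n (e z))) \<longlonglongrightarrow> z"
      by (rule metric_tendsto_imp_tendsto)
        (use near in \<open>auto intro!: always_eventually less_imp_le simp: power_divide\<close>)
    then have "e z \<in> A" by (simp add: A_def LIMSEQ_imp_Cauchy)
    then show ?thesis unfolding c_def a_def using lim by (simp add: limI)
  qed
  show ?thesis using that e c ce by blast
qed

text \<open>On the set where \<open>g < f\<close> the difference \<open>f - g\<close> is positive,
  yet the hypothesis makes its integral zero; finiteness of the integral of \<open>g\<close>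
  justifies the subtraction.\<close>

lemma AE_le_of_nn_integral_le:
  assumes [measurable]: "f \<in> borel_measurable M" "g \<in> borel_measurable M"
    and le: "\<And>A. A \<in> sets M \<Longrightarrow> (\<integral>\<^sup>+x\<in>A. f x \<partial>M) \<le> (\<integral>\<^sup>+x\<in>A. g x \<partial>M)"
    and fin: "(\<integral>\<^sup>+x. g x \<partial>M) < \<infinity>"
  shows "AE x in M. f x \<le> g x"
proof -
  let ?A = "{x \<in> space M. g x < f x}"
  have [measurable]: "?A \<in> sets M" by measurable
  have "(\<integral>\<^sup>+x. f x * indicator ?A x - g x * indicator ?A x \<partial>M)
      = (\<integral>\<^sup>+x\<in>?A. f x \<partial>M) - (\<integral>\<^sup>+x\<in>?A. g x \<partial>M)"
  proof (rule nn_integral_diff)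
    have "(\<integral>\<^sup>+x\<in>?A. g x \<partial>M) \<le> (\<integral>\<^sup>+x. g x \<partial>M)"
      by (intro nn_integral_mono) (auto simp: indicator_def)
    then show "(\<integral>\<^sup>+x\<in>?A. g x \<partial>M) \<noteq> \<infinity>" using fin by (auto simp: top_unique)
  qed (auto simp: indicator_def)
  also have "\<dots> = 0"
  proof -
    have "(\<integral>\<^sup>+x\<in>?A. g x \<partial>M) \<le> (\<integral>\<^sup>+x. g x \<partial>M)"
      by (intro nn_integral_mono) (auto simp: indicator_def)
    then have "(\<integral>\<^sup>+x\<in>?A. f x \<partial>M) \<le> (\<integral>\<^sup>+x. g x \<partial>M)"
      by (rule order_trans[OF le[OF \<open>?A \<in> sets M\<close>]])
    then have "(\<integral>\<^sup>+x\<in>?A. f x \<partial>M) < top" using fin by (simp add: le_less_trans)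
    then show ?thesis using le[of ?A] by (simp add: diff_eq_0_iff_ennreal)
  qed
  finally have "AE x in M. f x * indicator ?A x - g x * indicator ?A x = 0"
    by (subst (asm) nn_integral_0_iff_AE) auto
  then show ?thesis
    using AE_space
  proof (eventually_elim)
    case (elim x)
    show ?case
    proof (rule ccontr)
      assume "\<not> f x \<le> g x"
      then show False using elim
        by (auto simp: indicator_def not_le diff_eq_0_iff_ennreal split: if_splits)
    qed
  qed
qed

text \<open>Kept on the full Borel algebra of the line, so that products with it have the product
  algebra of \<open>borel\<close> and no restricted spaces appear.\<close>

definition unit_uniform :: "real measure" where
  "unit_uniform = uniform_measure lborel {0..1}"

lemma prob_space_unit_uniform: "prob_space unit_uniform"
  unfolding unit_uniform_def by (rule prob_space_uniform_measure) auto

lemma sets_unit_uniform [simp, measurable_cong]: "sets unit_uniform = sets borel"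
  by (simp add: unit_uniform_def)

lemma space_unit_uniform [simp]: "space unit_uniform = UNIV"
  by (simp add: unit_uniform_def)

text \<open>Points outside the unit interval carry no mass. This absorbs both the negative reals,
  which \<open>ennreal\<close> sends to 0, and values of \<open>r\<close> above 1.\<close>

lemma emeasure_unit_uniform_less:
  fixes r :: ennreal
  shows "emeasure unit_uniform {u. ennreal u < r} = min 1 r"
proof (cases "r > 1")
  case True
  have "emeasure unit_uniform {u. ennreal u < r} = emeasure lborel ({0..1} \<inter> {u :: real. ennreal u < r})"
    unfolding unit_uniform_def by (subst emeasure_uniform_measure) (auto simp: divide_ennreal_def)
  also have "{0..1} \<inter> {u. ennreal u < r} = {0..1 :: real}"
    using True by (auto intro: le_less_trans[of _ 1] simp: ennreal_le_1)
  finally show ?thesis using True by simp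
next
  case False
  then obtain c where c: "r = ennreal c" "0 \<le> c" "c \<le> 1"
    by (cases r) (auto simp: not_less top_unique)
  have "emeasure unit_uniform {u. ennreal u < r} = emeasure lborel ({0..1} \<inter> {u :: real. ennreal u < r})"
    unfolding unit_uniform_def by (subst emeasure_uniform_measure) (auto simp: divide_ennreal_def)
  also have "{0..1} \<inter> {u. ennreal u < r} = {0..<c}"
    using c by (auto simp: ennreal_less_iff)
  finally show ?thesis using False c by (simp add: min_def)
qed

text \<open>Running maxima of an enumeration of the rationals below \<open>t\<close>. They exhaust
  the half-line \<open>{..<t}\<close> by an increasing sequence of rational half-lines, also for
  \<open>t = \<infinity>\<close>, as monotone convergence will require.\<close>

lemma ereal_rat_approx_below:
  fixes t :: ereal
  assumes "t \<noteq> -\<infinity>"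
  obtains s :: "nat \<Rightarrow> rat" where "incseq s" "\<And>n. ereal (real_of_rat (s n)) < t"
    "\<And>y. y < t \<Longrightarrow> \<exists>n. y < ereal (real_of_rat (s n))"
proof -
  let ?C = "{q. ereal (real_of_rat q) < t}"
  have dense: "\<exists>q\<in>?C. y < ereal (real_of_rat q)" if lt: "y < t" for y
  proof -
    obtain r where r: "y < ereal r" "ereal r < t" using ereal_dense2[OF lt] by blast
    obtain r' where r': "ereal r < ereal r'" "ereal r' < t" using ereal_dense2[OF r(2)] by blast
    obtain q where q: "r < real_of_rat q" "real_of_rat q < r'" using of_rat_dense[of r r'] r' by auto
    have "y < ereal (real_of_rat q)" using r(1) by (rule less_trans) (simp add: q)
    moreover have "ereal (real_of_rat q) < t" by (rule less_trans[OF _ r'(2)]) (simp add: q)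
    ultimately show ?thesis by blast
  qed
  have ne: "?C \<noteq> {}" using dense[of "-\<infinity>"] assms by auto
  define m where "m n = from_nat_into ?C n" for n
  define s where "s n = Max (m ` {..n})" for n
  have mC: "m n \<in> ?C" for n unfolding m_def using ne by (rule from_nat_into)
  show ?thesis
  proof (rule that[of s])
    show "incseq s" unfolding s_def by (intro monoI Max_mono) auto
    have "s n \<in> m ` {..n}" for n unfolding s_def by (rule Max_in) auto
    then show "ereal (real_of_rat (s n)) < t" for n using mC by (metis (mono_tags, lifting) imageE mem_Collect_eq)
    fix y assume "y < t"
    then obtain q where q: "q \<in> ?C" "y < ereal (real_of_rat q)" using dense by blast
    obtain n where "m n = q" unfolding m_def
      using from_nat_into_surj[of ?C q] q(1) by (meson countableI_type)
    then have "q \<le> s n" unfolding s_def by (intro Max_ge) auto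
    then have "ereal (real_of_rat q) \<le> ereal (real_of_rat (s n))" by (simp add: of_rat_less_eq)
    then show "\<exists>n. y < ereal (real_of_rat (s n))" using q(2) less_le_trans by blast
  qed
qed

text \<open>Quantile construction of a measure on a product: on each fibre the conditional distribution
  function is inverted. Only its values at rational points are used, where it is a Radon-Nikodym
  derivative.\<close>

lemma randomization_ereal:
  fixes p :: "('a \<times> ereal) measure"
  assumes fin: "finite_measure p" and sp [measurable_cong]: "sets p = sets (N \<Otimes>\<^sub>M borel)"
  obtains Q where "Q \<in> borel_measurable (N \<Otimes>\<^sub>M borel)"
    "p = distr (distr p N fst \<Otimes>\<^sub>M unit_uniform) (N \<Otimes>\<^sub>M borel) (\<lambda>x. (fst x, Q x))"
proof -
  interpret p: finite_measure p by fact
  interpret U: prob_space unit_uniform by (rule prob_space_unit_uniform)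
  define \<nu> where "\<nu> = distr p N fst"
  have sp_p: "space p = space N \<times> UNIV"
    using sets_eq_imp_space_eq[OF sp] by (simp add: space_pair_measure)
  have fst_p [measurable]: "fst \<in> measurable p N" "snd \<in> borel_measurable p"
    using sp by (auto cong: measurable_cong_sets)
  have s\<nu> [simp, measurable_cong]: "sets \<nu> = sets N" and sp\<nu> [simp]: "space \<nu> = space N"
    by (auto simp: \<nu>_def)
  interpret \<nu>: finite_measure \<nu> unfolding \<nu>_def by (rule p.finite_measure_distr) simp
  define below where "below q A = {z \<in> space p. fst z \<in> A \<and> snd z < ereal (real_of_rat q)}" for q A
  have below_meas [measurable]: "below q A \<in> sets p" if [measurable]: "A \<in> sets N" for q A
    unfolding below_def by measurable
  have below_mono: "below q A \<subseteq> below r A" if "q \<le> r" for q r A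
  proof -
    have "ereal (real_of_rat q) \<le> ereal (real_of_rat r)" using that by (simp add: of_rat_less_eq)
    then show ?thesis unfolding below_def using less_le_trans by blast
  qed
  define P where "P q = distr (restrict_space p (below q (space N))) N fst" for q
  have eP: "emeasure (P q) A = emeasure p (below q A)" if A: "A \<in> sets N" for q A
  proof -
    have m: "fst \<in> measurable (restrict_space p (below q (space N))) N"
      by (rule measurable_restrict_space1) simp
    have "emeasure (P q) A = emeasure (restrict_space p (below q (space N)))
        (fst -` A \<inter> space (restrict_space p (below q (space N))))"
      unfolding P_def by (rule emeasure_distr[OF m A])
    also have "fst -` A \<inter> space (restrict_space p (below q (space N))) = below q A"
      using sets.sets_into_space[OF A] by (auto simp: below_def space_restrict_space sp_p)
    also have "emeasure (restrict_space p (below q (space N))) (below q A) = emeasure p (below q A)"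
      using sets.sets_into_space[OF A] by (intro emeasure_restrict_space) (auto simp: below_def)
    finally show ?thesis .
  qed
  have e\<nu>: "emeasure \<nu> A = emeasure p {z \<in> space p. fst z \<in> A}" if "A \<in> sets N" for A
    unfolding \<nu>_def using that by (subst emeasure_distr) (auto intro: arg_cong[where f = "emeasure p"])
  \<comment> \<open>\<open>R q x\<close> plays the role of the conditional probability, given the
    first coordinate \<open>x\<close>, that the second coordinate lies below
    \<open>q\<close>.\<close>
  define R where "R q = RN_deriv \<nu> (P q)" for q
  have R_meas [measurable]: "R q \<in> borel_measurable N" for q
    unfolding R_def by (subst measurable_cong_sets[OF s\<nu>[symmetric] refl], rule borel_measurable_RN_deriv)
  have Rm\<nu> [measurable]: "R q \<in> borel_measurable \<nu>" for q
    unfolding R_def by (rule borel_measurable_RN_deriv)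
  have sP [simp]: "sets (P q) = sets N" for q by (simp add: P_def)
  have R_int: "(\<integral>\<^sup>+x\<in>A. R q x \<partial>\<nu>) = emeasure p (below q A)" if A: "A \<in> sets N" for q A
  proof -
    have "absolutely_continuous \<nu> (P q)"
      unfolding absolutely_continuous_def
    proof
      fix B assume "B \<in> null_sets \<nu>"
      then have B: "B \<in> sets N" "emeasure p {z \<in> space p. fst z \<in> B} = 0" using e\<nu>[of B] by (auto simp: null_sets_def)
      have "emeasure p (below q B) \<le> emeasure p {z \<in> space p. fst z \<in> B}"
        using B(1) by (intro emeasure_mono) (auto simp: below_def)
      then show "B \<in> null_sets (P q)" using B by (intro null_setsI) (simp_all add: eP)
    qed
    then have "density \<nu> (R q) = P q"
      unfolding R_def by (intro \<nu>.density_RN_deriv) simp_all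
    then have "emeasure (P q) A = emeasure (density \<nu> (R q)) A" by simp
    also have "\<dots> = (\<integral>\<^sup>+x\<in>A. R q x \<partial>\<nu>)" using A by (intro emeasure_density Rm\<nu>) simp
    finally show ?thesis using eP[OF A] by simp
  qed
  \<comment> \<open>Each comparison holds only almost everywhere, but there are countably many pairs
    of rationals, so one null set serves for all of them.\<close>
  have R_mono: "AE x in \<nu>. \<forall>q r. q \<le> r \<longrightarrow> R q x \<le> R r x"
  proof -
    have "AE x in \<nu>. R q x \<le> R r x" if "q \<le> r" for q r
    proof (rule AE_le_of_nn_integral_le)
      show "(\<integral>\<^sup>+x\<in>A. R q x \<partial>\<nu>) \<le> (\<integral>\<^sup>+x\<in>A. R r x \<partial>\<nu>)" if "A \<in> sets \<nu>" for A
        using that below_mono[OF \<open>q \<le> r\<close>] by (auto simp: R_int intro!: emeasure_mono)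
      have "(\<integral>\<^sup>+x\<in>space N. R r x \<partial>\<nu>) = (\<integral>\<^sup>+x. R r x \<partial>\<nu>)"
        by (intro nn_integral_cong) (simp add: indicator_def)
      then show "(\<integral>\<^sup>+x. R r x \<partial>\<nu>) < \<infinity>"
        using R_int[of "space N" r] p.emeasure_finite[of "below r (space N)"] by (simp add: less_top)
    qed auto
    then have "AE x in \<nu>. q \<le> r \<longrightarrow> R q x \<le> R r x" for q r by (cases "q \<le> r") auto
    then show ?thesis by (simp add: AE_all_countable)
  qed
  have R_le_1: "AE x in \<nu>. \<forall>q. R q x \<le> 1"
  proof -
    have "AE x in \<nu>. R q x \<le> 1" for q
    proof (rule AE_le_of_nn_integral_le)
      show "(\<integral>\<^sup>+x\<in>A. R q x \<partial>\<nu>) \<le> (\<integral>\<^sup>+x\<in>A. 1 \<partial>\<nu>)" if "A \<in> sets \<nu>" for A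
        using that by (auto simp: R_int e\<nu> below_def intro!: emeasure_mono)
      show "(\<integral>\<^sup>+x. 1 \<partial>\<nu>) < \<infinity>" by (simp add: top.not_eq_extremum[symmetric])
    qed auto
    then show ?thesis unfolding AE_all_countable by blast
  qed
  \<comment> \<open>The quantile at level \<open>snd z\<close>. The infimum is taken in the extended
    reals, so it exists at every level: it is \<infinity> when no rational qualifies and may be
    -\<infinity>.\<close>
  define Q where "Q z = (INF q. if ennreal (snd z) < R q (fst z) then ereal (real_of_rat q) else \<infinity>)" for z
  have Q_meas [measurable]: "Q \<in> borel_measurable (N \<Otimes>\<^sub>M borel)"
    unfolding Q_def
  proof (rule borel_measurable_INF)
    fix q
    have [measurable]: "(\<lambda>z. R q (fst z)) \<in> borel_measurable (N \<Otimes>\<^sub>M borel)"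
      by (rule measurable_compose[OF measurable_fst R_meas])
    show "(\<lambda>z. if ennreal (snd z) < R q (fst z) then ereal (real_of_rat q) else \<infinity>)
        \<in> borel_measurable (N \<Otimes>\<^sub>M (borel :: real measure))" by measurable
  qed simp
  \<comment> \<open>With strict inequalities on both sides the inversion is exact, whatever the
    continuity of \<open>R\<close> in \<open>q\<close>.\<close>
  have Q_less: "Q (x, u) < t \<longleftrightarrow> (\<exists>q. ereal (real_of_rat q) < t \<and> ennreal u < R q x)" for x u t
    unfolding Q_def INF_less_iff by (auto split: if_splits)
  define law where "law = distr (\<nu> \<Otimes>\<^sub>M unit_uniform) (N \<Otimes>\<^sub>M borel) (\<lambda>x. (fst x, Q x))"
  have meas1 [measurable]: "(\<lambda>x. (fst x, Q x)) \<in> measurable (\<nu> \<Otimes>\<^sub>M unit_uniform) (N \<Otimes>\<^sub>M borel)"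
  proof (rule measurable_Pair)
    have s: "sets (\<nu> \<Otimes>\<^sub>M unit_uniform) = sets (N \<Otimes>\<^sub>M borel)"
      by (rule sets_pair_measure_cong) simp_all
    show "fst \<in> measurable (\<nu> \<Otimes>\<^sub>M unit_uniform) N"
      by (subst measurable_cong_sets[OF s refl]) simp
    show "Q \<in> measurable (\<nu> \<Otimes>\<^sub>M unit_uniform) borel"
      by (subst measurable_cong_sets[OF s refl]) (simp add: Q_meas)
  qed
  have e_law: "emeasure law (A \<times> B) = (\<integral>\<^sup>+x\<in>A. emeasure unit_uniform {u. Q (x, u) \<in> B} \<partial>\<nu>)"
    if A [measurable]: "A \<in> sets N" and B [measurable]: "B \<in> sets borel" for A B
  proof -
    have AB: "A \<times> B \<in> sets (N \<Otimes>\<^sub>M borel)" by measurable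
    have "emeasure law (A \<times> B) = emeasure (\<nu> \<Otimes>\<^sub>M unit_uniform)
        ((\<lambda>x. (fst x, Q x)) -` (A \<times> B) \<inter> space (\<nu> \<Otimes>\<^sub>M unit_uniform))"
      unfolding law_def by (rule emeasure_distr[OF meas1 AB])
    also have "\<dots> = (\<integral>\<^sup>+x. emeasure unit_uniform
        (Pair x -` ((\<lambda>x. (fst x, Q x)) -` (A \<times> B) \<inter> space (\<nu> \<Otimes>\<^sub>M unit_uniform))) \<partial>\<nu>)"
      by (rule U.emeasure_pair_measure_alt) (rule measurable_sets[OF meas1 AB])
    also have "\<dots> = (\<integral>\<^sup>+x\<in>A. emeasure unit_uniform {u. Q (x, u) \<in> B} \<partial>\<nu>)"
    proof (intro nn_integral_cong)
      fix x assume "x \<in> space \<nu>"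
      then have "Pair x -` ((\<lambda>x. (fst x, Q x)) -` (A \<times> B) \<inter> space (\<nu> \<Otimes>\<^sub>M unit_uniform))
          = (if x \<in> A then {u. Q (x, u) \<in> B} else {})"
        by (auto simp: space_pair_measure)
      then show "emeasure unit_uniform (Pair x -` ((\<lambda>x. (fst x, Q x)) -` (A \<times> B) \<inter> space (\<nu> \<Otimes>\<^sub>M unit_uniform)))
          = emeasure unit_uniform {u. Q (x, u) \<in> B} * indicator A x" by (simp add: indicator_def)
    qed
    finally show ?thesis .
  qed
  have law_less: "emeasure law (A \<times> {..<t}) = emeasure p (A \<times> {..<t})" if A: "A \<in> sets N" for A t
  proof (cases "t = -\<infinity>")
    case True
    then have "{..<t} = {}" by auto
    then show ?thesis by (simp only: Sigma_empty2 emeasure_empty)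
  next
    case False
    obtain s :: "nat \<Rightarrow> rat" where s: "incseq s" "\<And>n. ereal (real_of_rat (s n)) < t"
      "\<And>y. y < t \<Longrightarrow> \<exists>n. y < ereal (real_of_rat (s n))"
      using False by (rule ereal_rat_approx_below) blast
    \<comment> \<open>Monotonicity in the rationals reduces the condition over all rationals below
      \<open>t\<close> to the sequence \<open>s n\<close>, and the bound by 1 removes the minimum in
      the uniform law.\<close>
    have fibre: "AE x in \<nu>. emeasure unit_uniform {u. Q (x, u) < t} = (SUP n. R (s n) x)"
      using R_mono R_le_1
    proof eventually_elim
      case (elim x)
      have "Q (x, u) < t \<longleftrightarrow> ennreal u < (SUP n. R (s n) x)" for u
      proof
        assume "Q (x, u) < t"
        then obtain q where q: "ereal (real_of_rat q) < t" "ennreal u < R q x"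
          unfolding Q_less by blast
        then obtain n where n: "ereal (real_of_rat q) < ereal (real_of_rat (s n))" using s(3) by blast
        then have "R q x \<le> R (s n) x" using elim(1) by (simp add: of_rat_less less_imp_le)
        then have "ennreal u < R (s n) x" using q(2) by (rule less_le_trans[rotated])
        then show "ennreal u < (SUP n. R (s n) x)" by (rule less_le_trans) (rule SUP_upper, simp)
      next
        assume "ennreal u < (SUP n. R (s n) x)"
        then obtain n where "ennreal u < R (s n) x" unfolding less_SUP_iff by blast
        then show "Q (x, u) < t" unfolding Q_less using s(2) by blast
      qed
      then have "{u. Q (x, u) < t} = {u. ennreal u < (SUP n. R (s n) x)}" by simp
      moreover have "(SUP n. R (s n) x) \<le> 1" using elim by (auto intro: SUP_least)
      ultimately show ?case by (simp add: emeasure_unit_uniform_less min_absorb2)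
    qed
    have "emeasure law (A \<times> {..<t}) = (\<integral>\<^sup>+x\<in>A. emeasure unit_uniform {u. Q (x, u) < t} \<partial>\<nu>)"
      using e_law[OF A, of "{..<t}"] by simp
    also have "\<dots> = (\<integral>\<^sup>+x. (SUP n. R (s n) x * indicator A x) \<partial>\<nu>)"
      using fibre by (intro nn_integral_cong_AE) (auto simp: indicator_def elim: eventually_mono)
    also have "\<dots> = (SUP n. (\<integral>\<^sup>+x\<in>A. R (s n) x \<partial>\<nu>))"
    proof (rule nn_integral_monotone_convergence_SUP_AE)
      show "AE x in \<nu>. R (s n) x * indicator A x \<le> R (s (Suc n)) x * indicator A x" for n
        using R_mono incseqD[OF s(1), of n "Suc n"] by (auto simp: indicator_def elim: eventually_mono)
    qed (use A in \<open>auto cong: measurable_cong_sets\<close>)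
    also have "\<dots> = (SUP n. emeasure p (below (s n) A))" by (simp add: R_int[OF A])
    also have "\<dots> = emeasure p (\<Union>n. below (s n) A)"
      using below_mono s(1) by (intro SUP_emeasure_incseq) (auto simp: A incseq_def below_meas)
    also have "(\<Union>n. below (s n) A) = A \<times> {..<t}"
      using s(2,3) sets.sets_into_space[OF A]
      by (auto simp: below_def sp_p intro: less_trans)
    finally show ?thesis .
  qed
  have "law = p"
  proof (rule measure_eqI_generator_eq)
    \<comment> \<open>\<open>UNIV\<close> is added because \<open>{..<t}\<close> never contains
      \<infinity>; the total mass over \<open>A\<close> is therefore compared separately.\<close>
    let ?E = "{A \<times> B |A B. A \<in> sets N \<and> B \<in> range lessThan \<union> {UNIV :: ereal set}}"
    show "Int_stable ?E"
    proof (rule Int_stableI)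
      fix X Y assume "X \<in> ?E" "Y \<in> ?E"
      then obtain A B A' B' where *: "X = A \<times> B" "Y = A' \<times> B'" "A \<in> sets N" "A' \<in> sets N"
        "B \<in> range lessThan \<union> {UNIV :: ereal set}" "B' \<in> range lessThan \<union> {UNIV :: ereal set}"
        by blast
      have "{..<s} \<inter> {..<t} = {..<min s t}" for s t :: ereal by auto
      then have "B \<inter> B' \<in> range lessThan \<union> {UNIV :: ereal set}" using *(5,6) by auto
      moreover have "X \<inter> Y = (A \<inter> A') \<times> (B \<inter> B')" using *(1,2) by auto
      ultimately show "X \<inter> Y \<in> ?E" using *(3,4) by blast
    qed
    show E_sub: "?E \<subseteq> Pow (space N \<times> UNIV)" using sets.sets_into_space by blast
    have gen: "sets (N \<Otimes>\<^sub>M borel) = sigma_sets (space N \<times> UNIV) ?E"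
    proof -
      have "sets (N \<Otimes>\<^sub>M borel) = sets (sigma (space N \<times> space (borel :: ereal measure)) ?E)"
      proof (rule sets_pair_eq[where Ca = "{space N}" and Cb = "{UNIV}"])
        show "sets (borel :: ereal measure) = sigma_sets (space borel) (range lessThan \<union> {UNIV})"
        proof -
          have "sigma_sets UNIV (range lessThan \<union> {UNIV}) = sigma_sets UNIV (range lessThan :: ereal set set)"
            by (rule sigma_sets_eqI) (auto intro: sigma_sets_top)
          then show ?thesis by (subst borel_Iio) simp
        qed
      qed (auto simp: sets.sigma_sets_eq dest: sets.sets_into_space[THEN subsetD])
      then show ?thesis using E_sub by simp
    qed
    show "sets law = sigma_sets (space N \<times> UNIV) ?E" "sets p = sigma_sets (space N \<times> UNIV) ?E"
      using gen sp by (simp_all add: law_def)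
    show "range (\<lambda>_::nat. space N \<times> UNIV) \<subseteq> ?E" "(\<Union>i::nat. space N \<times> UNIV) = space N \<times> UNIV" by auto
    show "emeasure law X = emeasure p X" if X: "X \<in> ?E" for X
    proof -
      obtain A B where AB: "X = A \<times> B" "A \<in> sets N" "B \<in> range lessThan \<union> {UNIV}" using X by auto
      have "emeasure law (A \<times> UNIV) = emeasure p (A \<times> UNIV)"
      proof -
        have "emeasure law (A \<times> UNIV) = emeasure \<nu> A"
          using e_law[OF AB(2), of UNIV] U.emeasure_space_1 AB(2) by simp
        also have "\<dots> = emeasure p (A \<times> UNIV)"
          using sets.sets_into_space[OF AB(2)] e\<nu>[OF AB(2)]
          by (auto simp: sp_p intro!: arg_cong[where f = "emeasure p"])
        finally show ?thesis .
      qed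
      then show ?thesis using AB law_less by auto
    qed
    show "emeasure law (space N \<times> UNIV) \<noteq> \<infinity>" for i :: nat
    proof -
      have "emeasure law (space N \<times> UNIV) = emeasure \<nu> (space N)"
        using e_law[of "space N" UNIV] U.emeasure_space_1 by simp
      then show ?thesis using \<nu>.emeasure_finite[of "space N"] by simp
    qed
  qed
  then show ?thesis using that[OF Q_meas] unfolding law_def \<nu>_def by simp
qed


text \<open>\<open>K\<close> is coded by reals with a Borel left inverse \<open>c\<close>, so a
  quantile for the coded measure can be decoded. Values of \<open>Q\<close> that are not codes are
  harmless, because decoding is total and only the law of \<open>(fst x, Q x)\<close>
  matters.\<close>

lemma randomization:
  fixes p :: "('a \<times> 'k::{metric_space, second_countable_topology}) measure"
  assumes K: "compact (UNIV :: 'k set)"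
    and fin: "finite_measure p" and sp [measurable_cong]: "sets p = sets (N \<Otimes>\<^sub>M borel)"
  obtains \<Psi> where "\<Psi> \<in> borel_measurable (N \<Otimes>\<^sub>M borel)"
    "p = distr (distr p N fst \<Otimes>\<^sub>M unit_uniform) (N \<Otimes>\<^sub>M borel) (\<lambda>x. (fst x, \<Psi> x))"
proof -
  obtain e :: "'k \<Rightarrow> real" and c :: "real \<Rightarrow> 'k"
    where [measurable]: "e \<in> borel_measurable borel" "c \<in> borel_measurable borel"
      and ce: "\<And>z. c (e z) = z"
    using real_coding[OF K] by metis
  define enc :: "'a \<times> 'k \<Rightarrow> 'a \<times> ereal" where "enc z = (fst z, ereal (e (snd z)))" for z
  define dec :: "'a \<times> ereal \<Rightarrow> 'a \<times> 'k" where "dec z = (fst z, c (real_of_ereal (snd z)))" for z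
  have [measurable]: "enc \<in> measurable (N \<Otimes>\<^sub>M borel) (N \<Otimes>\<^sub>M borel)"
    unfolding enc_def by measurable
  have [measurable]: "dec \<in> measurable (N \<Otimes>\<^sub>M borel) (N \<Otimes>\<^sub>M borel)"
    unfolding dec_def by measurable
  define p' where "p' = distr p (N \<Otimes>\<^sub>M borel) enc"
  interpret finite_measure p by fact
  have "finite_measure p'" unfolding p'_def by (rule finite_measure_distr) simp
  moreover have "sets p' = sets (N \<Otimes>\<^sub>M borel)" by (simp add: p'_def)
  ultimately obtain Q where Q: "Q \<in> borel_measurable (N \<Otimes>\<^sub>M borel)"
    "p' = distr (distr p' N fst \<Otimes>\<^sub>M unit_uniform) (N \<Otimes>\<^sub>M borel) (\<lambda>x. (fst x, Q x))"
    by (rule randomization_ereal)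
  have marg: "distr p' N fst = distr p N fst"
    unfolding p'_def by (subst distr_distr) (auto simp: enc_def o_def)
  define \<Psi> where "\<Psi> x = c (real_of_ereal (Q x))" for x
  have \<Psi>: "\<Psi> \<in> borel_measurable (N \<Otimes>\<^sub>M borel)" unfolding \<Psi>_def using Q(1) by measurable
  have s: "sets (distr p N fst \<Otimes>\<^sub>M unit_uniform) = sets (N \<Otimes>\<^sub>M borel)"
    by (rule sets_pair_measure_cong) simp_all
  have fQ: "(\<lambda>x. (fst x, Q x)) \<in> measurable (distr p N fst \<Otimes>\<^sub>M unit_uniform) (N \<Otimes>\<^sub>M borel)"
    by (subst measurable_cong_sets[OF s refl]) (use Q(1) in measurable)
  have "p = distr p (N \<Otimes>\<^sub>M borel) (dec \<circ> enc)"
    by (simp add: enc_def dec_def o_def ce distr_id2 sp)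
  also have "\<dots> = distr p' (N \<Otimes>\<^sub>M borel) dec"
    unfolding p'_def by (subst distr_distr) (auto simp: o_def)
  also have "\<dots> = distr (distr p N fst \<Otimes>\<^sub>M unit_uniform) (N \<Otimes>\<^sub>M borel) (dec \<circ> (\<lambda>x. (fst x, Q x)))"
    by (subst Q(2), subst marg, subst distr_distr[OF _ fQ]) (auto simp: o_def)
  finally have "p = distr (distr p N fst \<Otimes>\<^sub>M unit_uniform) (N \<Otimes>\<^sub>M borel) (\<lambda>x. (fst x, \<Psi> x))"
    by (simp add: dec_def \<Psi>_def o_def)
  with \<Psi> show ?thesis by (rule that)
qed

section \<open>Disintegration along the fibres\<close>

lemma borel_measurable_sets_eq: "sets M = sets N \<Longrightarrow> h \<in> borel_measurable N \<Longrightarrow> h \<in> borel_measurable M"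
  by (simp cong: measurable_cong_sets)

lemma borel_probD:
  assumes "borel_prob m1"
  shows "prob_space m1" "sets m1 = sets borel" "space m1 = UNIV"
  using assms sets_eq_imp_space_eq[of m1 borel] by (auto simp: borel_prob_def)

lemma marginal_density_measurable [measurable]:
  assumes "borel_prob m1"
  shows "marginal_density m1 p \<in> borel_measurable borel"
proof -
  have "RN_deriv m1 (distr p borel fst) \<in> borel_measurable borel"
    by (rule borel_measurable_sets_eq[OF borel_probD(2)[OF assms, symmetric] borel_measurable_RN_deriv])
  then show ?thesis unfolding marginal_density_def by measurable
qed

text \<open>The marginal is a finite measure, so its Radon-Nikodym derivative is finite almost
  everywhere and \<open>enn2real\<close> loses nothing.\<close>

lemma density_marginal_density:
  fixes p :: "('m::topological_space \<times> 'k::topological_space) measure"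
  assumes m1: "borel_prob m1" and p: "finite_measure p" "fst \<in> borel_measurable p"
    and ac: "absolutely_continuous m1 (distr p borel fst)"
  shows "density m1 (\<lambda>x. ennreal (marginal_density m1 p x)) = distr p borel fst"
proof -
  note m = borel_probD[OF m1]
  interpret prob_space m1 by (rule m)
  interpret p: finite_measure p by (rule p)
  interpret d: finite_measure "distr p borel fst" by (rule p.finite_measure_distr) (rule p)
  have "AE x in m1. RN_deriv m1 (distr p borel fst) x \<noteq> \<infinity>"
    using ac m by (intro RN_deriv_finite d.sigma_finite_measure_axioms) simp_all
  then have "density m1 (\<lambda>x. ennreal (marginal_density m1 p x)) = density m1 (RN_deriv m1 (distr p borel fst))"
    using marginal_density_measurable[OF m1, of p] m(2)
    by (intro density_cong) (auto simp: marginal_density_def less_top cong: measurable_cong_sets elim: eventually_mono)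
  also have "\<dots> = distr p borel fst" using ac m by (intro density_RN_deriv) simp_all
  finally show ?thesis .
qed

lemma sets_borel_prod:
  "sets (borel :: ('a::second_countable_topology \<times> 'b::second_countable_topology) measure) = sets (borel \<Otimes>\<^sub>M borel)"
  by (rule arg_cong[OF borel_prod[symmetric]])

lemma measurable_fst_borel [measurable]: "fst \<in> borel_measurable (borel :: ('a::topological_space \<times> 'b::topological_space) measure)"
  and measurable_snd_borel [measurable]: "snd \<in> borel_measurable (borel :: ('a::topological_space \<times> 'b::topological_space) measure)"
  by (intro borel_measurable_continuous_onI continuous_intros)+

text \<open>With \<open>p\<close> written as the law of \<open>(x, \<Psi> (x, u))\<close>,
  \<open>u\<close> uniform, the conditional measure at \<open>x\<close> is the law with
  \<open>x\<close> frozen. It sits on the fibre over every \<open>x\<close>, and it depends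
  measurably on \<open>x\<close> because it is the image of one fixed measure under a jointly
  measurable map.\<close>

theorem rokhlin_disintegration_exists:
  fixes p :: "('m::{metric_space, second_countable_topology} \<times> 'k::{metric_space, second_countable_topology}) measure"
  assumes K: "compact (UNIV :: 'k set)" and m1: "borel_prob m1"
    and p: "finite_measure p" "sets p = sets borel" and ac: "absolutely_continuous m1 (distr p borel fst)"
  shows "\<exists>\<kappa>. rokhlin_disintegration m1 p \<kappa>"
proof -
  interpret U: prob_space unit_uniform by (rule prob_space_unit_uniform)
  define \<nu> where "\<nu> = distr p borel fst"
  have sp: "sets p = sets (borel \<Otimes>\<^sub>M borel)" using p(2) sets_borel_prod by metis
  obtain \<Psi> where \<Psi> [measurable]: "\<Psi> \<in> borel_measurable (borel \<Otimes>\<^sub>M borel)"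
    and eq: "p = distr (\<nu> \<Otimes>\<^sub>M unit_uniform) (borel \<Otimes>\<^sub>M borel) (\<lambda>x. (fst x, \<Psi> x))"
    unfolding \<nu>_def by (rule randomization[OF K p(1) sp])
  define \<kappa> where "\<kappa> x = distr unit_uniform borel (\<lambda>u. (x, \<Psi> (x, u)))" for x
  have "\<kappa> \<in> measurable borel (prob_algebra borel)"
    unfolding \<kappa>_def
  proof (rule measurable_distr_prob_space2[where M = borel])
    show "(\<lambda>x. unit_uniform) \<in> measurable borel (prob_algebra borel)"
      by (rule measurable_const) (simp add: space_prob_algebra prob_space_unit_uniform)
    show "(\<lambda>(x, u). (x, \<Psi> (x, u))) \<in> measurable (borel \<Otimes>\<^sub>M borel) borel"
      unfolding borel_prod[symmetric] by measurable
  qed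
  moreover have m: "(\<lambda>u. (x, \<Psi> (x, u))) \<in> measurable unit_uniform borel" for x
    unfolding borel_prod[symmetric] by measurable
  have "emeasure (\<kappa> x) ({x} \<times> UNIV) = 1" for x
  proof -
    have "{x} \<times> UNIV \<in> sets (borel \<Otimes>\<^sub>M borel :: ('m \<times> 'k) measure)" by simp
    then have "{x} \<times> UNIV \<in> sets (borel :: ('m \<times> 'k) measure)" unfolding borel_prod .
    then have "emeasure (\<kappa> x) ({x} \<times> UNIV)
        = emeasure unit_uniform ((\<lambda>u. (x, \<Psi> (x, u))) -` ({x} \<times> UNIV) \<inter> space unit_uniform)"
      unfolding \<kappa>_def by (rule emeasure_distr[OF m])
    also have "(\<lambda>u. (x, \<Psi> (x, u))) -` ({x} \<times> UNIV) \<inter> space unit_uniform = space unit_uniform" by auto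
    finally show ?thesis using U.emeasure_space_1 by simp
  qed
  moreover have "emeasure p E = (\<integral>\<^sup>+x. emeasure (\<kappa> x) E \<partial>(density m1 (\<lambda>x. ennreal (marginal_density m1 p x))))"
    if E: "E \<in> sets borel" for E
  proof -
    have s: "sets (\<nu> \<Otimes>\<^sub>M unit_uniform) = sets (borel \<Otimes>\<^sub>M borel)"
      by (rule sets_pair_measure_cong) (simp_all add: \<nu>_def)
    have m': "(\<lambda>x. (fst x, \<Psi> x)) \<in> measurable (\<nu> \<Otimes>\<^sub>M unit_uniform) (borel \<Otimes>\<^sub>M borel)"
      by (subst measurable_cong_sets[OF s refl]) measurable
    have E': "E \<in> sets (borel \<Otimes>\<^sub>M borel)" using E unfolding sets_borel_prod .
    have "emeasure p E = emeasure (\<nu> \<Otimes>\<^sub>M unit_uniform) ((\<lambda>x. (fst x, \<Psi> x)) -` E \<inter> space (\<nu> \<Otimes>\<^sub>M unit_uniform))"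
      by (subst eq) (rule emeasure_distr[OF m' E'])
    also have "\<dots> = (\<integral>\<^sup>+x. emeasure unit_uniform (Pair x -` ((\<lambda>x. (fst x, \<Psi> x)) -` E \<inter> space (\<nu> \<Otimes>\<^sub>M unit_uniform))) \<partial>\<nu>)"
      by (rule U.emeasure_pair_measure_alt[OF measurable_sets[OF m' E']])
    also have "\<dots> = (\<integral>\<^sup>+x. emeasure (\<kappa> x) E \<partial>\<nu>)"
      unfolding \<kappa>_def using E
      by (intro nn_integral_cong) (auto simp: emeasure_distr[OF m] space_pair_measure \<nu>_def
          intro!: arg_cong[where f = "emeasure unit_uniform"])
    also have "\<nu> = density m1 (\<lambda>x. ennreal (marginal_density m1 p x))"
      unfolding \<nu>_def
      by (intro density_marginal_density[symmetric] m1 ac p(1) borel_measurable_sets_eq[OF p(2)]) simp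
    finally show ?thesis .
  qed
  ultimately show ?thesis unfolding rokhlin_disintegration_def by blast
qed

text \<open>A Borel family \<open>s\<close> of signed measures on the fibres representing \<open>\<mu>\<close> as an integral against
  \<open>m1\<close>. The restrictions of \<open>\<mu>\<close> are the essentially unique such family, and every operation on
  measures below is computed on some such family.\<close>

definition fibre_rep :: "'m::topological_space measure \<Rightarrow> ('m \<times> 'k::topological_space) signed_measure \<Rightarrow>
    ('m \<Rightarrow> 'k signed_measure) \<Rightarrow> bool" where
  "fibre_rep m1 \<mu> s \<longleftrightarrow>
     (\<forall>B. (\<lambda>x. smeasure (s x) B) \<in> borel_measurable borel) \<and>
     (\<exists>w. integrable m1 w \<and> (\<forall>x B. \<bar>smeasure (s x) B\<bar> \<le> w x)) \<and>
     (\<forall>A\<in>sets borel. \<forall>B\<in>sets borel.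
        smeasure \<mu> (A \<times> B) = (LINT x|m1. indicator A x * smeasure (s x) B))"

text \<open>Outside the Borel sets \<open>smeasure\<close> vanishes, and \<open>B = {}\<close> in
  the domination gives \<open>0 \<le> w x\<close>; so measurability and domination extend from Borel
  sets to all sets.\<close>

lemma fibre_repI:
  assumes "\<And>B. B \<in> sets borel \<Longrightarrow> (\<lambda>x. smeasure (s x) B) \<in> borel_measurable borel"
    and "integrable m1 w" "\<And>x B. B \<in> sets borel \<Longrightarrow> \<bar>smeasure (s x) B\<bar> \<le> w x"
    and "\<And>A B. A \<in> sets borel \<Longrightarrow> B \<in> sets borel \<Longrightarrow>
      smeasure \<mu> (A \<times> B) = (LINT x|m1. indicator A x * smeasure (s x) B)"
  shows "fibre_rep m1 \<mu> s"
proof -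
  have "(\<lambda>x. smeasure (s x) B) \<in> borel_measurable borel" for B
    using assms(1)[of B] by (cases "B \<in> sets borel") (simp_all add: smeasure_nonborel)
  moreover have "\<bar>smeasure (s x) B\<bar> \<le> w x" for x B
    using assms(3)[of B x] assms(3)[of "{}" x] by (cases "B \<in> sets borel") (simp_all add: smeasure_nonborel)
  ultimately show ?thesis using assms unfolding fibre_rep_def by blast
qed

lemma fibre_rep_measurable:
  "fibre_rep m1 \<mu> s \<Longrightarrow> (\<lambda>x. smeasure (s x) B) \<in> borel_measurable borel"
  by (simp add: fibre_rep_def)

lemma fibre_rep_rect:
  "fibre_rep m1 \<mu> s \<Longrightarrow> A \<in> sets borel \<Longrightarrow> B \<in> sets borel \<Longrightarrow>
    smeasure \<mu> (A \<times> B) = (LINT x|m1. indicator A x * smeasure (s x) B)"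
  by (simp add: fibre_rep_def)

lemma fibre_rep_integrable:
  assumes m1: "borel_prob m1" and s: "fibre_rep m1 \<mu> s"
  shows "integrable m1 (\<lambda>x. smeasure (s x) B)"
    and "A \<in> sets borel \<Longrightarrow> integrable m1 (\<lambda>x. indicator A x * smeasure (s x) B)"
proof -
  note m = borel_probD[OF m1]
  obtain w where w: "integrable m1 w" "\<And>x B. \<bar>smeasure (s x) B\<bar> \<le> w x"
    using s by (auto simp: fibre_rep_def)
  show i: "integrable m1 (\<lambda>x. smeasure (s x) B)"
  proof (rule Bochner_Integration.integrable_bound[OF w(1)])
    show "(\<lambda>x. smeasure (s x) B) \<in> borel_measurable m1"
      by (rule borel_measurable_sets_eq[OF m(2) fibre_rep_measurable[OF s]])
    show "AE x in m1. norm (smeasure (s x) B) \<le> norm (w x)"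
      using w(2)[of _ B] by (auto intro: order_trans[OF _ abs_ge_self])
  qed
  show "integrable m1 (\<lambda>x. indicator A x * smeasure (s x) B)" if "A \<in> sets borel"
    using integrable_mult_indicator[OF _ i, of A] that m(2) by simp
qed

lemma borel_cut:
  fixes E :: "('m::second_countable_topology \<times> 'k::second_countable_topology) set"
  shows "E \<in> sets borel \<Longrightarrow> Pair x -` E \<in> sets borel"
  using sets_Pair1[of E borel borel x] unfolding borel_prod by auto

text \<open>A Dynkin-class argument from rectangles to Borel sets. Countable unions are handled by
  dominated convergence with the function \<open>w\<close> of the representation.\<close>

lemma fibre_rep_cut:
  fixes \<mu> :: "('m::second_countable_topology \<times> 'k::second_countable_topology) signed_measure"
  assumes m1: "borel_prob m1" and s: "fibre_rep m1 \<mu> s" and E: "E \<in> sets borel"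
  shows "(\<lambda>x. smeasure (s x) (Pair x -` E)) \<in> borel_measurable borel"
    and "integrable m1 (\<lambda>x. smeasure (s x) (Pair x -` E))"
    and "smeasure \<mu> E = (LINT x|m1. smeasure (s x) (Pair x -` E))"
proof -
  note m = borel_probD[OF m1]
  interpret prob_space m1 by (rule m)
  obtain w where w: "integrable m1 w" "\<And>x B. \<bar>smeasure (s x) B\<bar> \<le> w x"
    using s by (auto simp: fibre_rep_def)
  let ?G = "{A \<times> B |A B. A \<in> sets (borel :: 'm measure) \<and> B \<in> sets (borel :: 'k measure)}"
  define P where "P E \<longleftrightarrow> (\<lambda>x. smeasure (s x) (Pair x -` E)) \<in> borel_measurable borel \<and>
    smeasure \<mu> E = (LINT x|m1. smeasure (s x) (Pair x -` E))" for E
  have int: "integrable m1 (\<lambda>x. smeasure (s x) (Pair x -` E))"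
    if "(\<lambda>x. smeasure (s x) (Pair x -` E)) \<in> borel_measurable borel" for E
    using that w m(2) by (intro Bochner_Integration.integrable_bound[OF w(1)])
      (auto intro: order_trans[OF _ abs_ge_self] cong: measurable_cong_sets)
  have sG: "sets (borel :: ('m \<times> 'k) measure) = sigma_sets UNIV ?G"
    unfolding sets_borel_prod sets_pair_measure by simp
  have inG: "X \<in> sets borel" if "X \<in> sigma_sets UNIV ?G" for X :: "('m \<times> 'k) set"
    using that sG by simp
  have rect: "P (A \<times> B)" if "A \<in> sets borel" "B \<in> sets borel" for A B
  proof -
    have eq: "smeasure (s x) (Pair x -` (A \<times> B)) = indicator A x * smeasure (s x) B" for x
      by (simp add: indicator_def)
    show ?thesis unfolding P_def eq
      using that fibre_rep_measurable[OF s, of B] fibre_rep_rect[OF s that] by simp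
  qed
  have "P E"
  proof (rule sigma_sets_induct_disjoint[where G = ?G and \<Omega> = UNIV and A = E])
    show "Int_stable ?G" by (rule Int_stable_pair_measure_generator)
    show "E \<in> sigma_sets UNIV ?G" using E sG by simp
    show "P A" if "A \<in> ?G" for A using that rect by blast
    show "P {}" by (simp add: P_def)
    show "P (UNIV - A)" if A: "A \<in> sigma_sets UNIV ?G" "P A" for A
    proof -
      have "smeasure (s x) (Pair x -` (UNIV - A)) = smeasure (s x) (Pair x -` (UNIV \<times> UNIV)) - smeasure (s x) (Pair x -` A)" for x
        using smeasure_Diff[of "Pair x -` A" UNIV "s x"] borel_cut[OF inG[OF A(1)]]
        by (simp add: vimage_Diff)
      moreover have "smeasure \<mu> (UNIV - A) = smeasure \<mu> (UNIV \<times> UNIV) - smeasure \<mu> A"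
        using smeasure_Diff[of A UNIV \<mu>] inG[OF A(1)] by simp
      moreover have "P (UNIV \<times> UNIV)" by (rule rect) simp_all
      ultimately show ?thesis using A(2) int[of A] int[of "UNIV \<times> UNIV"]
        unfolding P_def by (simp only: borel_measurable_diff Bochner_Integration.integral_diff)
    qed
    show "P (\<Union>i. A i)" if A: "disjoint_family A" "range A \<subseteq> sigma_sets UNIV ?G" "\<And>i. P (A i)"
      for A :: "nat \<Rightarrow> _"
    proof -
      have Ai: "A i \<in> sets borel" for i using A(2) inG by blast
      have cut: "(\<lambda>i. smeasure (s x) (Pair x -` A i)) sums smeasure (s x) (Pair x -` (\<Union>i. A i))" for x
      proof -
        have "(\<lambda>i. smeasure (s x) (Pair x -` A i)) sums smeasure (s x) (\<Union>i. Pair x -` A i)"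
          using A(1) borel_cut[OF Ai] by (intro smeasure_sums) (auto simp: disjoint_family_on_def)
        then show ?thesis by (simp add: vimage_UN)
      qed
      \<comment> \<open>The partial sums are masses of finite unions, which is why the single
        function \<open>w\<close> dominates all of them.\<close>
      have fin: "(\<Sum>i<n. smeasure (s x) (Pair x -` A i)) = smeasure (s x) (Pair x -` (\<Union>i<n. A i))" for n x
      proof (induction n)
        case (Suc n)
        have "smeasure (s x) (Pair x -` ((\<Union>i<n. A i) \<union> A n))
            = smeasure (s x) (Pair x -` (\<Union>i<n. A i)) + smeasure (s x) (Pair x -` A n)"
          unfolding vimage_Un
        proof (rule smeasure_Un)
          have "A i \<inter> A n = {}" if "i < n" for i
            using A(1) that unfolding disjoint_family_on_def by (metis UNIV_I less_irrefl)
          then show "Pair x -` (\<Union>i<n. A i) \<inter> Pair x -` A n = {}" by blast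
        qed (use Ai in \<open>auto intro!: borel_cut sets.finite_UN\<close>)
        moreover have "(\<Union>i<n. A i) \<union> A n = (\<Union>i<Suc n. A i)" by (auto simp: less_Suc_eq)
        ultimately show ?case using Suc by simp
      qed simp
      have meas: "(\<lambda>x. smeasure (s x) (Pair x -` A i)) \<in> borel_measurable borel" for i
        using A(3) by (simp add: P_def)
      have measU: "(\<lambda>x. smeasure (s x) (Pair x -` (\<Union>i. A i))) \<in> borel_measurable borel"
      proof -
        have "(\<lambda>x. \<Sum>i. smeasure (s x) (Pair x -` A i)) \<in> borel_measurable borel"
          using meas by measurable
        then show ?thesis using cut by (simp add: sums_iff)
      qed
      have "(\<lambda>n. LINT x|m1. (\<Sum>i<n. smeasure (s x) (Pair x -` A i))) \<longlonglongrightarrow>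
          (LINT x|m1. smeasure (s x) (Pair x -` (\<Union>i. A i)))"
      proof (rule integral_dominated_convergence[where w = w])
        show "AE x in m1. (\<lambda>n. \<Sum>i<n. smeasure (s x) (Pair x -` A i)) \<longlonglongrightarrow> smeasure (s x) (Pair x -` (\<Union>i. A i))"
          using cut by (simp add: sums_def)
        show "AE x in m1. norm (\<Sum>i<n. smeasure (s x) (Pair x -` A i)) \<le> w x" for n
          unfolding fin using w(2) by simp
      qed (use meas measU m(2) w(1) in \<open>auto cong: measurable_cong_sets\<close>)
      moreover have "(LINT x|m1. (\<Sum>i<n. smeasure (s x) (Pair x -` A i))) = (\<Sum>i<n. smeasure \<mu> (A i))" for n
      proof -
        have "smeasure \<mu> (A i) = (LINT x|m1. smeasure (s x) (Pair x -` A i))" for i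
          using A(3) by (simp add: P_def)
        then show ?thesis by (simp only: Bochner_Integration.integral_sum[OF int[OF meas]])
      qed
      moreover have "(\<lambda>i. smeasure \<mu> (A i)) sums smeasure \<mu> (\<Union>i. A i)"
        using A(1) Ai by (intro smeasure_sums) auto
      ultimately have "smeasure \<mu> (\<Union>i. A i) = (LINT x|m1. smeasure (s x) (Pair x -` (\<Union>i. A i)))"
        by (simp add: sums_def LIMSEQ_unique)
      then show ?thesis using measU by (simp add: P_def)
    qed
  qed auto
  then have PE: "(\<lambda>x. smeasure (s x) (Pair x -` E)) \<in> borel_measurable borel \<and>
    smeasure \<mu> E = (LINT x|m1. smeasure (s x) (Pair x -` E))" unfolding P_def .
  show "(\<lambda>x. smeasure (s x) (Pair x -` E)) \<in> borel_measurable borel" by (rule conjunct1[OF PE])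
  then show "integrable m1 (\<lambda>x. smeasure (s x) (Pair x -` E))" by (rule int)
  show "smeasure \<mu> E = (LINT x|m1. smeasure (s x) (Pair x -` E))" by (rule conjunct2[OF PE])
qed


text \<open>Finite intersections of a countable basis are again countably many, and the empty
  intersection contributes \<open>UNIV\<close>. Countability allows equality of measures to be
  checked outside one null set.\<close>

lemma countable_generator_borel:
  obtains G :: "'k::second_countable_topology set set"
  where "countable G" "Int_stable G" "UNIV \<in> G" "sets borel = sigma_sets UNIV G"
proof -
  obtain B :: "'k set set" where B: "countable B" "topological_basis B"
    using ex_countable_basis by blast
  define G where "G = (\<lambda>F. \<Inter>F) ` {F. finite F \<and> F \<subseteq> B}"
  have op: "open X" if "X \<in> G" for X
    using that topological_basis_open[OF B(2)] unfolding G_def by (auto intro!: open_Inter)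
  show ?thesis
  proof (rule that[of G])
    show "countable G" unfolding G_def using B(1) by (intro countable_image countable_Collect_finite_subset)
    show "Int_stable G"
    proof (rule Int_stableI)
      fix X Y assume "X \<in> G" "Y \<in> G"
      then obtain F F' where "finite F" "F \<subseteq> B" "finite F'" "F' \<subseteq> B" "X = \<Inter>F" "Y = \<Inter>F'"
        by (auto simp: G_def)
      then have "X \<inter> Y = \<Inter>(F \<union> F')" "finite (F \<union> F')" "F \<union> F' \<subseteq> B" by auto
      then show "X \<inter> Y \<in> G" unfolding G_def by blast
    qed
    show "UNIV \<in> G" unfolding G_def by (rule image_eqI[of _ _ "{}"]) auto
    have BG: "b \<in> G" if "b \<in> B" for b
      unfolding G_def using that by (intro image_eqI[of _ _ "{b}"]) auto
    have "sigma_sets UNIV B = sigma_sets UNIV G"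
    proof (rule sigma_sets_eqI)
      fix X assume X: "X \<in> G"
      have "sets (borel :: 'k measure) = sigma_sets UNIV B"
        by (subst borel_eq_countable_basis[OF B]) simp
      then show "X \<in> sigma_sets UNIV B" using op[OF X] by (metis borel_open)
    qed (use BG in auto)
    then show "sets borel = sigma_sets UNIV G" by (subst borel_eq_countable_basis[OF B]) simp
  qed
qed

text \<open>For one set \<open>B\<close> both masses are densities of the same set function of
  \<open>A\<close>, so they agree almost everywhere. A countable intersection-stable generator
  collects the exceptional sets into one, and agreement extends to all Borel sets.\<close>

lemma fibre_rep_unique:
  fixes \<mu> :: "('m::second_countable_topology \<times> 'k::second_countable_topology) signed_measure"
  assumes m1: "borel_prob m1" and s: "fibre_rep m1 \<mu> s" and t: "fibre_rep m1 \<mu> t"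
  shows "AE x in m1. s x = t x"
proof -
  note m = borel_probD[OF m1]
  obtain G :: "'k set set" where G: "countable G" "Int_stable G" "UNIV \<in> G" "sets borel = sigma_sets UNIV G"
    by (rule countable_generator_borel)
  have "AE x in m1. smeasure (s x) B = smeasure (t x) B" if "B \<in> G" for B
  proof (rule density_unique_real)
    have B: "B \<in> sets borel" using that G(4) by auto
    have UB: "UNIV \<times> B \<in> sets (borel :: ('m \<times> 'k) measure)"
      using B unfolding sets_borel_prod by simp
    show "integrable m1 (\<lambda>x. smeasure (s x) B)" "integrable m1 (\<lambda>x. smeasure (t x) B)"
      using fibre_rep_cut(2)[OF m1 s UB] fibre_rep_cut(2)[OF m1 t UB] by simp_all
    fix A assume "A \<in> sets m1"
    then show "(\<integral>x\<in>A. smeasure (s x) B \<partial>m1) = (\<integral>x\<in>A. smeasure (t x) B \<partial>m1)"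
      using fibre_rep_rect[OF s, of A B] fibre_rep_rect[OF t, of A B] B m(2)
      by (simp add: set_lebesgue_integral_def)
  qed
  then have "AE x in m1. \<forall>B\<in>G. smeasure (s x) B = smeasure (t x) B"
    using G(1) by (simp add: AE_ball_countable)
  then show ?thesis
  proof eventually_elim
    case (elim x)
    have inG: "X \<in> sets borel" if "X \<in> sigma_sets UNIV G" for X using that G(4) by simp
    show ?case
    proof (rule smeasure_eqI)
      fix E :: "'k set" assume "E \<in> sets borel"
      then have E: "E \<in> sigma_sets UNIV G" using G(4) by simp
        have "G \<subseteq> Pow UNIV" by simp
      from G(2) this E show "smeasure (s x) E = smeasure (t x) E"
      proof (induction rule: sigma_sets_induct_disjoint)
        case (compl A)
        then show ?case
          using elim G(3) smeasure_Diff[of A UNIV "s x"] smeasure_Diff[of A UNIV "t x"] inG[OF compl(1)] by simp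
      next
        case (union A)
        then have r: "range A \<subseteq> sets borel" using inG by blast
        show ?case using smeasure_sums[OF r union(1), of "s x"] smeasure_sums[OF r union(1), of "t x"] union(3)
          by (simp add: sums_iff)
      qed (use elim in auto)
    qed
  qed
qed

lemma fibre_rep_add:
  assumes m1: "borel_prob m1" and s: "fibre_rep m1 \<mu> s" and t: "fibre_rep m1 \<nu> t"
  shows "fibre_rep m1 (\<mu> + \<nu>) (\<lambda>x. s x + t x)"
proof -
  obtain w w' where w: "integrable m1 w" "\<And>x B. \<bar>smeasure (s x) B\<bar> \<le> w x"
    "integrable m1 w'" "\<And>x B. \<bar>smeasure (t x) B\<bar> \<le> w' x"
    using s t unfolding fibre_rep_def by blast
  show ?thesis
  proof (rule fibre_repI)
    show "integrable m1 (\<lambda>x. w x + w' x)" using w by simp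
    show "\<bar>smeasure (s x + t x) B\<bar> \<le> w x + w' x" for x B
      using w(2)[of x B] w(4)[of x B] by simp
    show "(\<lambda>x. smeasure (s x + t x) B) \<in> borel_measurable borel" for B
      using fibre_rep_measurable[OF s, of B] fibre_rep_measurable[OF t, of B] by simp
    show "smeasure (\<mu> + \<nu>) (A \<times> B) = (LINT x|m1. indicator A x * smeasure (s x + t x) B)"
      if "A \<in> sets borel" "B \<in> sets borel" for A B
      using fibre_rep_rect[OF s that] fibre_rep_rect[OF t that]
        fibre_rep_integrable(2)[OF m1 s that(1), of B] fibre_rep_integrable(2)[OF m1 t that(1), of B]
      by (simp add: distrib_left)
  qed
qed

lemma fibre_rep_scaleR:
  assumes s: "fibre_rep m1 \<mu> s"
  shows "fibre_rep m1 (c *\<^sub>R \<mu>) (\<lambda>x. c *\<^sub>R s x)"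
proof -
  obtain w where w: "integrable m1 w" "\<And>x B. \<bar>smeasure (s x) B\<bar> \<le> w x"
    using s unfolding fibre_rep_def by blast
  show ?thesis
  proof (rule fibre_repI)
    show "integrable m1 (\<lambda>x. \<bar>c\<bar> * w x)" using w by simp
    show "\<bar>smeasure (c *\<^sub>R s x) B\<bar> \<le> \<bar>c\<bar> * w x" for x B
      using w(2)[of x B] by (simp add: abs_mult mult_left_mono)
    show "(\<lambda>x. smeasure (c *\<^sub>R s x) B) \<in> borel_measurable borel" for B
      using fibre_rep_measurable[OF s, of B] by simp
    show "smeasure (c *\<^sub>R \<mu>) (A \<times> B) = (LINT x|m1. indicator A x * smeasure (c *\<^sub>R s x) B)"
      if "A \<in> sets borel" "B \<in> sets borel" for A B
      using fibre_rep_rect[OF s that] by (simp add: mult.left_commute[of _ c])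
  qed
qed

section \<open>Restrictions of measures as representing families\<close>

lemma pos_restriction:
  fixes p :: "('m::{metric_space, second_countable_topology} \<times> 'k::{metric_space, second_countable_topology}) measure"
  assumes K: "compact (UNIV :: 'k set)" and m1: "borel_prob m1"
    and p: "finite_measure p" "sets p = sets borel" and ac: "absolutely_continuous m1 (distr p borel fst)"
  shows "finite_measure (pos_restriction m1 p x)" "sets (pos_restriction m1 p x) = sets borel"
    and "measure (pos_restriction m1 p x) UNIV = marginal_density m1 p x"
    and "B \<in> sets borel \<Longrightarrow> (\<lambda>x. measure (pos_restriction m1 p x) B) \<in> borel_measurable borel"
    and "integrable m1 (marginal_density m1 p)"
    and "A \<in> sets borel \<Longrightarrow> B \<in> sets borel \<Longrightarrow>
      measure p (A \<times> B) = (LINT x|m1. indicator A x * measure (pos_restriction m1 p x) B)"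
proof -
  note m = borel_probD[OF m1]
  interpret m1: prob_space m1 by (rule m)
  interpret p: finite_measure p by (rule p)
  \<comment> \<open>Since a disintegration exists, the choice operator picks one; nothing below
    depends on which.\<close>
  define \<kappa> where "\<kappa> = (SOME \<kappa>. rokhlin_disintegration m1 p \<kappa>)"
  have "rokhlin_disintegration m1 p \<kappa>"
    unfolding \<kappa>_def by (rule someI_ex[OF rokhlin_disintegration_exists[OF K m1 p ac]])
  then have \<kappa>: "\<kappa> \<in> measurable borel (prob_algebra borel)" "\<And>x. emeasure (\<kappa> x) ({x} \<times> UNIV) = 1"
    and dis: "\<And>E. E \<in> sets borel \<Longrightarrow> emeasure p E
      = (\<integral>\<^sup>+x. emeasure (\<kappa> x) E \<partial>(density m1 (\<lambda>x. ennreal (marginal_density m1 p x))))"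
    by (auto simp: rokhlin_disintegration_def)
  let ?d = "marginal_density m1 p"
  have d0: "0 \<le> ?d x" for x by (simp add: marginal_density_def)
  have \<kappa>x: "sets (\<kappa> x) = sets borel" "prob_space (\<kappa> x)" for x
    using measurable_space[OF \<kappa>(1), of x] by (auto simp: space_prob_algebra)
  have \<kappa>sp: "space (\<kappa> x) = UNIV" for x using sets_eq_imp_space_eq[OF \<kappa>x(1)] by simp
  have sndm: "snd \<in> borel_measurable (\<kappa> x)" for x
    by (rule borel_measurable_sets_eq[OF \<kappa>x(1)]) simp
  have UB: "UNIV \<times> B \<in> sets (borel :: ('m \<times> 'k) measure)" if "B \<in> sets borel" for B
    using that unfolding sets_borel_prod by simp
  have e: "emeasure (pos_restriction m1 p x) B = ennreal (?d x) * emeasure (\<kappa> x) (UNIV \<times> B)"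
    if B: "B \<in> sets borel" for x B
  proof -
    have "snd \<in> borel_measurable (scale_measure (ennreal (?d x)) (\<kappa> x))"
      using sndm by (simp cong: measurable_cong_sets)
    then have "emeasure (pos_restriction m1 p x) B
        = emeasure (scale_measure (ennreal (?d x)) (\<kappa> x)) (snd -` B \<inter> space (\<kappa> x))"
      unfolding pos_restriction_def \<kappa>_def[symmetric] using B
      by (subst emeasure_distr) (simp_all add: space_scale_measure)
    also have "snd -` B \<inter> space (\<kappa> x) = UNIV \<times> B" using \<kappa>sp by auto
    finally show ?thesis by simp
  qed
  show s: "sets (pos_restriction m1 p x) = sets borel" for x by (simp add: pos_restriction_def)
  have sp: "space (pos_restriction m1 p x) = UNIV" for x by (simp add: pos_restriction_def)
  have e1: "emeasure (\<kappa> x) UNIV = 1" for x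
    using prob_space.emeasure_space_1[OF \<kappa>x(2)] \<kappa>sp by simp
  show fin: "finite_measure (pos_restriction m1 p x)" for x
    by (rule finite_measureI) (simp add: sp e e1)
  show mU: "measure (pos_restriction m1 p x) UNIV = ?d x" for x
    by (simp add: measure_def e e1 d0)
  have km: "(\<lambda>x. measure (\<kappa> x) (UNIV \<times> B)) \<in> borel_measurable borel" if "B \<in> sets borel" for B
  proof -
    have "(\<lambda>x. measure (\<kappa> x) (UNIV \<times> B)) = (\<lambda>N. measure N (UNIV \<times> B)) \<circ> \<kappa>" by auto
    moreover have "\<kappa> \<in> measurable borel (subprob_algebra borel)" using \<kappa>(1) by (rule measurable_prob_algebraD)
    ultimately show ?thesis using measurable_measure_subprob_algebra[OF UB[OF that]] by simp
  qed
  have me: "measure (pos_restriction m1 p x) B = ?d x * measure (\<kappa> x) (UNIV \<times> B)"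
    if "B \<in> sets borel" for x B
    using e[OF that] d0 by (simp add: measure_def enn2real_mult)
  have dm: "?d \<in> borel_measurable borel" by (rule marginal_density_measurable[OF m1])
  show meas: "(\<lambda>x. measure (pos_restriction m1 p x) B) \<in> borel_measurable borel" if "B \<in> sets borel" for B
    using km[OF that] dm by (simp add: me[OF that])
  have rect: "emeasure p (A \<times> B) = (\<integral>\<^sup>+x. ennreal (indicator A x * measure (pos_restriction m1 p x) B) \<partial>m1)"
    if A: "A \<in> sets borel" and B: "B \<in> sets borel" for A B
  proof -
    have AB: "A \<times> B \<in> sets (borel :: ('m \<times> 'k) measure)" unfolding sets_borel_prod using A B by simp
    \<comment> \<open>\<open>\<kappa> x\<close> is concentrated over \<open>x\<close>, so
      \<open>A \<times> B\<close> has the measure of \<open>UNIV \<times> B\<close> or of the empty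
      set, according to whether \<open>x\<close> lies in \<open>A\<close>.\<close>
    have k: "emeasure (\<kappa> x) (A \<times> B) = ennreal (indicator A x * measure (\<kappa> x) (UNIV \<times> B))" for x
    proof -
      interpret kx: prob_space "\<kappa> x" by (rule \<kappa>x)
      have xU: "{x} \<times> UNIV \<in> sets (\<kappa> x)" unfolding \<kappa>x(1) sets_borel_prod by simp
      then have "AE z in \<kappa> x. z \<in> {x} \<times> UNIV"
        using \<kappa>(2)[of x] by (simp add: kx.emeasure_eq_measure kx.prob_eq_1[symmetric])
      then have "AE z in \<kappa> x. z \<in> A \<times> B \<longleftrightarrow> z \<in> (if x \<in> A then UNIV \<times> B else {})"
        by eventually_elim auto
      then have "emeasure (\<kappa> x) (A \<times> B) = emeasure (\<kappa> x) (if x \<in> A then UNIV \<times> B else {})"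
        using AB UB[OF B] \<kappa>x(1) by (intro emeasure_eq_AE) auto
      then show ?thesis by (simp add: indicator_def kx.emeasure_eq_measure)
    qed
    have "emeasure p (A \<times> B) = (\<integral>\<^sup>+x. ennreal (?d x) * ennreal (indicator A x * measure (\<kappa> x) (UNIV \<times> B)) \<partial>m1)"
      unfolding dis[OF AB] k using dm km[OF B] A m(2)
      by (intro nn_integral_density) (auto cong: measurable_cong_sets)
    also have "\<dots> = (\<integral>\<^sup>+x. ennreal (indicator A x * measure (pos_restriction m1 p x) B) \<partial>m1)"
      by (intro nn_integral_cong) (simp add: me[OF B] ennreal_mult''[symmetric] d0 mult.left_commute)
    finally show ?thesis .
  qed
  have I: "(\<lambda>x. indicator A x * measure (pos_restriction m1 p x) B) \<in> borel_measurable m1"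
    if "A \<in> sets borel" "B \<in> sets borel" for A B
  proof -
    have "(\<lambda>x. indicator A x * measure (pos_restriction m1 p x) B) \<in> borel_measurable borel"
      using meas[OF that(2)] that(1) by simp
    then show ?thesis by (rule borel_measurable_sets_eq[OF m(2)])
  qed
  show "measure p (A \<times> B) = (LINT x|m1. indicator A x * measure (pos_restriction m1 p x) B)"
    if "A \<in> sets borel" "B \<in> sets borel" for A B
    using rect[OF that] I[OF that]
    by (subst integral_eq_nn_integral) (auto simp: measure_def)
  have "(\<integral>\<^sup>+x. ennreal (?d x) \<partial>m1) = emeasure p (UNIV \<times> UNIV)"
    using rect[of UNIV UNIV] by (simp add: mU)
  then show "integrable m1 ?d"
    using dm m(2) d0 p.emeasure_finite[of "UNIV \<times> UNIV"]
    by (intro integrableI_nonneg) (auto simp: top.not_eq_extremum[symmetric] cong: measurable_cong_sets)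
qed

lemma AB_spaceD:
  assumes "\<mu> \<in> AB_space m1"
  shows "absolutely_continuous m1 (distr (pos_part \<mu>) borel fst)"
    "absolutely_continuous m1 (distr (neg_part \<mu>) borel fst)"
  using assms by (auto simp: AB_space_def)

text \<open>The sum of the two marginal densities serves as the integrable bound, since no fibre set
  has more mass than the whole fibre.\<close>

lemma fibre_rep_restriction:
  fixes \<mu> :: "('m::{metric_space, second_countable_topology} \<times> 'k::{metric_space, second_countable_topology}) signed_measure"
  assumes K: "compact (UNIV :: 'k set)" and m1: "borel_prob m1" and \<mu>: "\<mu> \<in> AB_space m1"
  shows "fibre_rep m1 \<mu> (restriction m1 \<mu>)"
    and "signed_density m1 \<mu> x = smeasure (restriction m1 \<mu> x) UNIV"
proof -
  note m = borel_probD[OF m1]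
  note P = pos_restriction[OF K m1 pos_neg_parts(1) pos_neg_parts(3) AB_spaceD(1)[OF \<mu>]]
  note N = pos_restriction[OF K m1 pos_neg_parts(2) pos_neg_parts(4) AB_spaceD(2)[OF \<mu>]]
  have r: "smeasure (restriction m1 \<mu> x) B
      = measure (pos_restriction m1 (pos_part \<mu>) x) B - measure (pos_restriction m1 (neg_part \<mu>) x) B" for x B
    unfolding restriction_def using P(1,2) N(1,2) by (simp add: smeasure_signed_of)
  show "signed_density m1 \<mu> x = smeasure (restriction m1 \<mu> x) UNIV"
    unfolding r signed_density_def by (simp add: P(3) N(3))
  let ?w = "\<lambda>x. marginal_density m1 (pos_part \<mu>) x + marginal_density m1 (neg_part \<mu>) x"
  show "fibre_rep m1 \<mu> (restriction m1 \<mu>)"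
  proof (rule fibre_repI)
    show "integrable m1 ?w" using P(5) N(5) by simp
    show "(\<lambda>x. smeasure (restriction m1 \<mu> x) B) \<in> borel_measurable borel" if "B \<in> sets borel" for B
      unfolding r using P(4)[OF that] N(4)[OF that] by simp
    have le: "measure (pos_restriction m1 (pos_part \<mu>) x) B \<le> marginal_density m1 (pos_part \<mu>) x"
      "measure (pos_restriction m1 (neg_part \<mu>) x) B \<le> marginal_density m1 (neg_part \<mu>) x"
      if "B \<in> sets borel" for x B
      unfolding P(3)[of x, symmetric] N(3)[of x, symmetric] using P(1,2)[of x] N(1,2)[of x] that
      by (auto intro!: finite_measure.finite_measure_mono)
    show "\<bar>smeasure (restriction m1 \<mu> x) B\<bar> \<le> ?w x" if "B \<in> sets borel" for x B
      unfolding r using le[OF that, of x] measure_nonneg[of "pos_restriction m1 (pos_part \<mu>) x" B]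
        measure_nonneg[of "pos_restriction m1 (neg_part \<mu>) x" B] by linarith
    show "smeasure \<mu> (A \<times> B) = (LINT x|m1. indicator A x * smeasure (restriction m1 \<mu> x) B)"
      if A: "A \<in> sets borel" and B: "B \<in> sets borel" for A B
    proof -
      have int: "integrable m1 (\<lambda>x. indicator A x * measure (pos_restriction m1 p x) B)"
        if "finite_measure p" "sets p = sets borel" "absolutely_continuous m1 (distr p borel fst)"
        for p :: "('m \<times> 'k) measure"
      proof (rule Bochner_Integration.integrable_bound)
        note Q = pos_restriction[OF K m1 that]
        show "integrable m1 (marginal_density m1 p)" by (rule Q)
        have "(\<lambda>x. indicator A x * measure (pos_restriction m1 p x) B) \<in> borel_measurable borel"
          using Q(4)[OF B] A by simp
        then show "(\<lambda>x. indicator A x * measure (pos_restriction m1 p x) B) \<in> borel_measurable m1"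
          by (rule borel_measurable_sets_eq[OF m(2)])
        have "measure (pos_restriction m1 p x) B \<le> marginal_density m1 p x" for x
        proof -
          have "measure (pos_restriction m1 p x) B \<le> measure (pos_restriction m1 p x) UNIV"
            by (rule finite_measure.finite_measure_mono[OF Q(1) subset_UNIV]) (simp add: Q(2))
          then show ?thesis by (simp only: Q(3))
        qed
        moreover have "0 \<le> marginal_density m1 p x" for x by (simp add: marginal_density_def)
        ultimately have "norm (indicator A x * measure (pos_restriction m1 p x) B) \<le> norm (marginal_density m1 p x)" for x
          by (simp add: indicator_def)
        then show "AE x in m1. norm (indicator A x * measure (pos_restriction m1 p x) B) \<le> norm (marginal_density m1 p x)"
          by simp
      qed
      have AB: "A \<times> B \<in> sets (borel :: ('m \<times> 'k) measure)" unfolding sets_borel_prod using A B by simp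
      have "smeasure \<mu> (A \<times> B) = measure (pos_part \<mu>) (A \<times> B) - measure (neg_part \<mu>) (A \<times> B)"
        using jordan_decomposition_parts[of \<mu>] AB by (simp add: jordan_decomposition_def)
      also have "\<dots> = (LINT x|m1. indicator A x * smeasure (restriction m1 \<mu> x) B)"
        unfolding r P(6)[OF A B] N(6)[OF A B] right_diff_distrib
        by (intro Bochner_Integration.integral_diff[symmetric] int pos_neg_parts AB_spaceD \<mu>)
      finally show ?thesis .
    qed
  qed
qed

text \<open>Over a null set \<open>A\<close>, every Borel subset of \<open>A \<times> UNIV\<close>
  has mass zero, because its cuts are empty for almost every \<open>x\<close>. Mass zero alone could
  come from cancellation; applied to the two pieces cut out by the Hahn set it makes both Jordan
  parts vanish there.\<close>

lemma fibre_rep_AB_space: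
  fixes \<mu> :: "('m::{metric_space, second_countable_topology} \<times> 'k::{metric_space, second_countable_topology}) signed_measure"
  assumes m1: "borel_prob m1" and s: "fibre_rep m1 \<mu> s"
  shows "\<mu> \<in> AB_space m1"
proof -
  note m = borel_probD[OF m1]
  obtain H where H: "H \<in> sets borel" "emeasure (pos_part \<mu>) (- H) = 0" "emeasure (neg_part \<mu>) H = 0"
    and eq: "\<And>E. E \<in> sets borel \<Longrightarrow> smeasure \<mu> E = measure (pos_part \<mu>) E - measure (neg_part \<mu>) E"
    using jordan_decomposition_parts[of \<mu>] unfolding jordan_decomposition_def by blast
  interpret p: finite_measure "pos_part \<mu>" by (rule pos_neg_parts)
  interpret n: finite_measure "neg_part \<mu>" by (rule pos_neg_parts)
  have zero: "measure (pos_part \<mu>) (A \<times> UNIV) = 0" "measure (neg_part \<mu>) (A \<times> UNIV) = 0"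
    if A: "A \<in> sets borel" "emeasure m1 A = 0" for A
  proof -
    have A_UNIV: "A \<times> UNIV \<in> sets (borel :: ('m \<times> 'k) measure)" unfolding sets_borel_prod using A by simp
    have AE: "AE x in m1. x \<notin> A" using A m by (intro AE_not_in null_setsI) simp_all
    have null: "smeasure \<mu> E = 0" if "E \<in> sets borel" "E \<subseteq> A \<times> UNIV" for E
    proof -
      have "AE x in m1. smeasure (s x) (Pair x -` E) = 0"
        using AE
      proof eventually_elim
        case (elim x)
        then have "Pair x -` E = {}" using that(2) by auto
        then show ?case by simp
      qed
      then have "(LINT x|m1. smeasure (s x) (Pair x -` E)) = 0" by (rule integral_eq_zero_AE)
      then show ?thesis using fibre_rep_cut(3)[OF m1 s that(1)] by simp
    qed
    let ?E = "(A \<times> UNIV) \<inter> H" and ?E' = "(A \<times> UNIV) \<inter> - H"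
    have E: "?E \<in> sets borel" "?E' \<in> sets borel" using A_UNIV H(1) by auto
    have split: "A \<times> UNIV = ?E \<union> ?E'" by auto
    have z: "measure (pos_part \<mu>) ?E' = 0" "measure (neg_part \<mu>) ?E = 0"
      using p.finite_measure_mono[of ?E' "- H"] n.finite_measure_mono[of ?E H] H E pos_neg_parts(3,4)[of \<mu>]
      by (simp_all add: p.emeasure_eq_measure n.emeasure_eq_measure measure_le_0_iff)
    have "measure (pos_part \<mu>) ?E = 0" "measure (neg_part \<mu>) ?E' = 0"
      using eq[OF E(1)] eq[OF E(2)] null[OF E(1)] null[OF E(2)] z by auto
    moreover have "measure (pos_part \<mu>) (A \<times> UNIV) = measure (pos_part \<mu>) ?E + measure (pos_part \<mu>) ?E'"
      by (subst split, rule p.finite_measure_Union) (use E pos_neg_parts(3)[of \<mu>] in auto)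
    moreover have "measure (neg_part \<mu>) (A \<times> UNIV) = measure (neg_part \<mu>) ?E + measure (neg_part \<mu>) ?E'"
      by (subst split, rule n.finite_measure_Union) (use E pos_neg_parts(4)[of \<mu>] in auto)
    ultimately show "measure (pos_part \<mu>) (A \<times> UNIV) = 0" "measure (neg_part \<mu>) (A \<times> UNIV) = 0"
      using z by simp_all
  qed
  have ac: "absolutely_continuous m1 (distr q borel fst)"
    if q: "finite_measure q" "sets q = sets borel"
      "\<And>A. A \<in> sets borel \<Longrightarrow> emeasure m1 A = 0 \<Longrightarrow> measure q (A \<times> UNIV) = 0"
    for q :: "('m \<times> 'k) measure"
    unfolding absolutely_continuous_def
  proof
    fix A assume "A \<in> null_sets m1"
    then have A: "A \<in> sets borel" "emeasure m1 A = 0" using m(2) by auto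
    interpret q: finite_measure q by (rule q)
    have spq: "space q = UNIV" using sets_eq_imp_space_eq[OF q(2)] by simp
    have "fst \<in> borel_measurable q" by (rule borel_measurable_sets_eq[OF q(2)]) simp
    then have "emeasure (distr q borel fst) A = emeasure q (fst -` A \<inter> space q)"
      using A by (intro emeasure_distr) simp_all
    also have "fst -` A \<inter> space q = A \<times> UNIV" using spq by auto
    finally show "A \<in> null_sets (distr q borel fst)"
      using A q(3)[OF A] by (intro null_setsI) (simp_all add: q.emeasure_eq_measure)
  qed
  show ?thesis unfolding AB_space_def
    using ac[of "pos_part \<mu>"] ac[of "neg_part \<mu>"] zero pos_neg_parts(1-4)[of \<mu>] by blast
qed

lemma restriction_eq:
  fixes \<mu> :: "('m::{metric_space, second_countable_topology} \<times> 'k::{metric_space, second_countable_topology}) signed_measure"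
  assumes K: "compact (UNIV :: 'k set)" and m1: "borel_prob m1" and s: "fibre_rep m1 \<mu> s"
  shows "AE x in m1. restriction m1 \<mu> x = s x"
    and "AE x in m1. signed_density m1 \<mu> x = smeasure (s x) UNIV"
proof -
  note AB = fibre_rep_AB_space[OF m1 s]
  show "AE x in m1. restriction m1 \<mu> x = s x"
    by (rule fibre_rep_unique[OF m1 fibre_rep_restriction(1)[OF K m1 AB] s])
  then show "AE x in m1. signed_density m1 \<mu> x = smeasure (s x) UNIV"
    unfolding fibre_rep_restriction(2)[OF K m1 AB] by eventually_elim simp
qed

section \<open>Integration against signed measures\<close>

lemma borel_space_UNIV: "sets M = sets borel \<Longrightarrow> space M = UNIV"
  by (metis sets_eq_imp_space_eq space_borel)

lemma bounded_integrable_parts: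
  assumes "g \<in> borel_measurable borel" "\<And>x. \<bar>g x\<bar> \<le> (c::real)"
  shows "integrable (pos_part \<nu>) g" "integrable (neg_part \<nu>) g"
  using bounded_integrable[OF pos_neg_parts(1,3)] bounded_integrable[OF pos_neg_parts(2,4)] assms by blast+

lemma signed_integral_limit:
  assumes t: "\<And>i. t i \<in> borel_measurable borel" "\<And>x. (\<lambda>i. t i x) \<longlonglongrightarrow> g x"
    and b: "\<And>i x. \<bar>t i x\<bar> \<le> (c::real)"
  shows "(\<lambda>i. signed_integral \<nu> (t i)) \<longlonglongrightarrow> signed_integral \<nu> g"
proof -
  have g: "g \<in> borel_measurable borel" using t by (rule borel_measurable_LIMSEQ_real[rotated])
  have "(\<lambda>i. LINT x|m. t i x) \<longlonglongrightarrow> (LINT x|m. g x)"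
    if m: "finite_measure m" "sets m = sets borel" for m
  proof -
    interpret finite_measure m by (rule m)
    show ?thesis
    proof (rule integral_dominated_convergence[where w = "\<lambda>_. c"])
      show "g \<in> borel_measurable m" "\<And>i. t i \<in> borel_measurable m"
        using borel_measurable_sets_eq[OF m(2)] g t(1) by blast+
    qed (use t(2) b in auto)
  qed
  then show ?thesis unfolding signed_integral_def using pos_neg_parts[of \<nu>] by (intro tendsto_diff) auto
qed

text \<open>On simple functions the integral is expressed by \<open>smeasure\<close> alone. As
  Jordan parts are not additive in the measure, linearity in the measure is derived from this
  formula.\<close>

lemma signed_integral_simple:
  assumes t: "simple_function borel t"
  shows "signed_integral \<nu> t = (\<Sum>y\<in>range t. y * smeasure \<nu> (t -` {y}))"
proof -
  have int: "(LINT x|m. t x) = (\<Sum>y\<in>range t. y * measure m (t -` {y}))"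
    if m: "finite_measure m" "sets m = sets borel" for m
  proof -
    interpret finite_measure m by (rule m)
    note sp = borel_space_UNIV[OF m(2)]
    have "simple_function m t" using t m sp by (simp add: simple_function_def)
    moreover have "emeasure m {y \<in> space m. t y \<noteq> 0} \<noteq> \<infinity>" by simp
    ultimately have "Bochner_Integration.simple_bochner_integrable m t"
      by (auto intro: simple_bochner_integrable.intros)
    then show ?thesis
      by (simp add: simple_bochner_integrable_eq_integral[symmetric] simple_bochner_integral_def sp
          vimage_def mult.commute)
  qed
  have "t -` {y} \<in> sets borel" for y
    using simple_functionD(2)[OF t, of "{y}"] by simp
  then have "smeasure \<nu> (t -` {y}) = measure (pos_part \<nu>) (t -` {y}) - measure (neg_part \<nu>) (t -` {y})" for y
    using jordan_decomposition_parts[of \<nu>] by (simp add: jordan_decomposition_def)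
  then show ?thesis unfolding signed_integral_def
    using int[OF pos_neg_parts(1,3)] int[OF pos_neg_parts(2,4)] by (simp add: right_diff_distrib sum_subtractf)
qed

text \<open>The approximation in metric form, relative to the point 0, keeps the approximants within
  twice the norm of the limit; hence the factor 2.\<close>

lemma simple_approximation:
  assumes g: "g \<in> borel_measurable borel" "\<And>x. \<bar>g x\<bar> \<le> (c::real)"
  obtains t where "\<And>i. simple_function borel (t i)" "\<And>x. (\<lambda>i. t i x) \<longlonglongrightarrow> g x" "\<And>i x. \<bar>t i x\<bar> \<le> 2 * c"
proof -
  obtain t where t: "\<And>i. simple_function borel (t i)" "\<And>x. (\<lambda>i. t i x) \<longlonglongrightarrow> g x"
    "\<And>i x. norm (t i x) \<le> 2 * norm (g x)"
    using borel_measurable_implies_sequence_metric[OF g(1), of 0] by (auto simp: dist_norm)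
  have "\<bar>t i x\<bar> \<le> 2 * c" for i x using t(3)[of i x] g(2)[of x] by simp
  then show ?thesis using that t by blast
qed

text \<open>Both sides of an identity between signed integrals pass to bounded limits of simple functions.\<close>

lemma signed_integral_add:
  assumes g: "g \<in> borel_measurable borel" "\<And>x. \<bar>g x\<bar> \<le> c"
  shows "signed_integral (\<mu> + \<nu>) g = signed_integral \<mu> g + signed_integral \<nu> g"
proof -
  obtain t where t: "\<And>i. simple_function borel (t i)" "\<And>x. (\<lambda>i. t i x) \<longlonglongrightarrow> g x" "\<And>i x. \<bar>t i x\<bar> \<le> 2 * c"
    using simple_approximation[OF g] by blast
  note lim = signed_integral_limit[OF borel_measurable_simple_function[OF t(1)] t(2,3)]
  have "(\<lambda>i. signed_integral (\<mu> + \<nu>) (t i)) = (\<lambda>i. signed_integral \<mu> (t i) + signed_integral \<nu> (t i))"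
    by (simp add: signed_integral_simple[OF t(1)] distrib_left sum.distrib)
  then show ?thesis using lim[of "\<mu> + \<nu>"] tendsto_add[OF lim[of \<mu>] lim[of \<nu>]] by (simp add: LIMSEQ_unique)
qed

lemma signed_integral_scaleR:
  assumes g: "g \<in> borel_measurable borel" "\<And>x. \<bar>g x\<bar> \<le> c"
  shows "signed_integral (r *\<^sub>R \<mu>) g = r * signed_integral \<mu> g"
proof -
  obtain t where t: "\<And>i. simple_function borel (t i)" "\<And>x. (\<lambda>i. t i x) \<longlonglongrightarrow> g x" "\<And>i x. \<bar>t i x\<bar> \<le> 2 * c"
    using simple_approximation[OF g] by blast
  note lim = signed_integral_limit[OF borel_measurable_simple_function[OF t(1)] t(2,3)]
  have "(\<lambda>i. signed_integral (r *\<^sub>R \<mu>) (t i)) = (\<lambda>i. r * signed_integral \<mu> (t i))"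
    by (simp add: signed_integral_simple[OF t(1)] sum_distrib_left ac_simps)
  then show ?thesis using lim[of "r *\<^sub>R \<mu>"] tendsto_mult_left[OF lim[of \<mu>], of r] by (simp add: LIMSEQ_unique)
qed

lemma signed_integral_zero: "signed_integral 0 g = 0" if "g \<in> borel_measurable borel" "\<And>x. \<bar>g x\<bar> \<le> c"
  using signed_integral_scaleR[OF that, of 0 0] by simp

lemma signed_integral_pushforward:
  assumes T: "T \<in> borel_measurable borel" and g: "g \<in> borel_measurable borel" "\<And>x. \<bar>g x\<bar> \<le> c"
  shows "signed_integral (pushforward T \<mu>) g = signed_integral \<mu> (\<lambda>x. g (T x))"
proof -
  obtain t where t: "\<And>i. simple_function borel (t i)" "\<And>x. (\<lambda>i. t i x) \<longlonglongrightarrow> g x" "\<And>i x. \<bar>t i x\<bar> \<le> 2 * c"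
    using simple_approximation[OF g] by blast
  have tm: "t i \<in> borel_measurable borel" for i using t(1) by (rule borel_measurable_simple_function)
  have "signed_integral (pushforward T \<mu>) (t i) = signed_integral \<mu> (\<lambda>x. t i (T x))" for i
  proof -
    have fin: "finite (range (t i))" using t(1)[of i] by (simp add: simple_function_def)
    have s: "simple_function borel (\<lambda>x. t i (T x))"
      using simple_function_comp[OF T t(1)[of i]] by (simp add: o_def)
    have "signed_integral (pushforward T \<mu>) (t i) = (\<Sum>y\<in>range (t i). y * smeasure \<mu> (T -` (t i -` {y})))"
      unfolding signed_integral_simple[OF t(1)]
      using simple_functionD(2)[OF t(1), of i "{_}"] by (intro sum.cong) (auto simp: smeasure_pushforward[OF T])
    \<comment> \<open>Values of \<open>t i\<close> that are missed on the image of \<open>T\<close>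
      have empty preimage and drop out.\<close>
    also have "\<dots> = (\<Sum>y\<in>range (\<lambda>x. t i (T x)). y * smeasure \<mu> ((\<lambda>x. t i (T x)) -` {y}))"
    proof (rule sum.mono_neutral_cong_right[OF fin])
      show "\<forall>y\<in>range (t i) - range (\<lambda>x. t i (T x)). y * smeasure \<mu> (T -` (t i -` {y})) = 0"
      proof
        fix y assume "y \<in> range (t i) - range (\<lambda>x. t i (T x))"
        then have "T x \<notin> t i -` {y}" for x by (metis DiffD2 rangeI vimage_singleton_eq)
        then have "T -` (t i -` {y}) = {}" by blast
        then show "y * smeasure \<mu> (T -` (t i -` {y})) = 0" by simp
      qed
    qed (auto simp: vimage_def)
    finally show ?thesis by (simp add: signed_integral_simple[OF s])
  qed
  moreover have "(\<lambda>i. signed_integral \<mu> (\<lambda>x. t i (T x))) \<longlonglongrightarrow> signed_integral \<mu> (\<lambda>x. g (T x))"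
    using tm T t by (intro signed_integral_limit[where c = "2 * c"]) auto
  ultimately show ?thesis
    using signed_integral_limit[OF tm t(2,3), of "pushforward T \<mu>"] by (simp add: LIMSEQ_unique)
qed

lemma signed_integral_measurable:
  assumes s: "\<And>B. (\<lambda>x. smeasure (s x) B) \<in> borel_measurable M"
    and g: "g \<in> borel_measurable borel" "\<And>x. \<bar>g x\<bar> \<le> c"
  shows "(\<lambda>x. signed_integral (s x) g) \<in> borel_measurable M"
proof -
  obtain t where t: "\<And>i. simple_function borel (t i)" "\<And>x. (\<lambda>i. t i x) \<longlonglongrightarrow> g x" "\<And>i x. \<bar>t i x\<bar> \<le> 2 * c"
    using simple_approximation[OF g] by blast
  show ?thesis
  proof (rule borel_measurable_LIMSEQ_real)
    show "(\<lambda>i. signed_integral (s x) (t i)) \<longlonglongrightarrow> signed_integral (s x) g" for x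
      by (rule signed_integral_limit[OF borel_measurable_simple_function[OF t(1)] t(2,3)])
    show "(\<lambda>x. signed_integral (s x) (t i)) \<in> borel_measurable M" for i
      unfolding signed_integral_simple[OF t(1)] using s by (intro borel_measurable_sum borel_measurable_times) auto
  qed
qed

text \<open>A constant integrates to the total mass. This is the origin of the mass term in the
  contraction estimate.\<close>

lemma signed_integral_affine:
  assumes g: "g \<in> borel_measurable borel" "\<And>x. \<bar>g x\<bar> \<le> c"
  shows "signed_integral \<nu> (\<lambda>x. a + b * g x) = a * smeasure \<nu> UNIV + b * signed_integral \<nu> g"
proof -
  interpret p: finite_measure "pos_part \<nu>" by (rule pos_neg_parts)
  interpret n: finite_measure "neg_part \<nu>" by (rule pos_neg_parts)
  have \<nu>: "smeasure \<nu> UNIV = measure (pos_part \<nu>) UNIV - measure (neg_part \<nu>) UNIV"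
    using jordan_decomposition_parts[of \<nu>] by (simp add: jordan_decomposition_def)
  have "(LINT x|pos_part \<nu>. a + b * g x) = a * measure (pos_part \<nu>) UNIV + b * (LINT x|pos_part \<nu>. g x)"
    "(LINT x|neg_part \<nu>. a + b * g x) = a * measure (neg_part \<nu>) UNIV + b * (LINT x|neg_part \<nu>. g x)"
    using bounded_integrable_parts[OF g, of \<nu>]
      borel_space_UNIV[OF pos_neg_parts(3), of \<nu>] borel_space_UNIV[OF pos_neg_parts(4), of \<nu>] by simp_all
  then show ?thesis unfolding \<nu> signed_integral_def by (simp add: algebra_simps)
qed

lemma signed_integral_diff_le:
  assumes g: "g \<in> borel_measurable borel" "\<And>x. \<bar>g x\<bar> \<le> c"
    and h: "h \<in> borel_measurable borel" "\<And>x. \<bar>h x\<bar> \<le> c"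
    and e: "\<And>x. \<bar>g x - h x\<bar> \<le> e"
  shows "\<bar>signed_integral \<nu> g - signed_integral \<nu> h\<bar>
    \<le> e * (measure (pos_part \<nu>) UNIV + measure (neg_part \<nu>) UNIV)"
proof -
  have le: "\<bar>(LINT x|m. g x) - (LINT x|m. h x)\<bar> \<le> e * measure m UNIV"
    if m: "finite_measure m" "sets m = sets borel" for m
  proof -
    interpret finite_measure m by (rule m)
    have i: "integrable m g" "integrable m h"
      using bounded_integrable[OF m] g h by blast+
    have "\<bar>(LINT x|m. g x) - (LINT x|m. h x)\<bar> = \<bar>LINT x|m. g x - h x\<bar>" using i by simp
    also have "\<dots> \<le> (LINT x|m. \<bar>g x - h x\<bar>)" by (rule integral_abs_bound)
    also have "\<dots> \<le> (LINT x|m. e)" using i e by (intro integral_mono) auto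
    finally show ?thesis using borel_space_UNIV[OF m(2)] by (simp add: mult.commute)
  qed
  show ?thesis unfolding signed_integral_def distrib_left
    using le[OF pos_neg_parts(1,3), of \<nu>] le[OF pos_neg_parts(2,4), of \<nu>] by linarith
qed

text \<open>Writing the measure as itself minus the null measure, minimality of the Jordan
  decomposition bounds the positive part by \<open>a\<close> and the negative part by 0.\<close>

lemma signed_integral_signed_of_le:
  assumes a: "finite_measure a" "sets a = sets borel"
    and g: "g \<in> borel_measurable borel" "\<And>x. \<bar>g x\<bar> \<le> c"
  shows "\<bar>signed_integral (signed_of a) g\<bar> \<le> c * measure a UNIV"
proof -
  have null: "finite_measure (null_measure borel :: 'a measure)" by (rule finite_measureI) simp
  have eq: "signed_of a = signed_of a - signed_of (null_measure borel)"
    by (rule smeasure_eqI) (simp add: smeasure_signed_of[OF null] measure_def)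
  note le = jordan_decomposition_minimal[OF jordan_decomposition_parts a(1) null a(2) _ eq, of UNIV]
  have "\<bar>signed_integral (signed_of a) g - signed_integral (signed_of a) (\<lambda>_. 0)\<bar>
      \<le> c * (measure (pos_part (signed_of a)) UNIV + measure (neg_part (signed_of a)) UNIV)"
    using g order_trans[OF abs_ge_zero g(2)] by (intro signed_integral_diff_le[where c = c]) auto
  also have "\<dots> \<le> c * (measure a UNIV + 0)"
    using le order_trans[OF abs_ge_zero g(2)] by (intro mult_left_mono add_mono) (auto simp: measure_def)
  finally show ?thesis by (simp add: signed_integral_def)
qed

section \<open>Hoelder functions and the fibre norm\<close>

text \<open>Pairs with \<open>x = y\<close>, excluded in the supremum, are harmless on the right,
  because both sides vanish there.\<close>

lemma holder_const_le_iff: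
  assumes "0 \<le> c"
  shows "holder_const \<zeta> h \<le> ennreal c \<longleftrightarrow> (\<forall>x y. \<bar>h x - h y\<bar> \<le> c * dist x y powr \<zeta>)"
proof -
  have "holder_const \<zeta> h \<le> ennreal c \<longleftrightarrow> (\<forall>x y. x \<noteq> y \<longrightarrow> ennreal (\<bar>h x - h y\<bar> / dist x y powr \<zeta>) \<le> ennreal c)"
    unfolding holder_const_def by (auto simp: SUP_le_iff)
  also have "\<dots> \<longleftrightarrow> (\<forall>x y. x \<noteq> y \<longrightarrow> \<bar>h x - h y\<bar> / dist x y powr \<zeta> \<le> c)"
    using assms by simp
  also have "\<dots> \<longleftrightarrow> (\<forall>x y. \<bar>h x - h y\<bar> \<le> c * dist x y powr \<zeta>)"
    by (smt (verit, best) assms dist_nz divide_le_eq powr_gt_zero zero_compare_simps(4) cancel_comm_monoid_add_class.diff_cancel dist_self powr_0)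
  finally show ?thesis .
qed

lemma sup_norm_le_iff: "0 \<le> c \<Longrightarrow> sup_norm h \<le> ennreal c \<longleftrightarrow> (\<forall>x. \<bar>h x\<bar> \<le> c)"
  unfolding sup_norm_def by (simp add: SUP_le_iff)

text \<open>For \<open>C = 1\<close> these are the test functions of \<open>wnorm\<close>. The
  Hoelder constant stays 1 while the sup bound varies: once \<open>C\<close> dominates every
  \<open>dist x y powr \<zeta>\<close>, the class is stable under composing with a contraction,
  subtracting a value and rescaling.\<close>

definition holder_test :: "real \<Rightarrow> real \<Rightarrow> ('k::metric_space \<Rightarrow> real) set" where
  "holder_test \<zeta> C = {g. (\<forall>x. \<bar>g x\<bar> \<le> C) \<and> (\<forall>x y. \<bar>g x - g y\<bar> \<le> dist x y powr \<zeta>)}"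

lemma holder_continuous:
  assumes \<zeta>: "0 < \<zeta>" and h: "\<And>x y. \<bar>h x - h y\<bar> \<le> c * dist x y powr \<zeta>"
  shows "continuous_on UNIV (h :: 'a::metric_space \<Rightarrow> real)"
proof -
  have "(h \<longlongrightarrow> h x) (at x)" for x
  proof -
    have "((\<lambda>y. dist y x) \<longlongrightarrow> 0) (at x)"
      using tendsto_dist[OF tendsto_ident_at tendsto_const, of x x] by simp
    then have "((\<lambda>y. c * dist y x powr \<zeta>) \<longlongrightarrow> c * 0 powr \<zeta>) (at x)"
      using \<zeta> by (intro tendsto_mult tendsto_const tendsto_powr') auto
    then have "((\<lambda>y. c * dist y x powr \<zeta>) \<longlongrightarrow> 0) (at x)" using \<zeta> by simp
    then have "((\<lambda>y. h y - h x) \<longlongrightarrow> 0) (at x)"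
      by (rule Lim_null_comparison[rotated]) (use h in auto)
    then show ?thesis by (simp add: LIM_zero_iff)
  qed
  then show ?thesis by (simp add: continuous_on_def)
qed

lemma holder_test_measurable: "0 < \<zeta> \<Longrightarrow> g \<in> holder_test \<zeta> C \<Longrightarrow> g \<in> borel_measurable borel"
  by (intro borel_measurable_continuous_onI holder_continuous[where c = 1]) (auto simp: holder_test_def)

lemma holder_test_bound: "g \<in> holder_test \<zeta> C \<Longrightarrow> \<bar>g x\<bar> \<le> C"
  by (auto simp: holder_test_def)

lemma wnorm_eq: "wnorm \<zeta> (\<nu> :: 'a::metric_space signed_measure) = (SUP g\<in>holder_test \<zeta> 1. ennreal \<bar>signed_integral \<nu> g\<bar>)"
proof -
  have "{g :: 'a \<Rightarrow> real. sup_norm g \<le> 1 \<and> holder_const \<zeta> g \<le> 1} = holder_test \<zeta> 1"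
    using sup_norm_le_iff[of 1] holder_const_le_iff[of 1] by (auto simp: holder_test_def)
  then show ?thesis unfolding wnorm_def by (simp only:)
qed

text \<open>A bound by a real number rather than a supremum in \<open>ennreal\<close>, so that fibre
  estimates can be added and averaged with real weights.\<close>

definition wbound :: "real \<Rightarrow> real \<Rightarrow> real \<Rightarrow> 'k::metric_space signed_measure \<Rightarrow> bool" where
  "wbound \<zeta> C b \<nu> \<longleftrightarrow> (\<forall>g\<in>holder_test \<zeta> C. \<bar>signed_integral \<nu> g\<bar> \<le> b)"

lemma wnorm_le_iff: "0 \<le> b \<Longrightarrow> wnorm \<zeta> \<nu> \<le> ennreal b \<longleftrightarrow> wbound \<zeta> 1 b \<nu>"
  by (simp add: wnorm_eq wbound_def SUP_le_iff)

text \<open>Dividing by \<open>C \<ge> 1\<close> brings a test function of level \<open>C\<close>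
  down to level 1 without enlarging its Hoelder constant.\<close>

lemma wbound_rescale:
  assumes \<zeta>: "0 < \<zeta>" and C: "1 \<le> C" and w: "wbound \<zeta> 1 b \<nu>"
  shows "wbound \<zeta> C (C * b) \<nu>"
  unfolding wbound_def
proof
  fix g :: "'a \<Rightarrow> real" assume g: "g \<in> holder_test \<zeta> C"
  \<comment> \<open>The summand 0 gives the function the affine shape to which
    \<open>signed_integral_affine\<close> applies.\<close>
  have *: "(\<lambda>x. 0 + (1/C) * g x) \<in> holder_test \<zeta> 1"
    unfolding holder_test_def
  proof (safe)
    fix x y
    show "\<bar>0 + (1/C) * g x\<bar> \<le> 1" using holder_test_bound[OF g, of x] C by (simp add: abs_mult)
    have "\<bar>(1/C) * g x - (1/C) * g y\<bar> = (1/C) * \<bar>g x - g y\<bar>"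
      using C by (simp add: abs_mult flip: diff_divide_distrib)
    also have "\<dots> \<le> 1 * dist x y powr \<zeta>" using g C by (intro mult_mono) (auto simp: holder_test_def)
    finally show "\<bar>0 + (1/C) * g x - (0 + (1/C) * g y)\<bar> \<le> dist x y powr \<zeta>" by simp
  qed
  then have "\<bar>signed_integral \<nu> (\<lambda>x. 0 + (1/C) * g x)\<bar> \<le> b" using w unfolding wbound_def by blast
  then have "\<bar>(1/C) * signed_integral \<nu> g\<bar> \<le> b"
    unfolding signed_integral_affine[OF holder_test_measurable[OF \<zeta> g] holder_test_bound[OF g]] by simp
  then show "\<bar>signed_integral \<nu> g\<bar> \<le> C * b" using C by (simp add: abs_mult field_simps)
qed

lemma wbound_antimono: "wbound \<zeta> C b (\<nu> :: 'a::metric_space signed_measure) \<Longrightarrow> C' \<le> C \<Longrightarrow> b \<le> b' \<Longrightarrow> wbound \<zeta> C' b' \<nu>"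
  unfolding wbound_def
proof
  fix g :: "'a \<Rightarrow> real"
  assume *: "\<forall>g\<in>holder_test \<zeta> C. \<bar>signed_integral \<nu> g\<bar> \<le> b" "C' \<le> C" "b \<le> b'" "g \<in> holder_test \<zeta> C'"
  then have "g \<in> holder_test \<zeta> C" unfolding holder_test_def by (auto intro: order_trans)
  then show "\<bar>signed_integral \<nu> g\<bar> \<le> b'" using * by (blast intro: order_trans)
qed

text \<open>Subtracting a constant from a test function on a set of small diameter makes it small, so a
  contraction shrinks the norm up to a term that only sees the total mass.\<close>

lemma wbound_contraction:
  fixes T :: "'k::metric_space \<Rightarrow> 'k"
  assumes \<zeta>: "0 < \<zeta>" and \<alpha>: "0 < \<alpha>" and T: "\<And>x y. dist (T x) (T y) \<le> \<alpha> * dist x y"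
    and C: "\<And>x y :: 'k. dist x y powr \<zeta> \<le> C" and w: "wbound \<zeta> C b \<nu>"
  shows "wbound \<zeta> C (\<alpha> powr \<zeta> * b + C * \<bar>smeasure \<nu> UNIV\<bar>) (pushforward T \<nu>)"
  unfolding wbound_def
proof
  fix g :: "'k \<Rightarrow> real" assume g: "g \<in> holder_test \<zeta> C"
  note gm = holder_test_measurable[OF \<zeta> g] holder_test_bound[OF g]
  have "continuous_on UNIV T"
    using T \<alpha> by (intro lipschitz_on_continuous_on[of \<alpha>]) (auto simp: lipschitz_on_def)
  then have Tm: "T \<in> borel_measurable borel" by (rule borel_measurable_continuous_onI)
  \<comment> \<open>Any base point will do, since \<open>C\<close> controls all pairs of
    points.\<close>
  define z :: 'k where "z = undefined"
  \<comment> \<open>Subtracting the value at the image of \<open>z\<close> leaves oscillation at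
    most \<open>\<alpha> powr \<zeta> * dist x z powr \<zeta>\<close>; dividing by
    \<open>\<alpha> powr \<zeta>\<close> gives Hoelder constant 1 and sup bound
    \<open>C\<close>.\<close>
  define u where "u x = (g (T x) - g (T z)) / \<alpha> powr \<zeta>" for x
  have a: "0 < \<alpha> powr \<zeta>" using \<alpha> by simp
  have H: "\<bar>g (T x) - g (T y)\<bar> \<le> \<alpha> powr \<zeta> * dist x y powr \<zeta>" for x y
  proof -
    have "\<bar>g (T x) - g (T y)\<bar> \<le> dist (T x) (T y) powr \<zeta>" using g by (simp add: holder_test_def)
    also have "\<dots> \<le> (\<alpha> * dist x y) powr \<zeta>" using T \<zeta> by (intro powr_mono2) auto
    also have "\<dots> = \<alpha> powr \<zeta> * dist x y powr \<zeta>" using \<alpha> by (simp add: powr_mult)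
    finally show ?thesis .
  qed
  have u: "u \<in> holder_test \<zeta> C"
    unfolding holder_test_def
  proof safe
    fix x y
    have "\<bar>u x\<bar> \<le> dist x z powr \<zeta>" using H[of x z] a by (simp add: u_def abs_divide divide_le_eq mult.commute)
    then show "\<bar>u x\<bar> \<le> C" using C[of x z] by simp
    have "u x - u y = (g (T x) - g (T y)) / \<alpha> powr \<zeta>" by (simp add: u_def diff_divide_distrib)
    then show "\<bar>u x - u y\<bar> \<le> dist x y powr \<zeta>"
      using H[of x y] a by (simp add: abs_divide divide_le_eq mult.commute)
  qed
  have "signed_integral (pushforward T \<nu>) g = signed_integral \<nu> (\<lambda>x. g (T z) + \<alpha> powr \<zeta> * u x)"
    using a by (simp add: signed_integral_pushforward[OF Tm gm] u_def)
  also have "\<dots> = g (T z) * smeasure \<nu> UNIV + \<alpha> powr \<zeta> * signed_integral \<nu> u"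
    by (rule signed_integral_affine[OF holder_test_measurable[OF \<zeta> u] holder_test_bound[OF u]])
  finally have "\<bar>signed_integral (pushforward T \<nu>) g\<bar>
      \<le> \<bar>g (T z)\<bar> * \<bar>smeasure \<nu> UNIV\<bar> + \<alpha> powr \<zeta> * \<bar>signed_integral \<nu> u\<bar>"
    using abs_triangle_ineq[of "g (T z) * smeasure \<nu> UNIV" "\<alpha> powr \<zeta> * signed_integral \<nu> u"] by (simp add: abs_mult)
  also have "\<dots> \<le> C * \<bar>smeasure \<nu> UNIV\<bar> + \<alpha> powr \<zeta> * b"
    using w u gm(2)[of "T z"] by (intro add_mono mult_left_mono mult_right_mono) (auto simp: wbound_def)
  finally show "\<bar>signed_integral (pushforward T \<nu>) g\<bar> \<le> \<alpha> powr \<zeta> * b + C * \<bar>smeasure \<nu> UNIV\<bar>" by simp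
qed

lemma wbound_add:
  assumes "0 < \<zeta>" "wbound \<zeta> C b \<nu>" "wbound \<zeta> C b' \<nu>'"
  shows "wbound \<zeta> C (b + b') (\<nu> + \<nu>')"
  unfolding wbound_def
proof
  fix g :: "'a \<Rightarrow> real" assume g: "g \<in> holder_test \<zeta> C"
  have "\<bar>signed_integral \<nu> g\<bar> \<le> b" "\<bar>signed_integral \<nu>' g\<bar> \<le> b'" using assms(2,3) g by (auto simp: wbound_def)
  then show "\<bar>signed_integral (\<nu> + \<nu>') g\<bar> \<le> b + b'"
    using signed_integral_add[OF holder_test_measurable[OF assms(1) g] holder_test_bound[OF g]] by simp
qed

lemma wbound_scaleR:
  assumes "0 < \<zeta>" "wbound \<zeta> C b \<nu>"
  shows "wbound \<zeta> C (\<bar>r\<bar> * b) (r *\<^sub>R \<nu>)"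
  unfolding wbound_def
proof
  fix g :: "'a \<Rightarrow> real" assume g: "g \<in> holder_test \<zeta> C"
  have "\<bar>signed_integral \<nu> g\<bar> \<le> b" using assms(2) g by (auto simp: wbound_def)
  then show "\<bar>signed_integral (r *\<^sub>R \<nu>) g\<bar> \<le> \<bar>r\<bar> * b"
    using signed_integral_scaleR[OF holder_test_measurable[OF assms(1) g] holder_test_bound[OF g]]
    by (simp add: abs_mult mult_left_mono)
qed

lemma wbound_zero: "0 < \<zeta> \<Longrightarrow> wbound \<zeta> C 0 0"
  unfolding wbound_def using signed_integral_zero[OF holder_test_measurable holder_test_bound] by force

lemma wbound_sum:
  assumes "0 < \<zeta>" "\<And>i. i \<in> I \<Longrightarrow> wbound \<zeta> C (b i) (\<nu> i)"
  shows "wbound \<zeta> C (\<Sum>i\<in>I. b i) (\<Sum>i\<in>I. \<nu> i)"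
  using assms(2)
proof (induction I rule: infinite_finite_induct)
  case (insert i I)
  then have "wbound \<zeta> C (b i + sum b I) (\<nu> i + sum \<nu> I)" by (intro wbound_add[OF assms(1)]) auto
  then show ?case using insert(1,2) by simp
qed (simp_all add: wbound_zero[OF assms(1)])

lemma wbound_signed_of:
  assumes "0 < \<zeta>" "prob_space a" "sets a = sets borel"
  shows "wbound \<zeta> C C (signed_of a)"
  unfolding wbound_def
proof
  interpret prob_space a by fact
  fix g :: "'a \<Rightarrow> real" assume g: "g \<in> holder_test \<zeta> C"
  show "\<bar>signed_integral (signed_of a) g\<bar> \<le> C"
    using signed_integral_signed_of_le[OF _ assms(3) holder_test_measurable[OF assms(1) g] holder_test_bound[OF g]]
      finite_measure_axioms prob_space borel_space_UNIV[OF assms(3)] by simp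
qed

text \<open>Up to a small error a test function is determined by its values on a finite net, rounded
  to a grid, and there are countably many lists of rounded values. One test function is chosen for
  each list that occurs.\<close>

lemma countable_dense_holder_test:
  assumes K: "compact (UNIV :: 'k::metric_space set)" and \<zeta>: "0 < \<zeta>"
  obtains S :: "('k::metric_space \<Rightarrow> real) set" where "countable S" "S \<subseteq> holder_test \<zeta> 1"
    "\<And>g \<epsilon>. g \<in> holder_test \<zeta> 1 \<Longrightarrow> 0 < \<epsilon> \<Longrightarrow> \<exists>h\<in>S. \<forall>x. \<bar>g x - h x\<bar> \<le> \<epsilon>"
proof -
  let ?T = "holder_test \<zeta> 1 :: ('k \<Rightarrow> real) set"
  have "\<exists>xs :: 'k list. \<forall>x. \<exists>d\<in>set xs. dist x d < 1 / real (Suc n)" for n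
  proof -
    have r: "0 < 1 / real (Suc n)" by simp
    from K[unfolded compact_eq_totally_bounded, THEN conjunct2, rule_format, OF r]
    obtain D :: "'k set" where D: "finite D \<and> UNIV \<subseteq> (\<Union>d\<in>D. ball d (1 / real (Suc n)))" ..
    obtain xs where xs: "set xs = D" using finite_list[OF conjunct1[OF D]] ..
    have "\<exists>d\<in>set xs. dist x d < 1 / real (Suc n)" for x
    proof -
      have "x \<in> (\<Union>d\<in>D. ball d (1 / real (Suc n)))" using conjunct2[OF D] by (rule subsetD) simp
      then show ?thesis unfolding xs by (simp add: dist_commute)
    qed
    then show ?thesis by blast
  qed
  then obtain xs :: "nat \<Rightarrow> 'k list" where xs: "\<And>n x. \<exists>d\<in>set (xs n). dist x d < 1 / real (Suc n)"
    by metis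
  \<comment> \<open>Nets are kept as lists so that a code is a list of integers, an element of a
    countable type.\<close>
  define code where "code n g = map (\<lambda>d. \<lfloor>real (Suc n) * g d\<rfloor>) (xs n)" for n and g :: "'k \<Rightarrow> real"
  define rep where "rep n c = (SOME g. g \<in> ?T \<and> code n g = c)" for n c
  define S where "S = (\<Union>n. rep n ` code n ` ?T)"
  have rep: "rep n (code n g) \<in> ?T" "code n (rep n (code n g)) = code n g" if "g \<in> ?T" for n g
    using someI[of "\<lambda>g'. g' \<in> ?T \<and> code n g' = code n g" g] that unfolding rep_def by auto
  show ?thesis
  proof (rule that[of S])
    show "countable S" unfolding S_def by (intro countable_UN countable_image countableI_type)
    show "S \<subseteq> ?T" unfolding S_def using rep(1) by blast
    fix g :: "'k \<Rightarrow> real" and \<epsilon> :: real assume g: "g \<in> ?T" and \<epsilon>: "0 < \<epsilon>"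
    \<comment> \<open>Three errors of \<open>\<epsilon>/3\<close>: the rounding at a net point and
      the oscillation of each of the two functions between \<open>x\<close> and that point. The
      second entry of the minimum is the distance at which \<open>r powr \<zeta>\<close> reaches
      \<open>\<epsilon>/3\<close>.\<close>
    have "0 < min (\<epsilon>/3) ((\<epsilon>/3) powr (1/\<zeta>))" using \<epsilon> by simp
    then obtain n where n: "1 / real (Suc n) < min (\<epsilon>/3) ((\<epsilon>/3) powr (1/\<zeta>))"
      using nat_approx_posE by blast
    have small: "r powr \<zeta> \<le> \<epsilon>/3" if "0 \<le> r" "r < 1 / real (Suc n)" for r
    proof -
      have "r powr \<zeta> \<le> ((\<epsilon>/3) powr (1/\<zeta>)) powr \<zeta>" using that n \<zeta> by (intro powr_mono2) auto
      also have "\<dots> = \<epsilon>/3" using \<zeta> \<epsilon> by (simp add: powr_powr)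
      finally show ?thesis .
    qed
    let ?h = "rep n (code n g)"
    have "\<bar>g x - ?h x\<bar> \<le> \<epsilon>" for x
    proof -
      obtain d where d: "d \<in> set (xs n)" "dist x d < 1 / real (Suc n)" using xs by blast
      have "\<lfloor>real (Suc n) * g d\<rfloor> = \<lfloor>real (Suc n) * ?h d\<rfloor>"
        using rep(2)[OF g, of n] d(1) by (auto simp: code_def)
      then have "\<bar>real (Suc n) * g d - real (Suc n) * ?h d\<bar> < 1" by linarith
      then have "real (Suc n) * \<bar>g d - ?h d\<bar> < 1" by (simp add: abs_mult flip: right_diff_distrib)
      then have "\<bar>g d - ?h d\<bar> < 1 / real (Suc n)" by (simp add: field_simps)
      moreover have "\<bar>g x - g d\<bar> \<le> \<epsilon>/3" "\<bar>?h x - ?h d\<bar> \<le> \<epsilon>/3"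
        using g rep(1)[OF g, of n] small[of "dist x d"] d(2) unfolding holder_test_def
        by (smt (verit) mem_Collect_eq zero_le_dist)+
      ultimately show ?thesis using n by linarith
    qed
    then show "\<exists>h\<in>S. \<forall>x. \<bar>g x - h x\<bar> \<le> \<epsilon>" unfolding S_def using g by blast
  qed
qed

text \<open>The supremum may be restricted to a countable, uniformly dense family of test functions.
  Measurability is what turns an almost everywhere bound into a bound on
  \<open>esssup\<close>.\<close>

lemma wnorm_measurable:
  fixes s :: "'m \<Rightarrow> 'k::metric_space signed_measure"
  assumes K: "compact (UNIV :: 'k set)" and \<zeta>: "0 < \<zeta>"
    and s: "\<And>B. (\<lambda>x. smeasure (s x) B) \<in> borel_measurable M"
  shows "(\<lambda>x. wnorm \<zeta> (s x)) \<in> borel_measurable M"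
proof -
  obtain S :: "('k \<Rightarrow> real) set" where S: "countable S" "S \<subseteq> holder_test \<zeta> 1"
    "\<And>g \<epsilon>. g \<in> holder_test \<zeta> 1 \<Longrightarrow> 0 < \<epsilon> \<Longrightarrow> \<exists>h\<in>S. \<forall>x. \<bar>g x - h x\<bar> \<le> \<epsilon>"
    using countable_dense_holder_test[OF K \<zeta>] by metis
  have "wnorm \<zeta> \<nu> = (SUP g\<in>S. ennreal \<bar>signed_integral \<nu> g\<bar>)" for \<nu>
    unfolding wnorm_eq
  proof (rule antisym)
    let ?R = "SUP g\<in>S. ennreal \<bar>signed_integral \<nu> g\<bar>"
    show "?R \<le> (SUP g\<in>holder_test \<zeta> 1. ennreal \<bar>signed_integral \<nu> g\<bar>)"
      using S(2) by (intro SUP_subset_mono) auto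
    show "(SUP g\<in>holder_test \<zeta> 1. ennreal \<bar>signed_integral \<nu> g\<bar>) \<le> ?R"
    proof (rule SUP_least, rule ennreal_le_epsilon)
      fix g :: "'k \<Rightarrow> real" and e :: real assume g: "g \<in> holder_test \<zeta> 1" and e: "0 < e"
      \<comment> \<open>The summand 1 makes the total variation bound positive, so that
        \<open>e\<close> can be divided by it.\<close>
      define V where "V = measure (pos_part \<nu>) UNIV + measure (neg_part \<nu>) UNIV + 1"
      have V: "V > 0" by (simp add: V_def add_nonneg_pos)
      obtain h where h: "h \<in> S" "\<And>x. \<bar>g x - h x\<bar> \<le> e / V" using S(3)[OF g, of "e / V"] e V by auto
      have hT: "h \<in> holder_test \<zeta> 1" using h(1) S(2) by blast
      have "\<bar>signed_integral \<nu> g - signed_integral \<nu> h\<bar>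
          \<le> e / V * (measure (pos_part \<nu>) UNIV + measure (neg_part \<nu>) UNIV)"
        by (rule signed_integral_diff_le[OF holder_test_measurable[OF \<zeta> g] holder_test_bound[OF g]
              holder_test_measurable[OF \<zeta> hT] holder_test_bound[OF hT] h(2)])
      also have "\<dots> \<le> e / V * V" using e V by (intro mult_left_mono) (auto simp: V_def)
      also have "\<dots> = e" using V by simp
      finally have "\<bar>signed_integral \<nu> g\<bar> \<le> \<bar>signed_integral \<nu> h\<bar> + e" by linarith
      then have "ennreal \<bar>signed_integral \<nu> g\<bar> \<le> ennreal \<bar>signed_integral \<nu> h\<bar> + ennreal e"
        using e by (simp flip: ennreal_plus)
      also have "\<dots> \<le> ?R + ennreal e" using h(1) by (intro add_right_mono SUP_upper)
      finally show "ennreal \<bar>signed_integral \<nu> g\<bar> \<le> ?R + ennreal e" .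
    qed
  qed
  moreover have "(\<lambda>x. SUP g\<in>S. ennreal \<bar>signed_integral (s x) g\<bar>) \<in> borel_measurable M"
  proof (rule borel_measurable_SUP[OF S(1)])
    fix g assume "g \<in> S"
    then have g: "g \<in> holder_test \<zeta> 1" using S(2) by blast
    have "(\<lambda>x. signed_integral (s x) g) \<in> borel_measurable M"
      by (rule signed_integral_measurable[OF s holder_test_measurable[OF \<zeta> g] holder_test_bound[OF g]])
    then show "(\<lambda>x. ennreal \<bar>signed_integral (s x) g\<bar>) \<in> borel_measurable M" by measurable
  qed
  ultimately show ?thesis by simp
qed

lemma Linf_norm_le_iff:
  fixes \<mu> :: "('m::{metric_space, second_countable_topology} \<times> 'k::{metric_space, second_countable_topology}) signed_measure"
  assumes K: "compact (UNIV :: 'k set)" and \<zeta>: "0 < \<zeta>" and m1: "borel_prob m1"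
    and s: "fibre_rep m1 \<mu> s" and b: "0 \<le> b"
  shows "Linf_norm \<zeta> m1 \<mu> \<le> ennreal b \<longleftrightarrow> (AE x in m1. wbound \<zeta> 1 b (s x))"
proof -
  note m = borel_probD[OF m1]
  note R = fibre_rep_restriction(1)[OF K m1 fibre_rep_AB_space[OF m1 s]]
  have meas: "(\<lambda>x. wnorm \<zeta> (restriction m1 \<mu> x)) \<in> borel_measurable m1"
    by (rule wnorm_measurable[OF K \<zeta> borel_measurable_sets_eq[OF m(2) fibre_rep_measurable[OF R]]])
  have "Linf_norm \<zeta> m1 \<mu> \<le> ennreal b \<longleftrightarrow> (AE x in m1. wnorm \<zeta> (restriction m1 \<mu> x) \<le> ennreal b)"
  proof
    assume "Linf_norm \<zeta> m1 \<mu> \<le> ennreal b"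
    then show "AE x in m1. wnorm \<zeta> (restriction m1 \<mu> x) \<le> ennreal b"
      using esssup_AE[of "\<lambda>x. wnorm \<zeta> (restriction m1 \<mu> x)" m1] unfolding Linf_norm_def
      by (auto elim!: eventually_mono intro: order_trans)
  qed (use meas in \<open>auto simp: Linf_norm_def\<close>)
  also have "\<dots> \<longleftrightarrow> (AE x in m1. wbound \<zeta> 1 b (restriction m1 \<mu> x))"
    by (simp add: wnorm_le_iff[OF b])
  also have "\<dots> \<longleftrightarrow> (AE x in m1. wbound \<zeta> 1 b (s x))"
    using restriction_eq(1)[OF K m1 s] by (intro eventually_cong) auto
  finally show ?thesis .
qed

section \<open>The Perron-Frobenius operator\<close>

text \<open>The sets on which the Jacobian formula can be used as a change of variables: images of
  Borel subsets have to be Borel to be measured. The property is inherited by Borel subsets, so an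
  open cover can be cut into disjoint pieces.\<close>

definition borel_embedding_on :: "('a::topological_space \<Rightarrow> 'b::topological_space) \<Rightarrow> 'a set \<Rightarrow> bool" where
  "borel_embedding_on f B \<longleftrightarrow> B \<in> sets borel \<and> inj_on f B \<and>
     (\<forall>C\<in>sets borel. C \<subseteq> B \<longrightarrow> f ` C \<in> sets borel)"

lemma borel_embedding_on_subset:
  "borel_embedding_on f B \<Longrightarrow> C \<in> sets borel \<Longrightarrow> C \<subseteq> B \<Longrightarrow> borel_embedding_on f C"
  unfolding borel_embedding_on_def by (auto intro: inj_on_subset)

text \<open>The image of \<open>C\<close> is its preimage under the continuous local
  inverse.\<close>

lemma borel_embedding_on_open:
  assumes S: "open S" "open (f ` S)" "inj_on f S" "continuous_on (f ` S) (inv_into S f)"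
  shows "borel_embedding_on f S"
  unfolding borel_embedding_on_def
proof (intro conjI ballI impI)
  fix C assume C: "C \<in> sets borel" "C \<subseteq> S"
  have "inv_into S f \<in> borel_measurable (restrict_space borel (f ` S))"
    by (rule borel_measurable_continuous_on_restrict[OF S(4)])
  then have "inv_into S f -` C \<inter> f ` S \<in> sets (restrict_space borel (f ` S))"
    using measurable_sets[OF _ C(1), of "inv_into S f" "restrict_space borel (f ` S)"]
    by (simp add: space_restrict_space)
  then have "inv_into S f -` C \<inter> f ` S \<in> sets borel"
    using S(2) by (subst (asm) sets_restrict_space_iff) auto
  also have "inv_into S f -` C \<inter> f ` S = f ` C"
    using C(2) S(3) by (auto simp: subset_iff image_iff)
  finally show "f ` C \<in> sets borel" .
qed (use S in auto)

text \<open>For indicators this is the definition of the Jacobian; it extends along sums, multiples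
  and monotone limits. Off the image of \<open>B\<close> the inverse branch has arbitrary values,
  hence the extension by zero.\<close>

lemma nn_integral_borel_embedding:
  fixes v :: "'a::topological_space \<Rightarrow> ennreal" and f :: "'a \<Rightarrow> 'a"
  assumes s: "sets M = sets borel" and J: "has_jacobian f M J" and B: "borel_embedding_on f B"
    and v: "v \<in> borel_measurable borel"
  shows "(\<lambda>x. if x \<in> f ` B then v (inv_into B f x) else 0) \<in> borel_measurable borel"
    and "(\<integral>\<^sup>+x. (if x \<in> f ` B then v (inv_into B f x) else 0) \<partial>M) = (\<integral>\<^sup>+y\<in>B. v y * ennreal (J y) \<partial>M)"
proof -
  have Bm: "B \<in> sets borel" "inj_on f B" and im: "\<And>C. C \<in> sets borel \<Longrightarrow> C \<subseteq> B \<Longrightarrow> f ` C \<in> sets borel"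
    using B by (auto simp: borel_embedding_on_def)
  have Jm: "J \<in> borel_measurable M" and cov: "\<And>C. C \<in> sets borel \<Longrightarrow> C \<subseteq> B \<Longrightarrow>
      emeasure M (f ` C) = (\<integral>\<^sup>+x\<in>C. ennreal (J x) \<partial>M)"
    using J inj_on_subset[OF Bm(2)] borel_measurable_sets_eq[OF s] by (auto simp: has_jacobian_def)
  define lift where "lift v x = (if x \<in> f ` B then v (inv_into B f x) else 0)" for v :: "'a \<Rightarrow> ennreal" and x
  have lift_f: "lift v (f y) = v y" if "y \<in> B" for v y using that Bm(2) by (simp add: lift_def)
  have lift_0: "lift v x = 0" if "x \<notin> f ` B" for v x using that by (simp add: lift_def)
  have lift_ind: "lift (indicator C) = indicator (f ` (C \<inter> B))" for C
  proof
    fix x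
    show "lift (indicator C) x = indicator (f ` (C \<inter> B)) x"
    proof (cases "x \<in> f ` B")
      case True
      then obtain y where y: "y \<in> B" "x = f y" by blast
      then have "x \<in> f ` (C \<inter> B) \<longleftrightarrow> y \<in> C" using inj_on_image_mem_iff[OF Bm(2) y(1), of "C \<inter> B"] by simp
      then show ?thesis using lift_f[OF y(1)] y by (simp add: indicator_def)
    next
      case False
      then have "x \<notin> f ` (C \<inter> B)" by blast
      then show ?thesis using lift_0[OF False] by simp
    qed
  qed
  have m: "lift v \<in> borel_measurable borel" if v: "v \<in> borel_measurable borel" for v
  proof (rule measurableI)
    fix A :: "ennreal set" assume A: "A \<in> sets borel"
    have pre: "v -` A \<inter> B \<in> sets borel"
      using measurable_sets[OF v A] Bm(1) by auto
    have "lift v -` A = f ` (v -` A \<inter> B) \<union> (if 0 \<in> A then - f ` B else {})"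
    proof (rule set_eqI)
      fix x
      show "x \<in> lift v -` A \<longleftrightarrow> x \<in> f ` (v -` A \<inter> B) \<union> (if 0 \<in> A then - f ` B else {})"
      proof (cases "x \<in> f ` B")
        case True
        then obtain y where y: "y \<in> B" "x = f y" by blast
        then have "x \<in> f ` (v -` A \<inter> B) \<longleftrightarrow> v y \<in> A"
          using inj_on_image_mem_iff[OF Bm(2) y(1), of "v -` A \<inter> B"] by simp
        then show ?thesis using lift_f[OF y(1)] y by simp
      next
        case False
        then have "x \<notin> f ` (v -` A \<inter> B)" by blast
        then show ?thesis using lift_0[OF False] False by simp
      qed
    qed
    also have "\<dots> \<in> sets borel" using im[OF pre] im[OF Bm(1)] by auto
    finally show "lift v -` A \<inter> space borel \<in> sets borel" by simp
  qed simp
  have mM: "lift v \<in> borel_measurable M" if "v \<in> borel_measurable borel" for v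
    by (rule borel_measurable_sets_eq[OF s m[OF that]])
  have vM: "v \<in> borel_measurable M" if "v \<in> borel_measurable borel" for v :: "'a \<Rightarrow> ennreal"
    by (rule borel_measurable_sets_eq[OF s that])
  have BM: "B \<in> sets M" using Bm s by simp
  show "(\<lambda>x. if x \<in> f ` B then v (inv_into B f x) else 0) \<in> borel_measurable borel"
    using m[OF v] by (simp add: lift_def[abs_def])
  have "integral\<^sup>N M (lift v) = (\<integral>\<^sup>+y\<in>B. v y * ennreal (J y) \<partial>M)"
    using v
  proof (induction v rule: borel_measurable_induct)
    case (cong u v)
    then have "u = v" by (simp add: fun_eq_iff)
    then show ?case using cong by simp
  next
    case (set C)
    then have CB: "C \<inter> B \<in> sets borel" using Bm by auto
    have "integral\<^sup>N M (lift (indicator C)) = emeasure M (f ` (C \<inter> B))"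
      unfolding lift_ind using im[OF CB] s by (simp add: nn_integral_indicator)
    also have "\<dots> = (\<integral>\<^sup>+x\<in>C \<inter> B. ennreal (J x) \<partial>M)" using cov[OF CB] by simp
    also have "\<dots> = (\<integral>\<^sup>+y\<in>B. indicator C y * ennreal (J y) \<partial>M)"
      by (intro nn_integral_cong) (simp add: indicator_def)
    finally show ?case .
  next
    case (mult u c)
    have "lift (\<lambda>x. c * u x) = (\<lambda>x. c * lift u x)" by (auto simp: lift_def)
    then have "integral\<^sup>N M (lift (\<lambda>x. c * u x)) = c * integral\<^sup>N M (lift u)"
      using mM[OF mult(2)] by (simp add: nn_integral_cmult)
    also have "\<dots> = c * (\<integral>\<^sup>+y\<in>B. u y * ennreal (J y) \<partial>M)" using mult by simp
    also have "\<dots> = (\<integral>\<^sup>+y. c * (u y * ennreal (J y) * indicator B y) \<partial>M)"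
    proof -
      note [measurable] = vM[OF mult(2)] Jm BM
      show ?thesis by (intro nn_integral_cmult[symmetric]) measurable
    qed
    finally show ?case by (simp add: ac_simps)
  next
    case (add u v)
    have "lift (\<lambda>x. v x + u x) = (\<lambda>x. lift v x + lift u x)" by (auto simp: lift_def)
    then have "integral\<^sup>N M (lift (\<lambda>x. v x + u x)) = integral\<^sup>N M (lift v) + integral\<^sup>N M (lift u)"
      using mM[OF add(1)] mM[OF add(3)] by (simp add: nn_integral_add)
    also have "\<dots> = (\<integral>\<^sup>+y. v y * ennreal (J y) * indicator B y + u y * ennreal (J y) * indicator B y \<partial>M)"
      using vM[OF add(1)] vM[OF add(3)] Jm BM add by (subst nn_integral_add) auto
    finally show ?case by (simp add: distrib_right)
  next
    case (seq U)
    have U: "U i \<in> borel_measurable M" for i using seq(1) by (rule vM)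
    have "lift (SUP i. U i) = (\<lambda>x. SUP i. lift (U i) x)" by (auto simp: lift_def image_comp fun_eq_iff)
    then have "integral\<^sup>N M (lift (SUP i. U i)) = (\<integral>\<^sup>+x. (SUP i. lift (U i) x) \<partial>M)" by simp
    also have "\<dots> = (SUP i. integral\<^sup>N M (lift (U i)))"
      using seq(1,3) by (intro nn_integral_monotone_convergence_SUP mM)
        (auto simp: incseq_def le_fun_def lift_def)
    also have "\<dots> = (SUP i. \<integral>\<^sup>+y\<in>B. U i y * ennreal (J y) \<partial>M)" using seq by simp
    also have "\<dots> = (\<integral>\<^sup>+y. (SUP i. U i y * ennreal (J y) * indicator B y) \<partial>M)"
      using seq(3) U Jm BM by (intro nn_integral_monotone_convergence_SUP[symmetric])
        (auto simp: incseq_def le_fun_def intro!: mult_right_mono)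
    also have "\<dots> = (\<integral>\<^sup>+y\<in>B. (SUP i. U i) y * ennreal (J y) \<partial>M)"
      by (intro nn_integral_cong) (simp add: SUP_mult_right_ennreal image_comp)
    finally show ?case .
  qed
  then show "(\<integral>\<^sup>+x. (if x \<in> f ` B then v (inv_into B f x) else 0) \<partial>M) = (\<integral>\<^sup>+y\<in>B. v y * ennreal (J y) \<partial>M)"
    by (simp add: lift_def[abs_def])
qed

text \<open>What the base map contributes once the manifold structure is forgotten. The partition
  into embedded Borel pieces gives finitely many inverse branches, through which sums over preimages
  become finite sums of measurable functions.\<close>

locale jacobian_map =
  fixes f :: "'m::{metric_space, second_countable_topology} \<Rightarrow> 'm"
    and m1 :: "'m measure" and J \<rho> :: "'m \<Rightarrow> real" and \<B> :: "'m set set"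
  assumes m1: "borel_prob m1" and invariant: "distr m1 borel f = m1"
    and f_measurable [measurable]: "f \<in> borel_measurable borel"
    and jacobian: "has_jacobian f m1 J" and rho: "\<rho> = (\<lambda>x. 1 / J x)"
    and pieces: "finite \<B>" "disjoint \<B>" "\<Union>\<B> = UNIV" "\<And>B. B \<in> \<B> \<Longrightarrow> borel_embedding_on f B"
begin

sublocale prob_space m1 by (rule borel_probD[OF m1])

lemma sets_m1 [simp, measurable_cong]: "sets m1 = sets borel" by (rule borel_probD[OF m1])

lemma space_m1 [simp]: "space m1 = UNIV" by (rule borel_probD[OF m1])

lemma J_pos: "0 < J x" and J_measurable [measurable]: "J \<in> borel_measurable borel"
  using jacobian by (auto simp: has_jacobian_def)

lemma rho_pos: "0 < \<rho> x" and rho_measurable [measurable]: "\<rho> \<in> borel_measurable borel"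
  using J_pos by (auto simp: rho)

lemma fibre_piece:
  assumes "B \<in> \<B>"
  shows "f -` {x} \<inter> B = (if x \<in> f ` B then {inv_into B f x} else {})"
proof (cases "x \<in> f ` B")
  case True
  have inj: "inj_on f B" using pieces(4)[OF assms] by (simp add: borel_embedding_on_def)
  obtain y where y: "y \<in> B" "x = f y" using True by blast
  have "f -` {x} \<inter> B = {y}" using inj y by (auto dest: inj_onD)
  then show ?thesis using True y inv_into_f_f[OF inj y(1)] by simp
next
  case False
  then show ?thesis by auto
qed

lemma finite_fibre: "finite (f -` {x})"
proof -
  have "f -` {x} = (\<Union>B\<in>\<B>. f -` {x} \<inter> B)" using pieces(3) by auto
  also have "finite \<dots>" using pieces(1) by (auto simp: fibre_piece)
  finally show ?thesis .
qed

text \<open>On the left the index set depends on \<open>x\<close>; on the right it is fixed, so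
  measurability and integration can be treated branch by branch.\<close>

lemma fibre_sum:
  fixes v :: "'m \<Rightarrow> 'b::comm_monoid_add"
  shows "(\<Sum>y\<in>f -` {x}. v y) = (\<Sum>B\<in>\<B>. if x \<in> f ` B then v (inv_into B f x) else 0)"
proof -
  have "f -` {x} = (\<Union>B\<in>\<B>. f -` {x} \<inter> B)" using pieces(3) by auto
  then have "(\<Sum>y\<in>f -` {x}. v y) = (\<Sum>y\<in>(\<Union>B\<in>\<B>. f -` {x} \<inter> B). v y)" by simp
  also have "\<dots> = (\<Sum>B\<in>\<B>. \<Sum>y\<in>f -` {x} \<inter> B. v y)"
  proof (rule sum.UNION_disjoint[OF pieces(1)])
    show "\<forall>B\<in>\<B>. finite (f -` {x} \<inter> B)" using finite_fibre by auto
    show "\<forall>B\<in>\<B>. \<forall>C\<in>\<B>. B \<noteq> C \<longrightarrow> (f -` {x} \<inter> B) \<inter> (f -` {x} \<inter> C) = {}"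
      using pieces(2) by (auto simp: disjoint_def)
  qed
  also have "\<dots> = (\<Sum>B\<in>\<B>. if x \<in> f ` B then v (inv_into B f x) else 0)"
    by (intro sum.cong) (simp_all add: fibre_piece)
  finally show ?thesis .
qed

lemma fibre_sum_measurable_ennreal:
  fixes v :: "'m \<Rightarrow> ennreal"
  assumes "v \<in> borel_measurable borel"
  shows "(\<lambda>x. \<Sum>y\<in>f -` {x}. v y) \<in> borel_measurable borel"
  unfolding fibre_sum
  using nn_integral_borel_embedding(1)[OF sets_m1 jacobian pieces(4) assms] by (intro borel_measurable_sum)

text \<open>On each piece the change of variables produces \<open>\<rho> y * J y = 1\<close>, and
  the pieces partition the space. This is the duality between the weighted sum over preimages and
  integration.\<close>

lemma nn_integral_fibre_sum:
  fixes u :: "'m \<Rightarrow> ennreal"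
  assumes [measurable]: "u \<in> borel_measurable borel"
  shows "(\<integral>\<^sup>+x. (\<Sum>y\<in>f -` {x}. ennreal (\<rho> y) * u y) \<partial>m1) = (\<integral>\<^sup>+x. u x \<partial>m1)"
proof -
  have v: "(\<lambda>y. ennreal (\<rho> y) * u y) \<in> borel_measurable borel" by measurable
  note I = nn_integral_borel_embedding[OF sets_m1 jacobian pieces(4) v]
  have rJ: "ennreal (\<rho> y) * u y * ennreal (J y) = u y" for y
  proof -
    have "ennreal (\<rho> y) * ennreal (J y) = 1"
      using J_pos[of y] by (simp add: rho ennreal_mult[symmetric])
    then show ?thesis by (metis mult.assoc mult.commute mult.left_neutral)
  qed
  have piece_meas: "B \<in> sets m1" if "B \<in> \<B>" for B using pieces(4)[OF that] by (simp add: borel_embedding_on_def)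
  have "(\<integral>\<^sup>+x. (\<Sum>y\<in>f -` {x}. ennreal (\<rho> y) * u y) \<partial>m1)
      = (\<Sum>B\<in>\<B>. \<integral>\<^sup>+x. (if x \<in> f ` B then ennreal (\<rho> (inv_into B f x)) * u (inv_into B f x) else 0) \<partial>m1)"
    unfolding fibre_sum using I(1) by (intro nn_integral_sum borel_measurable_sets_eq[OF sets_m1])
  also have "\<dots> = (\<Sum>B\<in>\<B>. \<integral>\<^sup>+y\<in>B. u y \<partial>m1)"
    using I(2) by (simp add: rJ)
  also have "\<dots> = (\<integral>\<^sup>+y. (\<Sum>B\<in>\<B>. u y * indicator B y) \<partial>m1)"
    using piece_meas by (intro nn_integral_sum[symmetric]) auto
  also have "\<dots> = (\<integral>\<^sup>+y. u y \<partial>m1)"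
  proof (intro nn_integral_cong)
    fix y
    obtain C where C: "C \<in> \<B>" "y \<in> C" using pieces(3) by auto
    then have "indicator B y = (if B = C then 1 else 0 :: ennreal)" if "B \<in> \<B>" for B
      using that pieces(2) by (auto simp: disjoint_def indicator_def)
    then have "(\<Sum>B\<in>\<B>. u y * indicator B y) = (\<Sum>B\<in>\<B>. if B = C then u y else 0)"
      by (intro sum.cong) auto
    also have "\<dots> = u y" using C(1) pieces(1) by simp
    finally show "(\<Sum>B\<in>\<B>. u y * indicator B y) = u y" .
  qed
  finally show ?thesis .
qed

text \<open>The weighted fibre sum of the indicator of a null set integrates to zero, so it vanishes
  almost everywhere, and positivity of \<open>\<rho>\<close> keeps every preimage out of the null
  set. This carries almost everywhere properties through the transfer operator.\<close>

lemma AE_fibre: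
  assumes "AE y in m1. Q y"
  shows "AE x in m1. \<forall>y\<in>f -` {x}. Q y"
proof -
  obtain N where N: "N \<in> null_sets m1" "{y. \<not> Q y} \<subseteq> N" using assms by (auto simp: eventually_ae_filter)
  then have [measurable]: "N \<in> sets borel" by auto
  have "(\<integral>\<^sup>+x. (\<Sum>y\<in>f -` {x}. ennreal (\<rho> y) * indicator N y) \<partial>m1) = (\<integral>\<^sup>+x. indicator N x \<partial>m1)"
    by (rule nn_integral_fibre_sum) measurable
  also have "\<dots> = 0" using N(1) by (simp add: null_sets_def)
  finally have "AE x in m1. (\<Sum>y\<in>f -` {x}. ennreal (\<rho> y) * indicator N y) = 0"
    by (subst (asm) nn_integral_0_iff_AE)
      (rule borel_measurable_sets_eq[OF sets_m1 fibre_sum_measurable_ennreal], measurable)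
  then show ?thesis
  proof eventually_elim
    case (elim x)
    have "indicator N y = (0 :: ennreal)" if "y \<in> f -` {x}" for y
    proof -
      have "ennreal (\<rho> y) * indicator N y = 0"
        using iffD1[OF sum_nonneg_eq_0_iff[OF finite_fibre] elim] that by auto
      then show ?thesis using rho_pos[of y] by (simp add: ennreal_eq_0_iff not_le)
    qed
    then show ?case using N(2) by (auto simp: indicator_eq_0_iff)
  qed
qed

abbreviation P where "P \<equiv> perron_frobenius f \<rho>"

lemma P_eq: "P h x = (\<Sum>y\<in>f -` {x}. \<rho> y * h y)"
  by (simp add: perron_frobenius_def mult.commute)

lemma P_diff: "P (\<lambda>y. h y - k y) x = P h x - P k x"
  by (simp add: P_eq right_diff_distrib sum_subtractf)

lemma P_cmult: "P (\<lambda>y. c * h y) x = c * P h x"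
  by (simp add: P_eq sum_distrib_left mult.left_commute)

lemma P_comp_mult: "P (\<lambda>y. a (f y) * h y) x = a x * P h x"
  by (simp add: P_eq sum_distrib_left mult.left_commute)

lemma P_mono: "(\<And>y. h y \<le> k y) \<Longrightarrow> P h x \<le> P k x"
  using rho_pos unfolding P_eq by (intro sum_mono mult_left_mono) (auto intro: less_imp_le)

lemma P_nonneg_measurable:
  assumes h: "h \<in> borel_measurable borel" "\<And>y. 0 \<le> h y"
  shows "P h \<in> borel_measurable borel" "(\<integral>\<^sup>+x. ennreal (P h x) \<partial>m1) = (\<integral>\<^sup>+x. ennreal (h x) \<partial>m1)"
proof -
  have eq: "ennreal (P h x) = (\<Sum>y\<in>f -` {x}. ennreal (\<rho> y) * ennreal (h y))" for x
    using h(2) less_imp_le[OF rho_pos] by (simp add: P_eq sum_ennreal[symmetric] ennreal_mult)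
  have nn: "0 \<le> P h x" for x using h(2) less_imp_le[OF rho_pos] by (auto simp: P_eq intro!: sum_nonneg)
  have "(\<lambda>x. ennreal (P h x)) \<in> borel_measurable borel"
    unfolding eq using h(1) by (intro fibre_sum_measurable_ennreal) measurable
  then have "(\<lambda>x. enn2real (ennreal (P h x))) \<in> borel_measurable borel" by measurable
  then show "P h \<in> borel_measurable borel" using nn by simp
  show "(\<integral>\<^sup>+x. ennreal (P h x) \<partial>m1) = (\<integral>\<^sup>+x. ennreal (h x) \<partial>m1)"
    unfolding eq using h(1) by (intro nn_integral_fibre_sum) measurable
qed

lemma P_measurable [measurable]:
  assumes h [measurable]: "h \<in> borel_measurable borel"
  shows "P h \<in> borel_measurable borel"
proof -
  have "P h = (\<lambda>x. P (\<lambda>y. max 0 (h y)) x - P (\<lambda>y. max 0 (- h y)) x)"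
    unfolding P_diff[symmetric] by (intro ext arg_cong[where f = "\<lambda>h. P h _"]) auto
  moreover have "P (\<lambda>y. max 0 (h y)) \<in> borel_measurable borel" "P (\<lambda>y. max 0 (- h y)) \<in> borel_measurable borel"
    by (rule P_nonneg_measurable; measurable)+
  ultimately show ?thesis by simp
qed

lemma P_integral:
  assumes h: "h \<in> borel_measurable borel" "integrable m1 h"
  shows "integrable m1 (P h)" "(LINT x|m1. P h x) = (LINT x|m1. h x)"
proof -
  have pos: "integrable m1 (P h) \<and> (LINT x|m1. P h x) = (LINT x|m1. h x)"
    if h: "h \<in> borel_measurable borel" "integrable m1 h" "\<And>y. 0 \<le> h y" for h
  proof -
    note Pm = P_nonneg_measurable[OF h(1,3)]
    have nn: "0 \<le> P h x" for x using h(3) less_imp_le[OF rho_pos] by (auto simp: P_eq intro!: sum_nonneg)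
    have m: "P h \<in> borel_measurable m1" by (rule borel_measurable_sets_eq[OF sets_m1 Pm(1)])
    have "(\<integral>\<^sup>+x. ennreal (h x) \<partial>m1) = ennreal (LINT x|m1. h x)" using h by (intro nn_integral_eq_integral) auto
    then have "(\<integral>\<^sup>+x. ennreal (P h x) \<partial>m1) = ennreal (LINT x|m1. h x)" using Pm(2) by simp
    moreover have "0 \<le> (LINT x|m1. h x)" using h(3) by (intro integral_nonneg_AE) auto
    ultimately have "has_bochner_integral m1 (P h) (LINT x|m1. h x)"
      using m nn by (intro has_bochner_integral_nn_integral) auto
    then show ?thesis by (auto simp: has_bochner_integral_iff)
  qed
  let ?p = "\<lambda>y. max 0 (h y)" and ?n = "\<lambda>y. max 0 (- h y)"
  have i: "integrable m1 ?p" "integrable m1 ?n" using h(2) by auto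
  have m: "?p \<in> borel_measurable borel" "?n \<in> borel_measurable borel" using h(1) by measurable
  note p = pos[OF m(1) i(1)] and n = pos[OF m(2) i(2)]
  have hd: "h = (\<lambda>y. ?p y - ?n y)" by auto
  have "P h = P (\<lambda>y. ?p y - ?n y)" by (rule arg_cong[OF hd])
  also have "\<dots> = (\<lambda>x. P ?p x - P ?n x)" by (rule ext) (rule P_diff)
  finally have Pd: "P h = (\<lambda>x. P ?p x - P ?n x)" .
  show "integrable m1 (P h)" unfolding Pd using p n by simp
  have "(LINT x|m1. P h x) = (LINT x|m1. ?p x) - (LINT x|m1. ?n x)" unfolding Pd using p n by simp
  also have "\<dots> = (LINT x|m1. ?p x - ?n x)" using i by simp
  finally show "(LINT x|m1. P h x) = (LINT x|m1. h x)" using hd by simp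
qed

text \<open>The indicator of a test set \<open>A\<close> enters \<open>P\<close> as its composition
  with \<open>f\<close>, and invariance of \<open>m1\<close> returns the measure of
  \<open>A\<close>. Invariance acts only in integrated form, so the conclusion is almost
  everywhere.\<close>

lemma P_one: "AE x in m1. P (\<lambda>_. 1) x = 1"
proof (rule density_unique_real)
  show i: "integrable m1 (\<lambda>_. 1 :: real)" by (rule integrable_const)
  show "integrable m1 (P (\<lambda>_. 1))" by (rule P_integral(1)[OF _ i]) simp
  fix A assume "A \<in> sets m1"
  then have A [measurable]: "A \<in> sets borel" by simp
  have "(\<integral>x\<in>A. P (\<lambda>_. 1) x \<partial>m1) = (LINT x|m1. P (\<lambda>y. indicator A (f y) * 1) x)"
    by (simp only: P_comp_mult[of "indicator A" "\<lambda>_. 1"] set_lebesgue_integral_def real_scaleR_def)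
  also have "\<dots> = (LINT x|m1. indicator A (f x) * 1)"
    by (rule P_integral) (auto intro!: integrable_const_bound[where B = 1])
  also have "\<dots> = (LINT x|distr m1 borel f. indicator A x)"
    by (subst integral_distr) (auto intro: borel_measurable_sets_eq[OF sets_m1])
  also have "\<dots> = (\<integral>x\<in>A. 1 \<partial>m1)" unfolding invariant set_lebesgue_integral_def by simp
  finally show "(\<integral>x\<in>A. P (\<lambda>_. 1) x \<partial>m1) = (\<integral>x\<in>A. 1 \<partial>m1)" .
qed

lemma P_AE_cong: "AE x in m1. h x = k x \<Longrightarrow> AE x in m1. P h x = P k x"
proof -
  assume "AE x in m1. h x = k x"
  from AE_fibre[OF this] show ?thesis
  proof (rule eventually_mono)
    fix x assume *: "\<forall>y\<in>f -` {x}. h y = k y"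
    show "P h x = P k x" unfolding P_eq
      by (intro sum.cong refl arg_cong[where f = "(*) _"] bspec[OF *])
  qed
qed

end

section \<open>Skew products and the invariant measure\<close>

lemma measurable_into_borel_prod:
  fixes h :: "'a \<Rightarrow> 'm::second_countable_topology \<times> 'k::second_countable_topology"
  shows "h \<in> measurable M (borel \<Otimes>\<^sub>M borel) \<longleftrightarrow> h \<in> measurable M borel"
  unfolding borel_prod ..

lemma measurable_from_borel_prod:
  fixes h :: "'m::second_countable_topology \<times> 'k::second_countable_topology \<Rightarrow> 'a"
  shows "h \<in> measurable (borel \<Otimes>\<^sub>M borel) M \<longleftrightarrow> h \<in> measurable borel M"
  unfolding borel_prod ..

lemma measurable_section:
  fixes G :: "'m::second_countable_topology \<times> 'k::second_countable_topology \<Rightarrow> 'a"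
  assumes "G \<in> measurable borel M"
  shows "(\<lambda>z. G (y, z)) \<in> measurable borel M"
  using assms unfolding measurable_from_borel_prod[symmetric] by measurable

section \<open>Action of the skew product on representing families\<close>

context jacobian_map
begin

text \<open>How a representing family changes under the push-forward by the skew product. The weight
  \<open>\<rho>\<close> appears because fibre measures are taken relative to \<open>m1\<close> both
  before and after.\<close>

definition fibre_transfer :: "('m \<times> 'k::{metric_space, second_countable_topology} \<Rightarrow> 'k) \<Rightarrow>
    ('m \<Rightarrow> 'k signed_measure) \<Rightarrow> 'm \<Rightarrow> 'k signed_measure" where
  "fibre_transfer G s x = (\<Sum>y\<in>f -` {x}. \<rho> y *\<^sub>R pushforward (\<lambda>z. G (y, z)) (s y))"

definition skew :: "('m \<times> 'k::{metric_space, second_countable_topology} \<Rightarrow> 'k) \<Rightarrow> 'm \<times> 'k \<Rightarrow> 'm \<times> 'k" where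
  "skew G p = (f (fst p), G p)"

lemma skew_measurable:
  assumes "G \<in> borel_measurable borel"
  shows "skew G \<in> borel_measurable borel"
proof -
  have [measurable]: "G \<in> borel_measurable (borel \<Otimes>\<^sub>M borel)" using assms by (simp add: measurable_from_borel_prod)
  have "skew G \<in> measurable (borel \<Otimes>\<^sub>M borel) (borel \<Otimes>\<^sub>M borel)"
    unfolding skew_def[abs_def] by measurable
  then show ?thesis by (simp add: measurable_from_borel_prod measurable_into_borel_prod)
qed

lemma smeasure_fibre_transfer:
  assumes G: "G \<in> borel_measurable borel" and B: "B \<in> sets borel"
  shows "smeasure (fibre_transfer G s x) B = P (\<lambda>y. smeasure (s y) (Pair y -` (G -` B))) x"
  unfolding fibre_transfer_def smeasure_sum P_eq using B
  by (simp add: smeasure_pushforward[OF measurable_section[OF G]] vimage_def)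

text \<open>Over \<open>y\<close> the preimage of \<open>A \<times> B\<close> is a section of the
  preimage of \<open>B\<close> under \<open>G\<close> if \<open>f y\<close> lies in
  \<open>A\<close>, and empty otherwise. The factor \<open>indicator A (f y)\<close> passes through
  \<open>P\<close>, which preserves integrals; \<open>P w\<close> is the new integrable
  bound.\<close>

lemma fibre_rep_pushforward:
  fixes \<mu> :: "('m \<times> 'k::{metric_space, second_countable_topology}) signed_measure"
  assumes G: "G \<in> borel_measurable borel" and s: "fibre_rep m1 \<mu> s"
  shows "fibre_rep m1 (pushforward (skew G) \<mu>) (fibre_transfer G s)"
proof -
  obtain w where w: "integrable m1 w" "\<And>x B. \<bar>smeasure (s x) B\<bar> \<le> w x"
    using s by (auto simp: fibre_rep_def)
  have wm: "w \<in> borel_measurable borel"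
    using borel_measurable_integrable[OF w(1)] borel_measurable_sets_eq[OF sets_m1[symmetric]] by blast
  define k where "k B y = smeasure (s y) (Pair y -` (G -` B))" for B y
  have GB: "G -` B \<in> sets borel" if "B \<in> sets borel" for B
    using measurable_sets[OF G that] by simp
  have km: "k B \<in> borel_measurable borel" and ki: "integrable m1 (k B)" if "B \<in> sets borel" for B
    using fibre_rep_cut(1,2)[OF m1 s GB[OF that]] unfolding k_def[abs_def] by blast+
  have tr: "smeasure (fibre_transfer G s x) B = P (k B) x" if "B \<in> sets borel" for x B
    unfolding k_def by (rule smeasure_fibre_transfer[OF G that])
  show ?thesis
  proof (rule fibre_repI)
    show "integrable m1 (P w)" by (rule P_integral(1)[OF wm w(1)])
    show "(\<lambda>x. smeasure (fibre_transfer G s x) B) \<in> borel_measurable borel" if "B \<in> sets borel" for B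
      unfolding tr[OF that] by (rule P_measurable[OF km[OF that]])
    show "\<bar>smeasure (fibre_transfer G s x) B\<bar> \<le> P w x" if "B \<in> sets borel" for x B
    proof -
      have "- w y \<le> k B y" "k B y \<le> w y" for y using w(2)[of y "Pair y -` (G -` B)"] unfolding k_def by linarith+
      then have "P (\<lambda>y. (-1) * w y) x \<le> P (k B) x" "P (k B) x \<le> P w x" by (auto intro!: P_mono)
      then show ?thesis unfolding tr[OF that] P_cmult by linarith
    qed
    show "smeasure (pushforward (skew G) \<mu>) (A \<times> B) = (LINT x|m1. indicator A x * smeasure (fibre_transfer G s x) B)"
      if A: "A \<in> sets borel" and B: "B \<in> sets borel" for A B
    proof -
      have AB: "A \<times> B \<in> sets (borel :: ('m \<times> 'k) measure)" unfolding sets_borel_prod using A B by simp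
      have pre: "skew G -` (A \<times> B) \<in> sets borel"
        using measurable_sets[OF skew_measurable[OF G] AB] by simp
      have cut: "smeasure (s y) (Pair y -` (skew G -` (A \<times> B))) = indicator A (f y) * k B y" for y
      proof (cases "f y \<in> A")
        case True
        then have "Pair y -` (skew G -` (A \<times> B)) = Pair y -` (G -` B)" by (auto simp: skew_def)
        then show ?thesis using True by (simp add: k_def)
      next
        case False
        then have "Pair y -` (skew G -` (A \<times> B)) = {}" by (auto simp: skew_def)
        then show ?thesis using False by simp
      qed
      note C = fibre_rep_cut[OF m1 s pre, unfolded cut]
      have "smeasure (pushforward (skew G) \<mu>) (A \<times> B) = (LINT y|m1. indicator A (f y) * k B y)"
        using AB C(3) by (simp add: smeasure_pushforward[OF skew_measurable[OF G]])
      also have "\<dots> = (LINT x|m1. P (\<lambda>y. indicator A (f y) * k B y) x)"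
        by (rule P_integral(2)[OF C(1,2), symmetric])
      finally show ?thesis unfolding tr[OF B] P_comp_mult .
    qed
  qed
qed

lemma fibre_transfer_mass:
  assumes "G \<in> borel_measurable borel"
  shows "smeasure (fibre_transfer G s x) UNIV = P (\<lambda>y. smeasure (s y) UNIV) x"
  using smeasure_fibre_transfer[OF assms, of UNIV] by simp

text \<open>At almost every \<open>x\<close> the weights \<open>\<rho> y\<close> sum to 1, so the
  contracted bounds at the preimages are averaged and survive unchanged. \<open>AE_fibre\<close>
  makes the hypotheses available at all preimages of \<open>x\<close> at once.\<close>

lemma fibre_transfer_wbound:
  fixes s :: "'m \<Rightarrow> 'k::{metric_space, second_countable_topology} signed_measure"
  assumes \<zeta>: "0 < \<zeta>" and \<alpha>: "0 < \<alpha>"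
    and G: "\<And>x z1 z2. dist (G (x, z1)) (G (x, z2)) \<le> \<alpha> * dist z1 z2"
    and C: "0 \<le> C" "\<And>x y :: 'k. dist x y powr \<zeta> \<le> C"
    and b: "AE x in m1. wbound \<zeta> C b (s x)" and c: "AE x in m1. \<bar>smeasure (s x) UNIV\<bar> \<le> c"
  shows "AE x in m1. wbound \<zeta> C (\<alpha> powr \<zeta> * b + C * c) (fibre_transfer G s x)"
proof -
  let ?b = "\<alpha> powr \<zeta> * b + C * c"
  have "AE y in m1. wbound \<zeta> C b (s y) \<and> \<bar>smeasure (s y) UNIV\<bar> \<le> c" using b c by eventually_elim simp
  from AE_fibre[OF this] P_one show ?thesis
  proof eventually_elim
    case (elim x)
    have "wbound \<zeta> C (\<Sum>y\<in>f -` {x}. \<bar>\<rho> y\<bar> * ?b) (fibre_transfer G s x)"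
      unfolding fibre_transfer_def
    proof (intro wbound_sum[OF \<zeta>] wbound_scaleR[OF \<zeta>])
      fix y assume y: "y \<in> f -` {x}"
      have w: "wbound \<zeta> C b (s y)" and m: "\<bar>smeasure (s y) UNIV\<bar> \<le> c" using bspec[OF elim(1) y] by auto
      have "wbound \<zeta> C (\<alpha> powr \<zeta> * b + C * \<bar>smeasure (s y) UNIV\<bar>) (pushforward (\<lambda>z. G (y, z)) (s y))"
        by (rule wbound_contraction[OF \<zeta> \<alpha> G C(2) w])
      then show "wbound \<zeta> C ?b (pushforward (\<lambda>z. G (y, z)) (s y))"
        by (rule wbound_antimono) (use m C(1) in \<open>auto intro: mult_left_mono\<close>)
    qed
    also have "(\<Sum>y\<in>f -` {x}. \<bar>\<rho> y\<bar> * ?b) = P (\<lambda>_. 1) x * ?b"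
      using less_imp_le[OF rho_pos] by (simp add: P_eq sum_distrib_right)
    finally show ?case using elim(2) by simp
  qed
qed

text \<open>Past orbits \<open>x\<^sub>0 = x, x\<^sub>1, x\<^sub>2, \<dots>\<close> with \<open>f x\<^sub>n\<^sub>+\<^sub>1 = x\<^sub>n\<close> are generated from independent uniform
  variables; on them \<open>G x\<^sub>1 (G x\<^sub>2 (\<dots> (G x\<^sub>n z)))\<close> converges, and the law of the limit is the invariant
  measure on the fibre over \<open>x\<close>.\<close>

lemma invariant_measure:
  fixes G :: "'m \<times> 'k::{metric_space, second_countable_topology} \<Rightarrow> 'k"
  assumes M: "compact (UNIV :: 'm set)" and K: "compact (UNIV :: 'k set)"
    and G: "G \<in> borel_measurable borel" and \<alpha>: "0 \<le> \<alpha>" "\<alpha> < 1"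
    and contr: "\<And>x z1 z2. dist (G (x, z1)) (G (x, z2)) \<le> \<alpha> * dist z1 z2"
  obtains \<mu>0 a where "pushforward (skew G) \<mu>0 = \<mu>0" "fibre_rep m1 \<mu>0 (\<lambda>x. signed_of (a x))"
    "\<And>x. prob_space (a x)" "\<And>x. sets (a x) = sets (borel :: 'k measure)"
proof -
  interpret U: prob_space unit_uniform by (rule prob_space_unit_uniform)
  let ?S = "stream_space unit_uniform"
  interpret S: prob_space ?S by (rule U.prob_space_stream_space)
  have [measurable]: "G \<in> borel_measurable (borel \<Otimes>\<^sub>M borel)" using G by (simp add: measurable_from_borel_prod)
  \<comment> \<open>The joint law of image and point. By invariance its first marginal is
    \<open>m1\<close>, so randomizing the second coordinate yields a map \<open>\<Phi>\<close> that
    almost surely selects a preimage of \<open>x\<close>, with the right conditional law.\<close>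
  define p where "p = distr m1 (borel \<Otimes>\<^sub>M borel) (\<lambda>y. (f y, y))"
  have pair: "(\<lambda>y. (f y, y)) \<in> measurable m1 (borel \<Otimes>\<^sub>M borel)" by measurable
  have "finite_measure p" unfolding p_def by (rule finite_measure_distr[OF pair])
  moreover have "sets p = sets (borel \<Otimes>\<^sub>M borel)" by (simp add: p_def)
  ultimately obtain \<Phi> where \<Phi> [measurable]: "\<Phi> \<in> borel_measurable (borel \<Otimes>\<^sub>M borel)"
    and p: "p = distr (distr p borel fst \<Otimes>\<^sub>M unit_uniform) (borel \<Otimes>\<^sub>M borel) (\<lambda>x. (fst x, \<Phi> x))"
    by (rule randomization[OF M])
  have "distr p borel fst = distr m1 borel f" unfolding p_def by (subst distr_distr[OF _ pair]) (auto simp: o_def)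
  then have marg: "distr p borel fst = m1" using invariant by simp
  \<comment> \<open>The integrated form of the statement that \<open>(x, \<Phi> (x, u))\<close> is
    distributed as \<open>(f y, y)\<close>.\<close>
  have past: "(\<integral>\<^sup>+x. (\<integral>\<^sup>+u. v (x, \<Phi> (x, u)) \<partial>unit_uniform) \<partial>m1) = (\<integral>\<^sup>+y. v (f y, y) \<partial>m1)"
    if v [measurable]: "v \<in> borel_measurable (borel \<Otimes>\<^sub>M borel)" for v
  proof -
    have s: "sets (m1 \<Otimes>\<^sub>M unit_uniform) = sets (borel \<Otimes>\<^sub>M borel)"
      by (rule sets_pair_measure_cong) simp_all
    have m: "(\<lambda>x. (fst x, \<Phi> x)) \<in> measurable (m1 \<Otimes>\<^sub>M unit_uniform) (borel \<Otimes>\<^sub>M borel)"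
      by (subst measurable_cong_sets[OF s refl]) measurable
    have m': "(\<lambda>x. v (fst x, \<Phi> x)) \<in> borel_measurable (m1 \<Otimes>\<^sub>M unit_uniform)"
      by (rule measurable_compose[OF m v])
    have "(\<integral>\<^sup>+x. (\<integral>\<^sup>+u. v (x, \<Phi> (x, u)) \<partial>unit_uniform) \<partial>m1) = (\<integral>\<^sup>+x. v (fst x, \<Phi> x) \<partial>(m1 \<Otimes>\<^sub>M unit_uniform))"
      using U.nn_integral_fst[OF m'] by simp
    also have "\<dots> = (\<integral>\<^sup>+x. v x \<partial>(distr (m1 \<Otimes>\<^sub>M unit_uniform) (borel \<Otimes>\<^sub>M borel) (\<lambda>x. (fst x, \<Phi> x))))"
      using v by (intro nn_integral_distr[OF m, symmetric]) simp
    also have "\<dots> = (\<integral>\<^sup>+x. v x \<partial>p)" using p unfolding marg by simp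
    also have "\<dots> = (\<integral>\<^sup>+y. v (f y, y) \<partial>m1)" unfolding p_def using v by (intro nn_integral_distr[OF pair]) simp
    finally show ?thesis .
  qed
  define z0 :: 'k where "z0 = undefined"
  \<comment> \<open>The recursion runs over functions of the point and the stream, because each step
    consumes the head of the stream and continues from the preimage it selects. The start value
    \<open>z0\<close> is forgotten in the limit.\<close>
  define h where "h = rec_nat (\<lambda>_ _. z0) (\<lambda>_ hn x \<omega>. G (\<Phi> (x, shd \<omega>), hn (\<Phi> (x, shd \<omega>)) (stl \<omega>)))"
  have h0: "h 0 x \<omega> = z0" and hS: "h (Suc n) x \<omega> = G (\<Phi> (x, shd \<omega>), h n (\<Phi> (x, shd \<omega>)) (stl \<omega>))" for n x \<omega>
    by (simp_all add: h_def)
  have hm: "(\<lambda>q. h n (fst q) (snd q)) \<in> borel_measurable (borel \<Otimes>\<^sub>M ?S)" for n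
  proof (induction n)
    case (Suc n)
    have y [measurable]: "(\<lambda>q. \<Phi> (fst q, shd (snd q))) \<in> borel_measurable (borel \<Otimes>\<^sub>M ?S)" by measurable
    have "(\<lambda>q. (\<Phi> (fst q, shd (snd q)), stl (snd q))) \<in> measurable (borel \<Otimes>\<^sub>M ?S) (borel \<Otimes>\<^sub>M ?S)" by measurable
    from measurable_compose[OF this Suc]
    have [measurable]: "(\<lambda>q. h n (\<Phi> (fst q, shd (snd q))) (stl (snd q))) \<in> borel_measurable (borel \<Otimes>\<^sub>M ?S)" by simp
    show ?case unfolding hS by measurable
  qed (simp add: h0)
  obtain D where D: "\<And>z z' :: 'k. dist z z' \<le> D"
    using compact_imp_bounded[OF K] bounded_two_points[of "UNIV :: 'k set"] by auto
  \<comment> \<open>The two values share their \<open>n\<close> outermost fibre maps and differ only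
    in the innermost argument.\<close>
  have geo: "dist (h (n + k) x \<omega>) (h n x \<omega>) \<le> \<alpha> ^ n * D" for n k x \<omega>
  proof (induction n arbitrary: x \<omega>)
    case (Suc n)
    have "dist (h (Suc n + k) x \<omega>) (h (Suc n) x \<omega>)
        \<le> \<alpha> * dist (h (n + k) (\<Phi> (x, shd \<omega>)) (stl \<omega>)) (h n (\<Phi> (x, shd \<omega>)) (stl \<omega>))"
      unfolding add_Suc hS by (rule contr)
    also have "\<dots> \<le> \<alpha> * (\<alpha> ^ n * D)" using \<alpha> Suc by (intro mult_left_mono)
    finally show ?case by simp
  qed (simp add: D)
  have cauchy: "Cauchy (\<lambda>n. h n x \<omega>)" for x \<omega>
  proof (rule metric_CauchyI)
    fix e :: real assume e: "0 < e"
    have "(\<lambda>n. \<alpha> ^ n * D) \<longlonglongrightarrow> 0 * D" using \<alpha> by (intro tendsto_mult tendsto_const LIMSEQ_realpow_zero)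
    then have "(\<lambda>n. \<alpha> ^ n * D) \<longlonglongrightarrow> 0" by simp
    from order_tendstoD(2)[OF this, of "e / 2"] e
    obtain N where N: "\<alpha> ^ N * D < e / 2" by (auto simp: eventually_sequentially)
    have near: "dist (h n x \<omega>) (h N x \<omega>) < e / 2" if "N \<le> n" for n
      using geo[of N "n - N" x \<omega>] N that by simp
    have "dist (h m x \<omega>) (h n x \<omega>) < e" if "N \<le> m" "N \<le> n" for m n
      using dist_triangle2[of "h m x \<omega>" "h n x \<omega>" "h N x \<omega>"] near[OF that(1)] near[OF that(2)] by linarith
    then show "\<exists>M. \<forall>m\<ge>M. \<forall>n\<ge>M. dist (h m x \<omega>) (h n x \<omega>) < e" by blast
  qed
  define g where "g x \<omega> = lim (\<lambda>n. h n x \<omega>)" for x \<omega>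
  have lim: "(\<lambda>n. h n x \<omega>) \<longlonglongrightarrow> g x \<omega>" for x \<omega>
  proof -
    obtain l where "(\<lambda>n. h n x \<omega>) \<longlonglongrightarrow> l"
      using compact_imp_complete[OF K] cauchy[of x \<omega>] unfolding complete_def by auto
    then show ?thesis unfolding g_def by (simp add: limI)
  qed
  have gm: "(\<lambda>q. g (fst q) (snd q)) \<in> borel_measurable (borel \<Otimes>\<^sub>M ?S)"
    by (rule borel_measurable_LIMSEQ_metric[OF hm lim])
  \<comment> \<open>Continuity of the fibre map lets the recursion pass to the limit. This fixed
    point equation is the source of invariance.\<close>
  have g_eq: "g x \<omega> = G (\<Phi> (x, shd \<omega>), g (\<Phi> (x, shd \<omega>)) (stl \<omega>))" for x \<omega>
  proof -
    let ?y = "\<Phi> (x, shd \<omega>)"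
    have "continuous_on UNIV (\<lambda>z. G (?y, z))"
      using contr \<alpha> by (intro lipschitz_on_continuous_on[of \<alpha>]) (auto simp: lipschitz_on_def)
    then have "isCont (\<lambda>z. G (?y, z)) (g ?y (stl \<omega>))" by (simp add: continuous_on_eq_continuous_at)
    then have "(\<lambda>n. G (?y, h n ?y (stl \<omega>))) \<longlonglongrightarrow> G (?y, g ?y (stl \<omega>))"
      using lim by (rule isCont_tendsto_compose)
    moreover have "(\<lambda>n. h (Suc n) x \<omega>) \<longlonglongrightarrow> g x \<omega>" using lim by (rule LIMSEQ_Suc)
    ultimately show ?thesis unfolding hS by (metis LIMSEQ_unique)
  qed
  have gx [measurable]: "g x \<in> borel_measurable ?S" for x
  proof -
    have "(\<lambda>\<omega>. (x, \<omega>)) \<in> measurable ?S (borel \<Otimes>\<^sub>M ?S)" by measurable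
    from measurable_compose[OF this gm] show ?thesis by simp
  qed
  define a where "a x = distr ?S borel (g x)" for x
  have a: "prob_space (a x)" "sets (a x) = sets borel" for x
    unfolding a_def by (rule S.prob_space_distr) simp_all
  have ss: "sets (m1 \<Otimes>\<^sub>M ?S) = sets (borel \<Otimes>\<^sub>M ?S)" by (rule sets_pair_measure_cong) simp_all
  have gp: "(\<lambda>q. (fst q, g (fst q) (snd q))) \<in> measurable (m1 \<Otimes>\<^sub>M ?S) borel"
  proof -
    note gm [measurable]
    have "(\<lambda>q. (fst q, g (fst q) (snd q))) \<in> measurable (borel \<Otimes>\<^sub>M ?S) (borel \<Otimes>\<^sub>M borel)" by measurable
    then show ?thesis unfolding measurable_cong_sets[OF ss refl] by (simp add: measurable_into_borel_prod)
  qed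
  define Q where "Q = distr (m1 \<Otimes>\<^sub>M ?S) borel (\<lambda>q. (fst q, g (fst q) (snd q)))"
  have Q_int: "emeasure Q E = (\<integral>\<^sup>+x. (\<integral>\<^sup>+\<omega>. indicator E (x, g x \<omega>) \<partial>?S) \<partial>m1)" if E: "E \<in> sets borel" for E
  proof -
    have "emeasure Q E = (\<integral>\<^sup>+q. indicator E q \<partial>Q)" using E by (simp add: Q_def)
    also have "\<dots> = (\<integral>\<^sup>+q. indicator E (fst q, g (fst q) (snd q)) \<partial>(m1 \<Otimes>\<^sub>M ?S))"
      unfolding Q_def using E by (intro nn_integral_distr[OF gp]) simp
    also have "\<dots> = (\<integral>\<^sup>+x. (\<integral>\<^sup>+\<omega>. indicator E (x, g x \<omega>) \<partial>?S) \<partial>m1)"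
      using S.nn_integral_fst[OF measurable_compose[OF gp borel_measurable_indicator[OF E]]] by simp
    finally show ?thesis .
  qed
  have pQ: "prob_space Q" unfolding Q_def
  proof (rule prob_space.prob_space_distr[OF _ gp])
    show "prob_space (m1 \<Otimes>\<^sub>M ?S)" by (rule prob_space_pair) unfold_locales
  qed
  then have fQ: "finite_measure Q" by (simp add: prob_space_def)
  interpret Q: finite_measure Q by (rule fQ)
  have sQ: "sets Q = sets borel" by (simp add: Q_def)
  have inv: "emeasure Q (skew G -` E) = emeasure Q E" if E [measurable]: "E \<in> sets borel" for E
  proof -
    have E' [measurable]: "E \<in> sets (borel \<Otimes>\<^sub>M borel)" using E unfolding sets_borel_prod .
    \<comment> \<open>\<open>v\<close> tests \<open>E\<close> at the first coordinate of
      \<open>q\<close> and at the image of the limit value over the second. Along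
      \<open>(f y, y)\<close> its integral is the mass of the preimage of \<open>E\<close>; along
      \<open>(x, \<Phi> (x, u))\<close> the variable \<open>u\<close> is prepended to the stream and
      the fixed point equation returns the mass of \<open>E\<close>.\<close>
    define v where "v q = (\<integral>\<^sup>+\<omega>. indicator E (fst q, G (snd q, g (snd q) \<omega>)) \<partial>?S)" for q
    have v: "v \<in> borel_measurable (borel \<Otimes>\<^sub>M borel)"
      unfolding v_def
    proof (rule S.borel_measurable_nn_integral)
      have "(\<lambda>(q, \<omega>). (snd q, \<omega>)) \<in> measurable ((borel \<Otimes>\<^sub>M borel) \<Otimes>\<^sub>M ?S) (borel \<Otimes>\<^sub>M ?S)" by measurable
      from measurable_compose[OF this gm]
      have [measurable]: "(\<lambda>w. g (snd (fst w)) (snd w)) \<in> borel_measurable ((borel \<Otimes>\<^sub>M borel) \<Otimes>\<^sub>M ?S)"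
        by (simp add: case_prod_beta')
      show "(\<lambda>(q, \<omega>). indicator E (fst q, G (snd q, g (snd q) \<omega>))) \<in> borel_measurable ((borel \<Otimes>\<^sub>M borel) \<Otimes>\<^sub>M ?S)"
        by measurable
    qed
    have SE: "skew G -` E \<in> sets borel" using measurable_sets[OF skew_measurable[OF G] E] by simp
    have "emeasure Q (skew G -` E) = (\<integral>\<^sup>+y. v (f y, y) \<partial>m1)"
      unfolding Q_int[OF SE] v_def
      by (intro nn_integral_cong) (simp add: indicator_def skew_def)
    also have "\<dots> = (\<integral>\<^sup>+x. (\<integral>\<^sup>+u. v (x, \<Phi> (x, u)) \<partial>unit_uniform) \<partial>m1)" by (rule past[OF v, symmetric])
    also have "\<dots> = (\<integral>\<^sup>+x. (\<integral>\<^sup>+\<omega>. indicator E (x, g x \<omega>) \<partial>?S) \<partial>m1)"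
    proof (intro nn_integral_cong)
      fix x
      have m: "(\<lambda>\<omega>. indicator E (x, g x \<omega>) :: ennreal) \<in> borel_measurable ?S" by measurable
      show "(\<integral>\<^sup>+u. v (x, \<Phi> (x, u)) \<partial>unit_uniform) = (\<integral>\<^sup>+\<omega>. indicator E (x, g x \<omega>) \<partial>?S)"
        unfolding U.nn_integral_stream_space[OF m] v_def by (subst g_eq) simp
    qed
    also have "\<dots> = emeasure Q E" by (rule Q_int[OF E, symmetric])
    finally show ?thesis .
  qed
  have "pushforward (skew G) (signed_of Q) = signed_of Q"
    using inv by (intro smeasure_eqI)
      (simp add: smeasure_pushforward[OF skew_measurable[OF G]] smeasure_signed_of[OF fQ sQ] measure_def)
  moreover have "fibre_rep m1 (signed_of Q) (\<lambda>x. signed_of (a x))"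
  proof (rule fibre_repI)
    have af: "finite_measure (a x)" for x using a(1)[of x] by (simp add: prob_space_def)
    note sa = smeasure_signed_of[OF af a(2)]
    have ae: "emeasure (a x) B = (\<integral>\<^sup>+\<omega>. indicator B (g x \<omega>) \<partial>?S)" if "B \<in> sets borel" for x B
    proof -
      have "emeasure (a x) B = (\<integral>\<^sup>+z. indicator B z \<partial>a x)" using that a(2) by simp
      then show ?thesis unfolding a_def using that by (subst (asm) nn_integral_distr) auto
    qed
    have me: "(\<lambda>x. emeasure (a x) B) \<in> borel_measurable borel" if "B \<in> sets borel" for B
      unfolding ae[OF that]
    proof (rule S.borel_measurable_nn_integral)
      show "(\<lambda>(x, \<omega>). indicator B (g x \<omega>)) \<in> borel_measurable (borel \<Otimes>\<^sub>M ?S)"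
        using measurable_compose[OF gm borel_measurable_indicator[OF that]] by (simp add: case_prod_beta')
    qed
    show mm: "(\<lambda>x. smeasure (signed_of (a x)) B) \<in> borel_measurable borel" if "B \<in> sets borel" for B
      unfolding sa measure_def using me[OF that] by measurable
    show "integrable m1 (\<lambda>_. 1 :: real)" by (rule integrable_const)
    show "\<bar>smeasure (signed_of (a x)) B\<bar> \<le> 1" for x B
      unfolding sa using prob_space.prob_le_1[OF a(1)] by simp
    show "smeasure (signed_of Q) (A \<times> B) = (LINT x|m1. indicator A x * smeasure (signed_of (a x)) B)"
      if A: "A \<in> sets borel" and B: "B \<in> sets borel" for A B
    proof -
      have AB: "A \<times> B \<in> sets (borel :: ('m \<times> 'k) measure)" unfolding sets_borel_prod using A B by simp
      have "emeasure Q (A \<times> B) = (\<integral>\<^sup>+x. ennreal (indicator A x * measure (a x) B) \<partial>m1)"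
        unfolding Q_int[OF AB]
      proof (intro nn_integral_cong)
        fix x
        have "(\<integral>\<^sup>+\<omega>. indicator (A \<times> B) (x, g x \<omega>) \<partial>?S) = indicator A x * emeasure (a x) B"
          unfolding ae[OF B] by (auto simp: indicator_def)
        also have "\<dots> = ennreal (indicator A x * measure (a x) B)"
          using finite_measure.emeasure_eq_measure[OF af[of x], of B] by (simp add: indicator_def)
        finally show "(\<integral>\<^sup>+\<omega>. indicator (A \<times> B) (x, g x \<omega>) \<partial>?S) = ennreal (indicator A x * measure (a x) B)" .
      qed
      moreover have "(\<lambda>x. indicator A x * measure (a x) B) \<in> borel_measurable m1"
        using mm[OF B] A by (intro borel_measurable_sets_eq[OF sets_m1] borel_measurable_times) (simp_all add: sa)
      ultimately show ?thesis unfolding sa smeasure_signed_of[OF fQ sQ]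
        by (subst integral_eq_nn_integral) (auto simp: measure_def)
    qed
  qed
  ultimately show ?thesis using that a by blast
qed

end

section \<open>The space of measures and the spectral gap\<close>

lemma holder_fun_iff: "h \<in> holder_fun \<zeta> \<longleftrightarrow> (\<exists>c\<ge>0. \<forall>x y. \<bar>h x - h y\<bar> \<le> c * dist x y powr \<zeta>)"
proof
  assume "h \<in> holder_fun \<zeta>"
  then have "holder_const \<zeta> h = ennreal (enn2real (holder_const \<zeta> h))" by (simp add: holder_fun_def)
  then show "\<exists>c\<ge>0. \<forall>x y. \<bar>h x - h y\<bar> \<le> c * dist x y powr \<zeta>"
    using holder_const_le_iff[of "enn2real (holder_const \<zeta> h)" \<zeta> h] by (metis enn2real_nonneg order_refl)
next
  assume "\<exists>c\<ge>0. \<forall>x y. \<bar>h x - h y\<bar> \<le> c * dist x y powr \<zeta>"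
  then obtain c where "holder_const \<zeta> h \<le> ennreal c" using holder_const_le_iff by blast
  then show "h \<in> holder_fun \<zeta>" unfolding holder_fun_def using le_less_trans[of _ "ennreal c" \<infinity>] by auto
qed

lemma holder_fun_const: "(\<lambda>_. c) \<in> holder_fun \<zeta>"
  unfolding holder_fun_iff by (intro exI[of _ 0]) simp

lemma holder_fun_add:
  assumes "h \<in> holder_fun \<zeta>" "k \<in> holder_fun \<zeta>"
  shows "(\<lambda>x. h x + k x) \<in> holder_fun \<zeta>"
proof -
  obtain c d where c: "c \<ge> 0" "\<And>x y. \<bar>h x - h y\<bar> \<le> c * dist x y powr \<zeta>"
    and d: "d \<ge> 0" "\<And>x y. \<bar>k x - k y\<bar> \<le> d * dist x y powr \<zeta>"
    using assms unfolding holder_fun_iff by blast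
  have "\<bar>(h x + k x) - (h y + k y)\<bar> \<le> (c + d) * dist x y powr \<zeta>" for x y
    using c(2)[of x y] d(2)[of x y] unfolding distrib_right by linarith
  then show ?thesis unfolding holder_fun_iff using c(1) d(1) by (intro exI[of _ "c + d"]) simp
qed

lemma holder_fun_cmult:
  assumes "h \<in> holder_fun \<zeta>"
  shows "(\<lambda>x. r * h x) \<in> holder_fun \<zeta>"
proof -
  obtain c where c: "c \<ge> 0" "\<And>x y. \<bar>h x - h y\<bar> \<le> c * dist x y powr \<zeta>"
    using assms unfolding holder_fun_iff by blast
  have "\<bar>r * h x - r * h y\<bar> \<le> (\<bar>r\<bar> * c) * dist x y powr \<zeta>" for x y
    using mult_left_mono[OF c(2)[of x y], of "\<bar>r\<bar>"] by (simp add: abs_mult mult.assoc flip: right_diff_distrib)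
  then show ?thesis unfolding holder_fun_iff using c(1) by (intro exI[of _ "\<bar>r\<bar> * c"]) simp
qed

lemma holder_fun_measurable: "0 < \<zeta> \<Longrightarrow> h \<in> holder_fun \<zeta> \<Longrightarrow> h \<in> borel_measurable borel"
  unfolding holder_fun_iff by (blast intro: borel_measurable_continuous_onI holder_continuous)

lemma holder_norm_finite:
  fixes h :: "'m::metric_space \<Rightarrow> real"
  assumes M: "compact (UNIV :: 'm set)" and \<zeta>: "0 < \<zeta>" and h: "h \<in> holder_fun \<zeta>"
  shows "holder_norm \<zeta> h < \<infinity>"
proof -
  have "continuous_on UNIV h" using h \<zeta> unfolding holder_fun_iff by (blast intro: holder_continuous)
  then have "bounded (h ` UNIV)" using M compact_continuous_image compact_imp_bounded by blast
  then obtain B where "\<And>x. \<bar>h x\<bar> \<le> B" by (auto simp: bounded_iff)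
  then have "sup_norm h \<le> ennreal B" using order_trans[OF abs_ge_zero] by (subst sup_norm_le_iff) auto
  then have "sup_norm h < \<infinity>" by (rule le_less_trans) simp
  then show ?thesis using h by (simp add: holder_norm_def holder_fun_def)
qed

lemma holder_norm_bound:
  assumes "holder_norm \<zeta> h \<le> ennreal H" "0 \<le> H"
  shows "\<bar>h x\<bar> \<le> H"
proof -
  have "sup_norm h \<le> ennreal H" using assms(1) by (simp add: holder_norm_def) (metis add_increasing order_refl order_trans zero_le)
  then show ?thesis using assms(2) by (simp add: sup_norm_le_iff)
qed

text \<open>The Hoelder constant ignores the constant, and the sup norm grows by at most
  \<open>H\<close>.\<close>

lemma holder_norm_diff_const:
  assumes h: "holder_norm \<zeta> h \<le> ennreal H" and H: "0 \<le> H" "\<bar>c\<bar> \<le> H"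
  shows "holder_norm \<zeta> (\<lambda>x. h x - c) \<le> ennreal (2 * H)"
proof -
  have "holder_const \<zeta> (\<lambda>x. h x - c) = holder_const \<zeta> h" by (simp add: holder_const_def)
  moreover have "sup_norm (\<lambda>x. h x - c) \<le> sup_norm h + ennreal H"
    unfolding sup_norm_def
  proof (rule SUP_least)
    fix x
    have "ennreal \<bar>h x - c\<bar> \<le> ennreal (\<bar>h x\<bar> + H)" using H by (intro ennreal_leI) linarith
    also have "\<dots> = ennreal \<bar>h x\<bar> + ennreal H" using H by simp
    also have "\<dots> \<le> (SUP x. ennreal \<bar>h x\<bar>) + ennreal H" by (intro add_right_mono SUP_upper) simp
    finally show "ennreal \<bar>h x - c\<bar> \<le> (SUP x. ennreal \<bar>h x\<bar>) + ennreal H" .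
  qed
  ultimately have "holder_norm \<zeta> (\<lambda>x. h x - c) \<le> holder_norm \<zeta> h + ennreal H"
    unfolding holder_norm_def by (simp add: add.assoc add_left_mono)
  also have "\<dots> \<le> ennreal H + ennreal H" using h by (rule add_right_mono)
  finally show ?thesis using H by (simp flip: ennreal_plus)
qed

lemma fibre_rep_determines:
  fixes \<mu> \<nu> :: "('m::second_countable_topology \<times> 'k::second_countable_topology) signed_measure"
  assumes m1: "borel_prob m1" and s: "fibre_rep m1 \<mu> s" and t: "fibre_rep m1 \<nu> t"
    and eq: "AE x in m1. s x = t x"
  shows "\<mu> = \<nu>"
proof (rule smeasure_eqI)
  fix E :: "('m \<times> 'k) set" assume E: "E \<in> sets borel"
  note meas = borel_measurable_sets_eq[OF borel_probD(2)[OF m1]]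
  have "(LINT x|m1. smeasure (s x) (Pair x -` E)) = (LINT x|m1. smeasure (t x) (Pair x -` E))"
    using eq by (intro integral_cong_AE meas fibre_rep_cut(1)[OF m1 s E] fibre_rep_cut(1)[OF m1 t E])
      (auto elim: eventually_mono)
  then show "smeasure \<mu> E = smeasure \<nu> E" using fibre_rep_cut(3)[OF m1 s E] fibre_rep_cut(3)[OF m1 t E] by simp
qed

lemma fibre_rep_zero: "fibre_rep m1 0 (\<lambda>_. 0)"
  by (rule fibre_repI[where w = "\<lambda>_. 0"]) auto

text \<open>The norm is an infimum over Hoelder versions, and the fibre norm can be computed on any
  representing family, so a single choice of both suffices for an upper bound.\<close>

lemma Sinf_spaceI:
  fixes \<mu> :: "('m::{metric_space, second_countable_topology} \<times> 'k::{metric_space, second_countable_topology}) signed_measure"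
  assumes K: "compact (UNIV :: 'k set)" and \<zeta>: "0 < \<zeta>" and m1: "borel_prob m1"
    and s: "fibre_rep m1 \<mu> s" and b: "0 \<le> b" "AE x in m1. wbound \<zeta> 1 b (s x)"
    and h: "h \<in> holder_fun \<zeta>" "AE x in m1. h x = smeasure (s x) UNIV"
  shows "\<mu> \<in> Sinf_space \<zeta> m1" "Sinf_norm \<zeta> m1 \<mu> \<le> holder_norm \<zeta> h + ennreal b"
proof -
  have L: "Linf_norm \<zeta> m1 \<mu> \<le> ennreal b" using b by (simp add: Linf_norm_le_iff[OF K \<zeta> m1 s])
  have "AE x in m1. h x = signed_density m1 \<mu> x" using h(2) restriction_eq(2)[OF K m1 s] by eventually_elim simp
  then have v: "h \<in> holder_versions \<zeta> m1 (signed_density m1 \<mu>)" using h(1) by (simp add: holder_versions_def)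
  have "Linf_norm \<zeta> m1 \<mu> < \<infinity>" using L by (rule le_less_trans) simp
  then show "\<mu> \<in> Sinf_space \<zeta> m1"
    using v fibre_rep_AB_space[OF m1 s] by (auto simp: Sinf_space_def Linf_space_def)
  show "Sinf_norm \<zeta> m1 \<mu> \<le> holder_norm \<zeta> h + ennreal b"
    unfolding Sinf_norm_def by (intro add_mono INF_lower v L)
qed

lemma Sinf_spaceD:
  fixes \<mu> :: "('m::{metric_space, second_countable_topology} \<times> 'k::{metric_space, second_countable_topology}) signed_measure"
  assumes K: "compact (UNIV :: 'k set)" and \<zeta>: "0 < \<zeta>" and m1: "borel_prob m1" and \<mu>: "\<mu> \<in> Sinf_space \<zeta> m1"
  defines "b \<equiv> enn2real (Linf_norm \<zeta> m1 \<mu>)"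
  shows "\<mu> \<in> AB_space m1" "fibre_rep m1 \<mu> (restriction m1 \<mu>)" "Linf_norm \<zeta> m1 \<mu> = ennreal b"
    "AE x in m1. wbound \<zeta> 1 b (restriction m1 \<mu> x)"
    "holder_versions \<zeta> m1 (signed_density m1 \<mu>) \<noteq> {}"
    "h \<in> holder_versions \<zeta> m1 (signed_density m1 \<mu>) \<Longrightarrow>
      h \<in> holder_fun \<zeta> \<and> (AE x in m1. h x = smeasure (restriction m1 \<mu> x) UNIV)"
proof -
  show AB: "\<mu> \<in> AB_space m1" using \<mu> by (simp add: Sinf_space_def Linf_space_def)
  show s: "fibre_rep m1 \<mu> (restriction m1 \<mu>)" by (rule fibre_rep_restriction(1)[OF K m1 AB])
  show L: "Linf_norm \<zeta> m1 \<mu> = ennreal b" using \<mu> by (simp add: Sinf_space_def Linf_space_def b_def)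
  show "AE x in m1. wbound \<zeta> 1 b (restriction m1 \<mu> x)"
    using L by (subst Linf_norm_le_iff[OF K \<zeta> m1 s, symmetric]) (simp_all add: b_def)
  show "holder_versions \<zeta> m1 (signed_density m1 \<mu>) \<noteq> {}" using \<mu> by (simp add: Sinf_space_def)
  show "h \<in> holder_fun \<zeta> \<and> (AE x in m1. h x = smeasure (restriction m1 \<mu> x) UNIV)"
    if "h \<in> holder_versions \<zeta> m1 (signed_density m1 \<mu>)"
    using that by (simp add: holder_versions_def fibre_rep_restriction(2)[OF K m1 AB])
qed

lemma Sinf_space_add:
  fixes \<mu> \<nu> :: "('m::{metric_space, second_countable_topology} \<times> 'k::{metric_space, second_countable_topology}) signed_measure"
  assumes K: "compact (UNIV :: 'k set)" and \<zeta>: "0 < \<zeta>" and m1: "borel_prob m1"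
    and \<mu>: "\<mu> \<in> Sinf_space \<zeta> m1" and \<nu>: "\<nu> \<in> Sinf_space \<zeta> m1"
  shows "\<mu> + \<nu> \<in> Sinf_space \<zeta> m1"
proof -
  note A = Sinf_spaceD[OF K \<zeta> m1 \<mu>] and B = Sinf_spaceD[OF K \<zeta> m1 \<nu>]
  obtain h where h: "h \<in> holder_fun \<zeta>" "AE x in m1. h x = smeasure (restriction m1 \<mu> x) UNIV" using A(5,6) by blast
  obtain k where k: "k \<in> holder_fun \<zeta>" "AE x in m1. k x = smeasure (restriction m1 \<nu> x) UNIV" using B(5,6) by blast
  show ?thesis
  proof (rule Sinf_spaceI(1)[OF K \<zeta> m1 fibre_rep_add[OF m1 A(2) B(2)]])
    show "AE x in m1. wbound \<zeta> 1 (enn2real (Linf_norm \<zeta> m1 \<mu>) + enn2real (Linf_norm \<zeta> m1 \<nu>))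
        (restriction m1 \<mu> x + restriction m1 \<nu> x)"
      using A(4) B(4) by eventually_elim (rule wbound_add[OF \<zeta>])
    show "(\<lambda>x. h x + k x) \<in> holder_fun \<zeta>" by (rule holder_fun_add[OF h(1) k(1)])
    show "AE x in m1. h x + k x = smeasure (restriction m1 \<mu> x + restriction m1 \<nu> x) UNIV"
      using h(2) k(2) by eventually_elim simp
  qed simp
qed

lemma Sinf_space_scaleR:
  fixes \<mu> :: "('m::{metric_space, second_countable_topology} \<times> 'k::{metric_space, second_countable_topology}) signed_measure"
  assumes K: "compact (UNIV :: 'k set)" and \<zeta>: "0 < \<zeta>" and m1: "borel_prob m1"
    and \<mu>: "\<mu> \<in> Sinf_space \<zeta> m1"
  shows "c *\<^sub>R \<mu> \<in> Sinf_space \<zeta> m1"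
proof -
  note A = Sinf_spaceD[OF K \<zeta> m1 \<mu>]
  obtain h where h: "h \<in> holder_fun \<zeta>" "AE x in m1. h x = smeasure (restriction m1 \<mu> x) UNIV" using A(5,6) by blast
  show ?thesis
  proof (rule Sinf_spaceI(1)[OF K \<zeta> m1 fibre_rep_scaleR[OF A(2)]])
    show "AE x in m1. wbound \<zeta> 1 (\<bar>c\<bar> * enn2real (Linf_norm \<zeta> m1 \<mu>)) (c *\<^sub>R restriction m1 \<mu> x)"
      using A(4) by eventually_elim (rule wbound_scaleR[OF \<zeta>])
    show "(\<lambda>x. c * h x) \<in> holder_fun \<zeta>" by (rule holder_fun_cmult[OF h(1)])
    show "AE x in m1. c * h x = smeasure (c *\<^sub>R restriction m1 \<mu> x) UNIV"
      using h(2) by eventually_elim simp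
  qed simp
qed

lemma Sinf_space_subspace:
  assumes K: "compact (UNIV :: 'k::{metric_space, second_countable_topology} set)" and \<zeta>: "0 < \<zeta>"
    and m1: "borel_prob (m1 :: 'm::{metric_space, second_countable_topology} measure)"
  shows "subspace (Sinf_space \<zeta> m1 :: ('m \<times> 'k) signed_measure set)"
  unfolding subspace_def
proof (intro conjI ballI allI)
  show "0 \<in> (Sinf_space \<zeta> m1 :: ('m \<times> 'k) signed_measure set)"
    by (rule Sinf_spaceI(1)[OF K \<zeta> m1 fibre_rep_zero, of 0 "\<lambda>_. 0"])
      (auto intro: holder_fun_const wbound_zero[OF \<zeta>])
qed (auto intro: Sinf_space_add[OF K \<zeta> m1] Sinf_space_scaleR[OF K \<zeta> m1])

lemma fibre_rep_mass:
  assumes "fibre_rep m1 \<mu> s"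
  shows "smeasure \<mu> UNIV = (LINT x|m1. smeasure (s x) UNIV)"
  using fibre_rep_rect[OF assms, of UNIV UNIV] by simp

text \<open>The sup bound of the test functions must meet two demands: at least 1, to be comparable
  with \<open>wnorm\<close>, and at least every power of a distance, for the contraction.\<close>

lemma compact_dist_powr_bound:
  assumes K: "compact (UNIV :: 'k::metric_space set)" and \<zeta>: "0 < \<zeta>"
  shows "\<exists>C\<ge>1. \<forall>x y :: 'k. dist x y powr \<zeta> \<le> C"
proof -
  obtain d where d: "\<And>z z' :: 'k. dist z z' \<le> d"
    using compact_imp_bounded[OF K] bounded_two_points[of "UNIV :: 'k set"] by auto
  have "dist x y powr \<zeta> \<le> d powr \<zeta>" for x y :: 'k using d \<zeta> by (intro powr_mono2) auto
  then show ?thesis by (intro exI[of _ "max 1 (d powr \<zeta>)"]) (auto intro: max.coboundedI2)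
qed

section \<open>Decay on measures of total mass zero\<close>

context jacobian_map
begin

text \<open>Since \<open>h\<close> is merely a version of the density, equality is only almost
  everywhere; \<open>P\<close> respects such equalities because almost everywhere properties hold at
  all preimages of almost every point.\<close>

lemma P_pow_AE:
  assumes G: "G \<in> borel_measurable borel" and h: "AE x in m1. h x = smeasure (s x) UNIV"
  shows "AE x in m1. (P ^^ n) h x = smeasure ((fibre_transfer G ^^ n) s x) UNIV"
proof (induction n)
  case (Suc n)
  then show ?case using P_AE_cong[OF Suc] by (simp add: fibre_transfer_mass[OF G])
qed (simp add: h)

lemma fibre_rep_pow:
  fixes \<mu> :: "('m \<times> 'k::{metric_space, second_countable_topology}) signed_measure"
  assumes "G \<in> borel_measurable borel" "fibre_rep m1 \<mu> s"
  shows "fibre_rep m1 ((pushforward (skew G) ^^ n) \<mu>) ((fibre_transfer G ^^ n) s)"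
  by (induction n) (simp_all add: assms fibre_rep_pushforward)

text \<open>The densities decay by the gap of \<open>P\<close>, and the masses of the fibres are the only obstruction to
  the contraction of the fibre norms.\<close>

lemma exponential_decay:
  fixes G :: "'m \<times> 'k::{metric_space, second_countable_topology} \<Rightarrow> 'k"
  assumes M: "compact (UNIV :: 'm set)" and K: "compact (UNIV :: 'k set)" and \<zeta>: "0 < \<zeta>"
    and G: "G \<in> borel_measurable borel" and \<alpha>: "0 < \<alpha>" "\<alpha> < 1"
    and contr: "\<And>x z1 z2. dist (G (x, z1)) (G (x, z2)) \<le> \<alpha> * dist z1 z2"
    and r: "0 < r" "r < 1" "0 < D"
    and gap: "\<And>n h. n \<ge> 1 \<Longrightarrow> h \<in> holder_fun \<zeta> \<Longrightarrow> (LINT x|m1. h x) = 0 \<Longrightarrow>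
      holder_norm \<zeta> ((P ^^ n) h) \<le> ennreal (D * r ^ n) * holder_norm \<zeta> h"
  obtains \<xi> K1 where "0 < \<xi>" "\<xi> < 1" "0 < K1"
    "\<forall>(\<mu> :: ('m \<times> 'k) signed_measure) s b h H n. fibre_rep m1 \<mu> s \<longrightarrow> 0 \<le> b \<longrightarrow> 0 \<le> H \<longrightarrow>
      (AE x in m1. wbound \<zeta> 1 b (s x)) \<longrightarrow> h \<in> holder_fun \<zeta> \<longrightarrow> (AE x in m1. h x = smeasure (s x) UNIV) \<longrightarrow>
      holder_norm \<zeta> h \<le> ennreal H \<longrightarrow> (LINT x|m1. h x) = 0 \<longrightarrow> n \<ge> 1 \<longrightarrow>
      Sinf_norm \<zeta> m1 ((pushforward (skew G) ^^ n) \<mu>) \<le> ennreal (K1 * \<xi> ^ n * (H + b))"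
proof -
  obtain C where C: "1 \<le> C" "\<And>x y :: 'k. dist x y powr \<zeta> \<le> C"
    using compact_dist_powr_bound[OF K \<zeta>] by blast
  \<comment> \<open>At least 1, so that the decay bound also covers \<open>n = 0\<close>, where the
    iterate is \<open>h\<close> itself.\<close>
  define D' where "D' = max 1 D"
  define \<theta> where "\<theta> = max (\<alpha> powr \<zeta>) r"
  have "\<alpha> powr \<zeta> < 1" using powr_less_mono2[of \<zeta> \<alpha> 1] \<alpha> \<zeta> by simp
  then have \<theta>: "\<alpha> powr \<zeta> \<le> \<theta>" "r \<le> \<theta>" "\<theta> < 1" "0 < \<theta>" using r by (auto simp: \<theta>_def)
  \<comment> \<open>Strictly above \<open>\<theta>\<close>: the fibre bound obeys a recursion of
    rate at most \<open>\<theta>\<close> whose source term also decays at rate at most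
    \<open>\<theta>\<close>, and its solution may behave like
    \<open>n * \<theta> ^ n\<close>.\<close>
  define \<xi> where "\<xi> = (1 + \<theta>) / 2"
  have \<xi>: "\<theta> < \<xi>" "\<xi> < 1" "0 < \<xi>" using \<theta> by (auto simp: \<xi>_def)
  \<comment> \<open>The second summand is tailored to
    \<open>\<theta> * K' + C * D' \<le> \<xi> * K'\<close>, which closes the induction. The first
    one starts it, paying for the passage from test functions bounded by 1 to those bounded by
    \<open>C\<close>.\<close>
  define K' where "K' = C + C * D' / (\<xi> - \<theta>)"
  have K': "C \<le> K'" "\<theta> * K' + C * D' \<le> \<xi> * K'" "0 \<le> K'"
  proof -
    have q: "0 \<le> C * D' / (\<xi> - \<theta>)" using C(1) \<xi> by (simp add: D'_def)
    then show "C \<le> K'" "0 \<le> K'" using C(1) by (auto simp: K'_def)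
    have "C * D' = (\<xi> - \<theta>) * (C * D' / (\<xi> - \<theta>))" using \<xi> by simp
    also have "\<dots> \<le> (\<xi> - \<theta>) * K'" using \<xi> C(1) by (intro mult_left_mono) (auto simp: K'_def)
    finally show "\<theta> * K' + C * D' \<le> \<xi> * K'" by (simp add: algebra_simps)
  qed
  show ?thesis
  proof (rule that[of \<xi> "D' + K'"])
    show "0 < D' + K'" using K' by (simp add: D'_def)
  next
    show "\<forall>(\<mu> :: ('m \<times> 'k) signed_measure) s b h H n. fibre_rep m1 \<mu> s \<longrightarrow> 0 \<le> b \<longrightarrow> 0 \<le> H \<longrightarrow>
      (AE x in m1. wbound \<zeta> 1 b (s x)) \<longrightarrow> h \<in> holder_fun \<zeta> \<longrightarrow> (AE x in m1. h x = smeasure (s x) UNIV) \<longrightarrow>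
      holder_norm \<zeta> h \<le> ennreal H \<longrightarrow> (LINT x|m1. h x) = 0 \<longrightarrow> n \<ge> 1 \<longrightarrow>
      Sinf_norm \<zeta> m1 ((pushforward (skew G) ^^ n) \<mu>) \<le> ennreal ((D' + K') * \<xi> ^ n * (H + b))"
    proof (intro allI impI)
      fix \<mu> :: "('m \<times> 'k) signed_measure" and s b h H and n :: nat
      assume s: "fibre_rep m1 \<mu> s" and b: "0 \<le> b" and H: "0 \<le> H" and w: "AE x in m1. wbound \<zeta> 1 b (s x)"
        and h: "h \<in> holder_fun \<zeta>" "AE x in m1. h x = smeasure (s x) UNIV" "holder_norm \<zeta> h \<le> ennreal H"
          "(LINT x|m1. h x) = 0" and n: "n \<ge> 1"
      let ?t = "\<lambda>n. (fibre_transfer G ^^ n) s"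
      have gapn: "holder_norm \<zeta> ((P ^^ n) h) \<le> ennreal (D' * r ^ n * H)" for n
      proof (cases "n = 0")
        case True
        have "H \<le> D' * H" using H mult_right_mono[of 1 D' H] by (simp add: D'_def)
        then show ?thesis using True h(3) by (auto intro: order_trans ennreal_leI)
      next
        case False
        then have "holder_norm \<zeta> ((P ^^ n) h) \<le> ennreal (D * r ^ n) * holder_norm \<zeta> h"
          by (intro gap h) simp
        also have "\<dots> \<le> ennreal (D' * r ^ n) * ennreal H"
          using h(3) r by (intro mult_mono ennreal_leI mult_right_mono) (auto simp: D'_def)
        also have "\<dots> = ennreal (D' * r ^ n * H)"
          using r H by (simp add: ennreal_mult D'_def)
        finally show ?thesis .
      qed
      have pos: "0 \<le> D' * r ^ n * H" for n using r H by (simp add: D'_def)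
      have mass: "AE x in m1. \<bar>smeasure (?t n x) UNIV\<bar> \<le> D' * r ^ n * H" for n
        using P_pow_AE[OF G h(2), of n]
      proof eventually_elim
        case (elim x)
        show ?case using holder_norm_bound[OF gapn pos, of n x] unfolding elim .
      qed
      have wb: "AE x in m1. wbound \<zeta> C (K' * \<xi> ^ n * (H + b)) (?t n x)" for n
      proof (induction n)
        case 0
        have le: "C * b \<le> K' * \<xi> ^ 0 * (H + b)" using K' H b C(1) by (simp add: mult_mono)
        show ?case using w
        proof eventually_elim
          case (elim x)
          show ?case using wbound_antimono[OF wbound_rescale[OF \<zeta> C(1) elim] order_refl le] by simp
        qed
      next
        case (Suc n)
        have C0: "0 \<le> C" using C(1) by simp
        have "\<alpha> powr \<zeta> * (K' * \<xi> ^ n * (H + b)) + C * (D' * r ^ n * H)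
            \<le> \<theta> * (K' * \<xi> ^ n * (H + b)) + C * (D' * \<xi> ^ n * (H + b))"
        proof (intro add_mono)
          show "\<alpha> powr \<zeta> * (K' * \<xi> ^ n * (H + b)) \<le> \<theta> * (K' * \<xi> ^ n * (H + b))"
            using \<theta>(1) K'(3) \<xi> H b by (intro mult_right_mono) auto
          have "r ^ n \<le> \<xi> ^ n" using r \<theta> \<xi> by (intro power_mono) auto
          then show "C * (D' * r ^ n * H) \<le> C * (D' * \<xi> ^ n * (H + b))"
            using C0 r \<xi> H b by (intro mult_left_mono mult_mono) (auto simp: D'_def)
        qed
        also have "\<dots> = (\<theta> * K' + C * D') * (\<xi> ^ n * (H + b))" by (simp add: algebra_simps)
        also have "\<dots> \<le> (\<xi> * K') * (\<xi> ^ n * (H + b))" using K'(2) \<xi> H b by (intro mult_right_mono) auto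
        finally have le: "\<alpha> powr \<zeta> * (K' * \<xi> ^ n * (H + b)) + C * (D' * r ^ n * H) \<le> K' * \<xi> ^ Suc n * (H + b)"
          by (simp add: ac_simps)
        from fibre_transfer_wbound[OF \<zeta> \<alpha>(1) contr C0 C(2) Suc mass[of n]]
        show ?case
        proof eventually_elim
          case (elim x)
          then show ?case using wbound_antimono[OF elim order_refl le] by simp
        qed
      qed
      let ?b = "K' * \<xi> ^ n * (H + b)"
      have b': "0 \<le> ?b" using K'(3) \<xi> H b by simp
      have "holder_norm \<zeta> ((P ^^ n) h) < \<infinity>" using gapn[of n] by (rule le_less_trans) simp
      then have hn: "(P ^^ n) h \<in> holder_fun \<zeta>"
        unfolding holder_norm_def holder_fun_def by (auto simp: less_top)
      have "Sinf_norm \<zeta> m1 ((pushforward (skew G) ^^ n) \<mu>) \<le> holder_norm \<zeta> ((P ^^ n) h) + ennreal ?b"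
      proof (rule Sinf_spaceI(2)[OF K \<zeta> m1 fibre_rep_pow[OF G s] b' _ hn P_pow_AE[OF G h(2)]])
        \<comment> \<open>Test functions of level 1 are also of level \<open>C\<close>, so the
          return to the norm costs nothing.\<close>
        show "AE x in m1. wbound \<zeta> 1 ?b (?t n x)"
          using wb[of n] by eventually_elim (rule wbound_antimono, use C(1) in auto)
      qed
      also have "\<dots> \<le> ennreal (D' * r ^ n * H) + ennreal ?b" by (rule add_right_mono[OF gapn])
      also have "\<dots> = ennreal (D' * r ^ n * H + ?b)" using pos b' by simp
      also have "\<dots> \<le> ennreal ((D' + K') * \<xi> ^ n * (H + b))"
      proof (rule ennreal_leI)
        have "r ^ n \<le> \<xi> ^ n" using r \<theta> \<xi> by (intro power_mono) auto
        then have "D' * r ^ n * H \<le> D' * \<xi> ^ n * (H + b)"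
          using r \<xi> H b by (intro mult_mono) (auto simp: D'_def)
        then show "D' * r ^ n * H + ?b \<le> (D' + K') * \<xi> ^ n * (H + b)" by (simp add: distrib_right)
      qed
      finally show "Sinf_norm \<zeta> m1 ((pushforward (skew G) ^^ n) \<mu>) \<le> ennreal ((D' + K') * \<xi> ^ n * (H + b))" .
    qed
  qed (use \<xi> in auto)
qed

text \<open>Regularity of \<open>P h\<close> is available for densities of mean zero, so the mean is
  split off; it comes back as the constant \<open>c\<close> because \<open>P\<close> fixes constants
  almost everywhere.\<close>

lemma Sinf_space_pushforward:
  fixes G :: "'m \<times> 'k::{metric_space, second_countable_topology} \<Rightarrow> 'k"
  assumes M: "compact (UNIV :: 'm set)" and K: "compact (UNIV :: 'k set)" and \<zeta>: "0 < \<zeta>"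
    and G: "G \<in> borel_measurable borel" and \<alpha>: "0 < \<alpha>"
    and contr: "\<And>x z1 z2. dist (G (x, z1)) (G (x, z2)) \<le> \<alpha> * dist z1 z2"
    and P_holder: "\<And>h. h \<in> holder_fun \<zeta> \<Longrightarrow> (LINT x|m1. h x) = 0 \<Longrightarrow> P h \<in> holder_fun \<zeta>"
    and \<mu>: "\<mu> \<in> Sinf_space \<zeta> m1"
  shows "pushforward (skew G) \<mu> \<in> Sinf_space \<zeta> m1"
proof -
  note A = Sinf_spaceD[OF K \<zeta> m1 \<mu>]
  let ?b = "enn2real (Linf_norm \<zeta> m1 \<mu>)"
  obtain h where h: "h \<in> holder_fun \<zeta>" "AE x in m1. h x = smeasure (restriction m1 \<mu> x) UNIV" using A(5,6) by blast
  define H where "H = enn2real (holder_norm \<zeta> h)"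
  have H: "holder_norm \<zeta> h = ennreal H" "0 \<le> H"
    using holder_norm_finite[OF M \<zeta> h(1)] by (auto simp: H_def)
  have hb: "\<bar>h x\<bar> \<le> H" for x using holder_norm_bound[of \<zeta> h H] H by simp
  obtain C where C: "1 \<le> C" "\<And>x y :: 'k. dist x y powr \<zeta> \<le> C"
    using compact_dist_powr_bound[OF K \<zeta>] by blast
  have "AE x in m1. wbound \<zeta> C (C * ?b) (restriction m1 \<mu> x)"
    using A(4) by eventually_elim (rule wbound_rescale[OF \<zeta> C(1)])
  moreover have "AE x in m1. \<bar>smeasure (restriction m1 \<mu> x) UNIV\<bar> \<le> H"
    using h(2) by eventually_elim (metis hb)
  ultimately have w: "AE x in m1. wbound \<zeta> C (\<alpha> powr \<zeta> * (C * ?b) + C * H) (fibre_transfer G (restriction m1 \<mu>) x)"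
    using C(1) by (intro fibre_transfer_wbound[OF \<zeta> \<alpha> contr _ C(2)]) auto
  define c where "c = (LINT x|m1. h x)"
  have hi: "integrable m1 h"
    using bounded_integrable[OF finite_measure_axioms sets_m1 holder_fun_measurable[OF \<zeta> h(1)] hb] .
  have k: "(\<lambda>x. h x - c) \<in> holder_fun \<zeta>"
    using holder_fun_add[OF h(1) holder_fun_const[of "- c"]] by simp
  have "(LINT x|m1. h x - c) = 0" using hi prob_space by (simp add: c_def)
  then have Pk: "(\<lambda>x. P (\<lambda>x. h x - c) x + c) \<in> holder_fun \<zeta>"
    using holder_fun_add[OF P_holder[OF k] holder_fun_const[of c]] by simp
  have mass: "AE x in m1. P (\<lambda>x. h x - c) x + c = smeasure (fibre_transfer G (restriction m1 \<mu>) x) UNIV"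
    using P_AE_cong[OF h(2)] P_one
  proof eventually_elim
    case (elim x)
    have "P (\<lambda>x. h x - c) x = P h x - c * P (\<lambda>_. 1) x"
      using P_diff[of h "\<lambda>_. c" x] P_cmult[of c "\<lambda>_. 1" x] by simp
    then show ?case using elim by (simp add: fibre_transfer_mass[OF G])
  qed
  show ?thesis
  proof (rule Sinf_spaceI(1)[OF K \<zeta> m1 fibre_rep_pushforward[OF G A(2)] _ _ Pk mass])
    show "0 \<le> \<alpha> powr \<zeta> * (C * ?b) + C * H" using C(1) H(2) by simp
    show "AE x in m1. wbound \<zeta> 1 (\<alpha> powr \<zeta> * (C * ?b) + C * H) (fibre_transfer G (restriction m1 \<mu>) x)"
      using w by eventually_elim (rule wbound_antimono, use C(1) in auto)
  qed
qed

text \<open>The measures in \<open>AB_space m1\<close> do not charge the fibres over a null set, and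
  almost no point has a preimage in a null set. This permits modifying \<open>G\<close> over a null
  set of base points.\<close>

lemma pushforward_cong_AE:
  fixes G G' :: "'m \<times> 'k::{metric_space, second_countable_topology} \<Rightarrow> 'k"
  assumes K: "compact (UNIV :: 'k set)" and G: "G \<in> borel_measurable borel" "G' \<in> borel_measurable borel"
    and eq: "AE x in m1. \<forall>z. G (x, z) = G' (x, z)" and \<mu>: "\<mu> \<in> AB_space m1"
  shows "pushforward (skew G) \<mu> = pushforward (skew G') \<mu>"
proof (rule fibre_rep_determines[OF m1])
  note s = fibre_rep_restriction(1)[OF K m1 \<mu>]
  show "fibre_rep m1 (pushforward (skew G) \<mu>) (fibre_transfer G (restriction m1 \<mu>))"
    "fibre_rep m1 (pushforward (skew G') \<mu>) (fibre_transfer G' (restriction m1 \<mu>))"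
    by (rule fibre_rep_pushforward[OF G(1) s] fibre_rep_pushforward[OF G(2) s])+
  from AE_fibre[OF eq] show "AE x in m1. fibre_transfer G (restriction m1 \<mu>) x = fibre_transfer G' (restriction m1 \<mu>) x"
  proof eventually_elim
    case (elim x)
    have "(\<lambda>z. G (y, z)) = (\<lambda>z. G' (y, z))" if "y \<in> f -` {x}" for y using bspec[OF elim that] by auto
    then show ?case unfolding fibre_transfer_def by (intro sum.cong) simp_all
  qed
qed

end


section \<open>From the manifold to Borel pieces, and assembly of the decomposition\<close>

lemma finite_borel_embedding_partition:
  fixes f :: "'m::metric_space \<Rightarrow> 'm"
  assumes M: "compact (UNIV :: 'm set)" and loc: "\<And>x. \<exists>S. open S \<and> x \<in> S \<and> borel_embedding_on f S"
  obtains \<B> where "finite \<B>" "disjoint \<B>" "\<Union>\<B> = UNIV" "\<And>B. B \<in> \<B> \<Longrightarrow> borel_embedding_on f B"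
proof -
  obtain S where S: "\<And>x. open (S x)" "\<And>x. x \<in> S x" "\<And>x. borel_embedding_on f (S x)"
    using loc by metis
  have "UNIV \<subseteq> (\<Union>x. S x)" using S(2) by blast
  then obtain T where T: "finite T" "UNIV \<subseteq> (\<Union>x\<in>T. S x)"
    using compactE_image[OF M, of UNIV S] S(1) by metis
  obtain n :: nat and c where c: "T = c ` {i. i < n}" using finite_imp_nat_seg_image_inj_on[OF T(1)] by blast
  define B where "B i = S (c i) - (\<Union>j<i. S (c j))" for i :: nat
  have emb: "borel_embedding_on f (B i)" for i
  proof (rule borel_embedding_on_subset[OF S(3)])
    show "B i \<in> sets borel" unfolding B_def using S(1) by (intro sets.Diff borel_open open_UN) auto
    show "B i \<subseteq> S (c i)" by (auto simp: B_def)
  qed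
  show ?thesis
  proof (rule that[of "B ` {..<n}"])
    have less: "B i \<inter> B j = {}" if "i < j" for i j using that by (auto simp: B_def)
    then have "B i \<inter> B j = {}" if "i \<noteq> j" for i j using that by (metis Int_commute linorder_neqE_nat)
    then show "disjoint (B ` {..<n})" unfolding disjoint_def by (metis imageE)
    show "\<Union>(B ` {..<n}) = UNIV"
    proof (intro set_eqI iffI UNIV_I)
      fix x
      have "x \<in> (\<Union>x\<in>T. S x)" using T(2) by (rule subsetD) simp
      then obtain i where i: "i < n" "x \<in> S (c i)" unfolding c by blast
      define k where "k = (LEAST i. x \<in> S (c i))"
      have k: "x \<in> S (c k)" "k \<le> i"
        unfolding k_def using i(2) by (rule LeastI, rule Least_le)
      have "x \<notin> S (c j)" if "j < k" for j using that unfolding k_def by (rule not_less_Least)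
      then have "x \<in> B k" unfolding B_def using k(1) by blast
      then show "x \<in> \<Union>(B ` {..<n})" using k(2) i(1) by auto
    qed
  qed (use emb in auto)
qed

text \<open>Dividing by \<open>a\<close> and subtracting the finite \<open>L\<close> turns the
  hypothesis into a lower bound for every \<open>y h\<close>, hence for the infimum. It transfers an
  estimate made for each Hoelder version of a density to the quotient norm.\<close>

lemma ennreal_le_mult_INF_add:
  fixes L :: ennreal
  assumes a: "0 < a" and le: "\<And>h. h \<in> V \<Longrightarrow> x \<le> ennreal a * (y h + L)" and L: "L < \<infinity>"
  shows "x \<le> ennreal a * ((INF h\<in>V. y h) + L)"
proof -
  have L': "L \<noteq> top" using L by simp
  have inv: "ennreal (1 / a) * (ennreal a * z) = z" "ennreal a * (ennreal (1 / a) * z) = z" for z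
    using a by (simp_all add: mult.assoc[symmetric] ennreal_mult[symmetric])
  have "ennreal (1 / a) * x - L \<le> (INF h\<in>V. y h)"
  proof (rule INF_greatest)
    fix h assume "h \<in> V"
    then have "ennreal (1 / a) * x \<le> ennreal (1 / a) * (ennreal a * (y h + L))" by (intro mult_left_mono le) auto
    then show "ennreal (1 / a) * x - L \<le> y h"
      using L' by (simp add: inv ennreal_minus_le_iff add.commute)
  qed
  then have "ennreal (1 / a) * x \<le> (INF h\<in>V. y h) + L"
    using L' by (simp add: ennreal_minus_le_iff add.commute)
  then have "ennreal a * (ennreal (1 / a) * x) \<le> ennreal a * ((INF h\<in>V. y h) + L)" by (intro mult_left_mono) auto
  then show ?thesis by (simp add: inv)
qed

theorem theorem2:
  fixes \<zeta> \<sigma> L \<epsilon> \<alpha> :: real and q deg :: nat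
    and atlas :: "('m::{metric_space, second_countable_topology}, 'e::euclidean_space) chart set"
    and g :: "('m, 'e) chart \<Rightarrow> 'e \<Rightarrow> 'e \<Rightarrow> 'e \<Rightarrow> real"
    and f :: "'m \<Rightarrow> 'm" and lip :: "'m \<Rightarrow> real" and \<A> :: "'m set"
    and m1 :: "'m measure" and J \<rho> :: "'m \<Rightarrow> real"
    and G :: "'m \<times> 'k::{metric_space, second_countable_topology} \<Rightarrow> 'k"
    and F :: "'m \<times> 'k \<Rightarrow> 'm \<times> 'k"
  assumes zeta: "0 < \<zeta>" "\<zeta> < 1"
    and M: "riemannian_manifold atlas g" "compact (UNIV :: 'm set)" "connected (UNIV :: 'm set)"
      "diameter (UNIV :: 'm set) = 1"
    and f: "local_diffeomorphism atlas f"
    and ell_cont: "continuous_on UNIV lip"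
    and ell: "\<And>x. \<exists>U. open U \<and> x \<in> U \<and> inj_on f U \<and>
      (\<forall>y\<in>f ` U. \<forall>z\<in>f ` U. dist (inv_into U f y) (inv_into U f z) \<le> lip x * dist y z)"
    and deg: "\<And>x. card (f -` {x}) = deg"
    and constants: "open \<A>" "\<sigma> > 1" "L \<ge> 1" "\<epsilon> > 0" "q < deg"
    and f1: "\<And>x. x \<in> \<A> \<Longrightarrow> lip x \<le> L" "\<And>x. x \<notin> \<A> \<Longrightarrow> lip x < 1 / \<sigma>"
    and f2: "\<exists>\<U>. finite \<U> \<and> (\<forall>U\<in>\<U>. open U \<and> inj_on f U) \<and> \<Union>\<U> = UNIV \<and>
      (\<exists>\<V>\<subseteq>\<U>. card \<V> = q \<and> \<A> \<subseteq> \<Union>\<V>)"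
    and m1: "maximal_entropy_measure f m1"
      "\<exists>\<nu>. conformal_measure f \<nu> \<and> absolutely_continuous \<nu> m1"
    and J: "has_jacobian f m1 J"
    and rho: "\<rho> = (\<lambda>x. 1 / J x)"
    and f3: "\<rho> \<in> holder_fun \<zeta>" "(SUP x. ln (\<rho> x)) - (INF x. ln (\<rho> x)) < \<epsilon>"
      "holder_const \<zeta> \<rho> < ennreal (\<epsilon> * (INF x. \<rho> x))"
    and small: "exp \<epsilon> * (((real deg - real q) * \<sigma> powr (- \<zeta>)
      + real q * L powr \<zeta> * (1 + (L - 1) powr \<zeta>)) / real deg) < 1"
    and gap: "\<exists>r D. 0 < r \<and> r < 1 \<and> 0 < D \<and>
      (\<forall>n\<ge>1. \<forall>h\<in>holder_fun \<zeta>. (LINT x|m1. h x) = 0 \<longrightarrow>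
        holder_norm \<zeta> ((perron_frobenius f \<rho> ^^ n) h) \<le> ennreal (D * r ^ n) * holder_norm \<zeta> h)"
    and K: "compact (UNIV :: 'k set)"
    and G: "G \<in> borel_measurable borel"
    and G1: "0 < \<alpha>" "\<alpha> < 1"
      "AE x in m1. \<forall>z1 z2. dist (G (x, z1)) (G (x, z2)) \<le> \<alpha> * dist z1 z2"
    and F: "F = (\<lambda>(x, z). (f x, G (x, z)))"
  shows "\<exists>P N :: ('m \<times> 'k) signed_measure \<Rightarrow> ('m \<times> 'k) signed_measure.
    linear_operator_on (Sinf_space \<zeta> m1) P \<and>
    linear_operator_on (Sinf_space \<zeta> m1) N \<and>
    (\<forall>\<mu>\<in>Sinf_space \<zeta> m1. pushforward F \<mu> \<in> Sinf_space \<zeta> m1 \<and> pushforward F \<mu> = P \<mu> + N \<mu>) \<and>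
    (\<forall>\<mu>\<in>Sinf_space \<zeta> m1. P (P \<mu>) = P \<mu>) \<and>
    dim (P ` Sinf_space \<zeta> m1) = 1 \<and>
    (\<exists>\<xi> K0. 0 < \<xi> \<and> \<xi> < 1 \<and> 0 < K0 \<and>
      (\<forall>n\<ge>1. \<forall>\<mu>\<in>Sinf_space \<zeta> m1.
        Sinf_norm \<zeta> m1 ((N ^^ n) \<mu>) \<le> ennreal (K0 * \<xi> ^ n) * Sinf_norm \<zeta> m1 \<mu>)) \<and>
    (\<forall>\<mu>\<in>Sinf_space \<zeta> m1. P (N \<mu>) = 0 \<and> N (P \<mu>) = 0)"
proof -
  have inv: "invariant_prob f m1" using m1(1) by (simp add: maximal_entropy_measure_def)
  then have bp: "borel_prob m1" and dm: "distr m1 borel f = m1" by (auto simp: invariant_prob_def)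
  have loc: "\<exists>S. open S \<and> x \<in> S \<and> continuous_on S f \<and> borel_embedding_on f S" for x
  proof -
    obtain S where S: "open S" "x \<in> S" "open (f ` S)" "inj_on f S"
      "C1_map_on atlas S f" "C1_map_on atlas (f ` S) (inv_into S f)"
      using f unfolding local_diffeomorphism_def by blast
    then have "continuous_on S f" "continuous_on (f ` S) (inv_into S f)" by (simp_all add: C1_map_on_def)
    then show ?thesis using S borel_embedding_on_open by blast
  qed
  have "isCont f x" for x
    using loc[of x] by (metis at_within_open continuous_on_eq_continuous_within)
  then have fm: "f \<in> borel_measurable borel"
    by (intro borel_measurable_continuous_onI continuous_at_imp_continuous_on) simp
  have "\<exists>S. open S \<and> x \<in> S \<and> borel_embedding_on f S" for x using loc[of x] by blast
  then obtain \<B> where \<B>: "finite \<B>" "disjoint \<B>" "\<Union>\<B> = UNIV" "\<And>B. B \<in> \<B> \<Longrightarrow> borel_embedding_on f B"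
    using finite_borel_embedding_partition[OF M(2)] by metis
  interpret jacobian_map f m1 J \<rho> \<B>
    by unfold_locales (fact bp dm fm J rho \<B>)+
  let ?S = "Sinf_space \<zeta> m1 :: ('m \<times> 'k) signed_measure set"
  obtain N0 where N0: "N0 \<in> null_sets m1"
    "{x \<in> space m1. \<not> (\<forall>z1 z2. dist (G (x, z1)) (G (x, z2)) \<le> \<alpha> * dist z1 z2)} \<subseteq> N0"
    using G1(3) unfolding eventually_ae_filter by blast
  \<comment> \<open>Over the exceptional null set the fibre map is made constant, hence a
    contraction; so the contraction holds over every \<open>x\<close> while \<open>G'\<close> stays
    Borel.\<close>
  define G' where "G' p = (if fst p \<in> N0 then undefined else G p)" for p
  have contr: "dist (G' (x, z1)) (G' (x, z2)) \<le> \<alpha> * dist z1 z2" for x z1 z2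
    using N0(2) G1(1) by (auto simp: G'_def)
  have N0b: "N0 \<in> sets borel" using N0(1) by auto
  have G'm: "G' \<in> borel_measurable borel"
    unfolding G'_def[abs_def] using N0b G by measurable
  have AE_eq: "AE x in m1. \<forall>z. G (x, z) = G' (x, z)"
    using AE_not_in[OF N0(1)] by eventually_elim (simp add: G'_def)
  have F_skew: "F = skew G" by (auto simp: F skew_def fun_eq_iff)
  obtain r D where r: "0 < r" "r < 1" "0 < D" and gap': "\<And>n h. n \<ge> 1 \<Longrightarrow> h \<in> holder_fun \<zeta> \<Longrightarrow>
      (LINT x|m1. h x) = 0 \<Longrightarrow> holder_norm \<zeta> ((perron_frobenius f \<rho> ^^ n) h) \<le> ennreal (D * r ^ n) * holder_norm \<zeta> h"
    using gap by blast
  \<comment> \<open>The gap with \<open>n = 1\<close> already preserves the Hoelder class on mean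
    zero, because Hoelder norms are finite on a compact space.\<close>
  have P_holder: "perron_frobenius f \<rho> h \<in> holder_fun \<zeta>" if h: "h \<in> holder_fun \<zeta>" "(LINT x|m1. h x) = 0" for h
  proof -
    have "holder_norm \<zeta> (perron_frobenius f \<rho> h) \<le> ennreal (D * r) * holder_norm \<zeta> h"
      using gap'[of 1 h] h by simp
    also have "\<dots> < \<infinity>"
      using holder_norm_finite[OF M(2) zeta(1) h(1)] by (simp add: ennreal_mult_less_top)
    finally show ?thesis by (simp add: holder_norm_def holder_fun_def)
  qed
  define T where "T = pushforward (skew G')"
  have Tm: "skew G' \<in> borel_measurable borel" by (rule skew_measurable[OF G'm])
  have T_add: "T (\<mu> + \<nu>) = T \<mu> + T \<nu>" and T_diff: "T (\<mu> - \<nu>) = T \<mu> - T \<nu>" and T_scaleR: "T (c *\<^sub>R \<mu>) = c *\<^sub>R T \<mu>"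
    for \<mu> \<nu> c unfolding T_def by (rule pushforward_add[OF Tm] pushforward_diff[OF Tm] pushforward_scaleR[OF Tm])+
  have T_mass: "smeasure (T \<mu>) UNIV = smeasure \<mu> UNIV" for \<mu>
    by (simp add: T_def smeasure_pushforward[OF Tm])
  have T_S: "T \<mu> \<in> ?S" if "\<mu> \<in> ?S" for \<mu>
    unfolding T_def by (rule Sinf_space_pushforward[OF M(2) K zeta(1) G'm G1(1) contr P_holder that])
  have F_T: "pushforward F \<mu> = T \<mu>" if "\<mu> \<in> ?S" for \<mu>
    unfolding F_skew T_def
    by (rule pushforward_cong_AE[OF K G G'm AE_eq Sinf_spaceD(1)[OF K zeta(1) bp that]])
  obtain \<mu>0 a where inv0: "T \<mu>0 = \<mu>0" and rep0: "fibre_rep m1 \<mu>0 (\<lambda>x. signed_of (a x))"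
    and a: "\<And>x. prob_space (a x)" "\<And>x. sets (a x) = sets (borel :: 'k measure)"
    using invariant_measure[OF M(2) K G'm less_imp_le[OF G1(1)] G1(2) contr] unfolding T_def by metis
  have a1: "smeasure (signed_of (a x)) UNIV = 1" for x
  proof -
    interpret ax: prob_space "a x" by (rule a)
    show ?thesis using ax.prob_space borel_space_UNIV[OF a(2)]
      by (simp add: smeasure_signed_of[OF ax.finite_measure_axioms a(2)])
  qed
  have wb0: "AE x in m1. wbound \<zeta> 1 1 (signed_of (a x))"
    using wbound_signed_of[OF zeta(1) a] by simp
  have mass0: "smeasure \<mu>0 UNIV = 1" using fibre_rep_mass[OF rep0] prob_space by (simp add: a1)
  have S0: "\<mu>0 \<in> ?S"
    by (rule Sinf_spaceI(1)[OF K zeta(1) bp rep0 _ wb0 holder_fun_const[of 1]]) (simp_all add: a1)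
  have sub: "subspace ?S" by (rule Sinf_space_subspace[OF K zeta(1) bp])
  \<comment> \<open>The push-forward preserves total mass and fixes \<open>\<mu>0\<close>, and
    \<open>\<mu>0\<close> has mass 1: idempotence and the vanishing of both products follow from
    these facts.\<close>
  define Pr where "Pr \<mu> = smeasure \<mu> UNIV *\<^sub>R \<mu>0" for \<mu> :: "('m \<times> 'k) signed_measure"
  define Nr where "Nr \<mu> = T \<mu> - Pr \<mu>" for \<mu>
  have Pr_S: "Pr \<mu> \<in> ?S" for \<mu> unfolding Pr_def by (rule subspace_scale[OF sub S0])
  have Nr_S: "Nr \<mu> \<in> ?S" if "\<mu> \<in> ?S" for \<mu> unfolding Nr_def by (rule subspace_diff[OF sub T_S[OF that] Pr_S])
  have T_Pr: "T (Pr \<mu>) = Pr \<mu>" for \<mu> by (simp add: Pr_def T_scaleR inv0)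
  have Pr_lin: "linear_operator_on ?S Pr"
    unfolding linear_operator_on_def using sub Pr_S by (auto simp: Pr_def scaleR_add_left)
  have Nr_lin: "linear_operator_on ?S Nr"
    unfolding linear_operator_on_def using sub Nr_S
    by (auto simp: Nr_def Pr_def T_add T_scaleR scaleR_add_left scaleR_diff_right)
  have dim: "dim (Pr ` ?S) = 1"
  proof -
    have "Pr ` ?S = span {\<mu>0}"
    proof (intro equalityI subsetI)
      fix \<nu> assume "\<nu> \<in> span {\<mu>0}"
      then obtain k where "\<nu> = k *\<^sub>R \<mu>0" by (auto simp: span_singleton)
      then have "\<nu> = Pr \<nu>" "\<nu> \<in> ?S" using mass0 subspace_scale[OF sub S0] by (auto simp: Pr_def)
      then show "\<nu> \<in> Pr ` ?S" by blast
    qed (auto simp: Pr_def span_singleton)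
    moreover have "\<mu>0 \<noteq> 0" using mass0 by auto
    then have "independent {\<mu>0}" by simp
    then have "dim (span {\<mu>0}) = card {\<mu>0}" by (rule dim_span_eq_card_independent)
    ultimately show ?thesis by simp
  qed
  obtain \<xi> K1 where \<xi>: "0 < \<xi>" "\<xi> < 1" "0 < K1" and decay:
    "\<forall>(\<mu> :: ('m \<times> 'k) signed_measure) s b h H n. fibre_rep m1 \<mu> s \<longrightarrow> 0 \<le> b \<longrightarrow> 0 \<le> H \<longrightarrow>
      (AE x in m1. wbound \<zeta> 1 b (s x)) \<longrightarrow> h \<in> holder_fun \<zeta> \<longrightarrow> (AE x in m1. h x = smeasure (s x) UNIV) \<longrightarrow>
      holder_norm \<zeta> h \<le> ennreal H \<longrightarrow> (LINT x|m1. h x) = 0 \<longrightarrow> n \<ge> 1 \<longrightarrow>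
      Sinf_norm \<zeta> m1 ((T ^^ n) \<mu>) \<le> ennreal (K1 * \<xi> ^ n * (H + b))"
    unfolding T_def by (rule exponential_decay[OF M(2) K zeta(1) G'm G1(1,2) contr r gap'])
  \<comment> \<open>The identity starts at \<open>n = 1\<close>; for \<open>n = 0\<close> the left
    side still contains the projection. Afterwards every iterate has total mass zero, and there
    \<open>Nr\<close> acts as \<open>T\<close>.\<close>
  have N_pow: "(Nr ^^ n) \<mu> = (T ^^ n) (\<mu> - Pr \<mu>)" if n: "n \<ge> 1" for n \<mu>
    using n
  proof (induction n rule: nat_induct_at_least)
    case base
    show ?case by (simp add: Nr_def T_diff T_Pr)
  next
    case (Suc n)
    have "smeasure ((T ^^ n) \<nu>) UNIV = smeasure \<nu> UNIV" for \<nu> by (induction n) (simp_all add: T_mass)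
    then have "Pr ((T ^^ n) (\<mu> - Pr \<mu>)) = 0" by (simp add: Pr_def mass0)
    then show ?case using Suc.IH by (simp add: Nr_def)
  qed
  \<comment> \<open>The factor 3 arises from removing the projection: the density then has Hoelder
    norm at most \<open>2 * H\<close> and the fibres are bounded by \<open>b + H\<close>, in total
    at most \<open>3 * (H + b)\<close>.\<close>
  have bound: "Sinf_norm \<zeta> m1 ((Nr ^^ n) \<mu>) \<le> ennreal (3 * K1 * \<xi> ^ n) * Sinf_norm \<zeta> m1 \<mu>"
    if n: "n \<ge> 1" and \<mu>: "\<mu> \<in> ?S" for n \<mu>
    unfolding Sinf_norm_def[of _ _ \<mu>]
  proof (rule ennreal_le_mult_INF_add)
    define b where "b = enn2real (Linf_norm \<zeta> m1 \<mu>)"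
    note A = Sinf_spaceD[OF K zeta(1) bp \<mu>, folded b_def]
    have b: "0 \<le> b" by (simp add: b_def)
    show "0 < 3 * K1 * \<xi> ^ n" using \<xi> by simp
    show "Linf_norm \<zeta> m1 \<mu> < \<infinity>" unfolding A(3) by simp
    fix h assume h0: "h \<in> holder_versions \<zeta> m1 (signed_density m1 \<mu>)"
    note h = conjunct1[OF A(6)[OF h0]] conjunct2[OF A(6)[OF h0]]
    define H where "H = enn2real (holder_norm \<zeta> h)"
    have H: "holder_norm \<zeta> h = ennreal H" "0 \<le> H"
      using holder_norm_finite[OF M(2) zeta(1) h(1)] by (auto simp: H_def)
    have hb: "\<bar>h x\<bar> \<le> H" for x using holder_norm_bound[of \<zeta> h H] H by simp
    have hm: "h \<in> borel_measurable borel" by (rule holder_fun_measurable[OF zeta(1) h(1)])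
    have hi: "integrable m1 h" by (rule bounded_integrable[OF finite_measure_axioms sets_m1 hm hb])
    define c where "c = smeasure \<mu> UNIV"
    \<comment> \<open>The total mass is the mean of the density, so \<open>h - c\<close> has mean
      zero, as the decay estimate requires.\<close>
    have c: "c = (LINT x|m1. h x)"
      unfolding c_def fibre_rep_mass[OF A(2)]
      using h(2) by (intro integral_cong_AE borel_measurable_sets_eq[OF sets_m1] fibre_rep_measurable[OF A(2)] hm)
        (auto elim: eventually_mono)
    have "\<bar>LINT x|m1. h x\<bar> \<le> (LINT x|m1. \<bar>h x\<bar>)" by (rule integral_abs_bound)
    also have "\<dots> \<le> (LINT x|m1. H)" using hi hb by (intro integral_mono) auto
    finally have cH: "\<bar>c\<bar> \<le> H" using prob_space by (simp add: c)
    \<comment> \<open>The difference is written as a sum with a negative multiple, the form in which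
      representing families combine.\<close>
    have "fibre_rep m1 (\<mu> + (- c) *\<^sub>R \<mu>0) (\<lambda>x. restriction m1 \<mu> x + (- c) *\<^sub>R signed_of (a x))"
      by (intro fibre_rep_add[OF bp] A(2) fibre_rep_scaleR rep0)
    then have rep: "fibre_rep m1 (\<mu> - Pr \<mu>) (\<lambda>x. restriction m1 \<mu> x + (- c) *\<^sub>R signed_of (a x))"
      by (simp add: Pr_def c_def)
    have "Sinf_norm \<zeta> m1 ((T ^^ n) (\<mu> - Pr \<mu>)) \<le> ennreal (K1 * \<xi> ^ n * (2 * H + (b + H)))"
    proof (rule decay[rule_format, OF rep _ _ _ _ _ _ _ n])
      show "AE x in m1. wbound \<zeta> 1 (b + H) (restriction m1 \<mu> x + (- c) *\<^sub>R signed_of (a x))"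
        using A(4) wb0
      proof eventually_elim
        case (elim x)
        from wbound_add[OF zeta(1) elim(1) wbound_scaleR[OF zeta(1) elim(2), of "- c"]]
        show ?case by (rule wbound_antimono) (use cH in auto)
      qed
      show "(\<lambda>x. h x - c) \<in> holder_fun \<zeta>"
        using holder_fun_add[OF h(1) holder_fun_const[of "- c"]] by simp
      show "AE x in m1. h x - c = smeasure (restriction m1 \<mu> x + (- c) *\<^sub>R signed_of (a x)) UNIV"
        using h(2) by eventually_elim (simp add: a1)
      show "holder_norm \<zeta> (\<lambda>x. h x - c) \<le> ennreal (2 * H)"
        using H cH by (intro holder_norm_diff_const) simp_all
      show "(LINT x|m1. h x - c) = 0" using hi prob_space by (simp add: c)
    qed (use H b in auto)
    also have "\<dots> \<le> ennreal (3 * K1 * \<xi> ^ n * (H + b))"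
    proof (rule ennreal_leI)
      have "K1 * \<xi> ^ n * (2 * H + (b + H)) \<le> K1 * \<xi> ^ n * (3 * (H + b))"
        using \<xi> H b by (intro mult_left_mono) auto
      also have "\<dots> = 3 * K1 * \<xi> ^ n * (H + b)" by (simp only: mult_ac)
      finally show "K1 * \<xi> ^ n * (2 * H + (b + H)) \<le> 3 * K1 * \<xi> ^ n * (H + b)" .
    qed
    also have "\<dots> = ennreal (3 * K1 * \<xi> ^ n) * (ennreal H + ennreal b)"
      using \<xi> H b by (simp add: ennreal_mult flip: ennreal_plus)
    finally show "Sinf_norm \<zeta> m1 ((Nr ^^ n) \<mu>) \<le> ennreal (3 * K1 * \<xi> ^ n) * (holder_norm \<zeta> h + Linf_norm \<zeta> m1 \<mu>)"
      unfolding N_pow[OF n] H(1) A(3) .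
  qed
  show ?thesis
  proof (rule exI[of _ Pr], rule exI[of _ Nr], intro conjI ballI)
    show "linear_operator_on ?S Pr" "linear_operator_on ?S Nr" "dim (Pr ` ?S) = 1" by (fact Pr_lin Nr_lin dim)+
    show "pushforward F \<mu> \<in> ?S" "pushforward F \<mu> = Pr \<mu> + Nr \<mu>" if "\<mu> \<in> ?S" for \<mu>
      using F_T[OF that] T_S[OF that] by (simp_all add: Nr_def)
    show "Pr (Pr \<mu>) = Pr \<mu>" "Pr (Nr \<mu>) = 0" "Nr (Pr \<mu>) = 0" for \<mu>
      by (simp_all add: Nr_def T_Pr) (simp_all add: Pr_def mass0 T_mass)
    show "\<exists>\<xi> K0. 0 < \<xi> \<and> \<xi> < 1 \<and> 0 < K0 \<and> (\<forall>n\<ge>1. \<forall>\<mu>\<in>?S.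
        Sinf_norm \<zeta> m1 ((Nr ^^ n) \<mu>) \<le> ennreal (K0 * \<xi> ^ n) * Sinf_norm \<zeta> m1 \<mu>)"
      using \<xi> bound by (intro exI[of _ \<xi>] exI[of _ "3 * K1"]) auto
  qed
qed

end
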